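(* Let $n,m\in\mathbb Z_{\ge 0}$, $d\ge 1$, and let $a,b,p,q\in\mathbb Z_{>0}$ satisfy $a,b\le m$, $a\ge p-n$, $b\ge q-n$. Let $\alpha=\overline{(a^p)}$ and $\beta=\overline{(b^q)}$ be the highest weights labeled by the rectangles $(a^p)$ ($p$ rows of $a$ boxes) and $(b^q)$ ($q$ rows of $b$ boxes), let $M=L(\alpha)$, $N=L(\beta)$, and let $\rho':\mathcal G_d\to\operatorname{End}_{\mathfrak{gl}(n|m)}(L(\alpha)\otimes L(\beta)\otimes V^{\otimes d})$ be the algebra homomorphism described in the context. Then the additional defining relations of the extended degenerate two boundary Hecke algebra $\mathcal H^{\mathrm{ext}}_d$ hold in the image of $\rho'$; hence $\rho'$ induces a well-defined algebra homomorphism $$\Psi:\mathcal H^{\mathrm{ext}}_d\to\operatorname{End}_{\mathfrak{gl}(n|m)}(L(\alpha)\otimes L(\beta)\otimes V^{\otimes d}).$$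
   Context: Everything is over $\mathbb{C}$; modules are supermodules. For $1\le i\le n+m$ put $\overline i=\overline 0$ if $i\le n$ and $\overline i=\overline 1$ if $i>n$. $\mathfrak g=\mathfrak{gl}(n|m)$ is the Lie superalgebra of $(n+m)\times(n+m)$ matrices, $E_{ij}$ having parity $\overline i+\overline j$, with bracket $[x,y]=xy-(-1)^{\overline x\,\overline y}yx$. $\mathfrak h$ is the diagonal Cartan subalgebra, $\epsilon_i\in\mathfrak h^*$ is dual to $E_{ii}$, positive roots are $\epsilon_i-\epsilon_j$ ($i<j$). $V$ is the natural module with basis $e_1,\dots,e_{n+m}$, $e_i$ of parity $\overline i$. Tensor products of modules use $\Delta(x)=x\otimes 1+1\otimes x$ with the usual super sign rule. A hook partition is a partition $\lambda=(\lambda_1\ge\lambda_2\ge\cdots)$ with $\lambda_{n+1}\le m$. It determines the weight $\overline\lambda=\sum_{i=1}^n\lambda_i\epsilon_i+\sum_{j=1}^m\nu_j\epsilon_{n+j}$, where $\nu$ is the transpose of the partition $(\lambda_{n+1},\lambda_{n+2},\dots)$. $L(\overline\lambda)$ is the irreducible $\mathfrak g$-module of highest weight $\overline\lambda$; it is a direct summand of some $V^{\otimes s}$. The Casimir element is $\kappa=\sum_{i,j}(-1)^{\overline j}E_{ij}E_{ji}\in U(\mathfrak g)$, which is central; $\kappa_V$ is the scalar by which it acts on $V$. On $M\otimes N\otimes V^{\otimes d}$: $\kappa_M$, $\kappa_N$, $\kappa_{M\otimes N}$ denote $\kappa$ acting on $M$, on $N$, on $M\otimes N$; for $0\le i\le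 d$, $\kappa_{M,i}$ (resp. $\kappa_{N,i}$, $\kappa_{M\otimes N,i}$) is $\kappa$ acting via iterated comultiplication on the tensor product of $M$ (resp. $N$, $M\otimes N$) with the first $i$ copies of $V$, identity on the other factors. The degenerate two boundary braid algebra $\mathcal G_d$ is the associative unital $\mathbb C$-algebra generated by $\mathbb C[x_1,\dots,x_d]$, $\mathbb C[y_1,\dots,y_d]$, $\mathbb C[z_0,\dots,z_d]$ and $\mathbb C\Sigma_d$ (simple transpositions $t_1,\dots,t_{d-1}$), subject to: (R1) $x_it_j=t_jx_i$, $y_it_j=t_jy_i$, $z_it_j=t_jz_i$ whenever $i\ne j,j+1$; (R2) $z_0+\cdots+z_i$ commutes with $x_j$ and with $y_j$ for $i\ge j$; (R3) $t_i$ commutes with $x_i+x_{i+1}$ and with $y_i+y_{i+1}$ for $1\le i\le d-1$; (R4) $t_it_{i+1}(x_{i+1}-t_ix_it_i)t_{i+1}t_i=x_{i+2}-t_{i+1}x_{i+1}t_{i+1}$ and the same with $y$ in place of $x$, for $1\le i\le d-2$; (R5) $x_{i+1}-t_ix_it_i=y_{i+1}-t_iy_it_i$ for $1\le i\le d-1$; (R6) $z_i=x_i+y_i-m_i$ for $1\le i\le d$, where $m_j=\sum_{i=1}^{j-1}m_{i,j}$, $m_{i,i+1}=x_{i+1}-t_ix_it_i$, $m_{i,j}=t_{(i\,j-1)}m_{j-1,j}t_{(i\,j-1)}$ for $j>i+1$, $t_{(i\,j)}$ being the transposition of $i$ and $j$. The homomorphism $\rho'$ is given by: $t_i\mapsto$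 the signed swap $v\otimes w\mapsto(-1)^{\overline v\,\overline w}w\otimes v$ on the $i$-th and $(i+1)$-st copies of $V$; $x_i\mapsto\frac12(\kappa_{M,i}-\kappa_{M,i-1}-\kappa_V)$; $y_i\mapsto\frac12(\kappa_{N,i}-\kappa_{N,i-1}-\kappa_V)$; $z_i\mapsto\frac12(\kappa_{M\otimes N,i}-\kappa_{M\otimes N,i-1}-\kappa_V)$ for $1\le i\le d$; $z_0\mapsto\frac12(\kappa_{M\otimes N}-\kappa_M-\kappa_N)$. The extended degenerate two boundary Hecke algebra $\mathcal H^{\mathrm{ext}}_d$ (depending on $a,b,p,q$) is the quotient of $\mathcal G_d$ by the additional relations $(x_1-a)(x_1+p)=0$, $(y_1-b)(y_1+q)=0$, $x_{i+1}=t_ix_it_i+t_i$ and $y_{i+1}=t_iy_it_i+t_i$ for $1\le i\le d-1$. *)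

theory Defs
  imports
    "HOL-Algebra.QuotRing"
    "HOL-Algebra.Module"
    "HOL-Library.Poly_Mapping"
    "HOL-Library.Z2"
    "HOL-Library.FuncSet"
    "Jordan_Normal_Form.Matrix"
begin

section \<open>Complex vector spaces and their tensor product\<close>

class scaleC =
  fixes scaleC :: "complex \<Rightarrow> 'a \<Rightarrow> 'a"  (infixr \<open>*\<^sub>C\<close> 75)

class complex_vector = scaleC + ab_group_add +
  assumes scaleC_add_right: "c *\<^sub>C (u + v) = c *\<^sub>C u + c *\<^sub>C v"
    and scaleC_add_left: "(c + e) *\<^sub>C v = c *\<^sub>C v + e *\<^sub>C v"
    and scaleC_scaleC: "c *\<^sub>C e *\<^sub>C v = (c * e) *\<^sub>C v"
    and scaleC_one: "1 *\<^sub>C v = v"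

interpretation complex_vector: vector_space "scaleC :: complex \<Rightarrow> 'a \<Rightarrow> 'a::complex_vector"
  by unfold_locales (simp_all add: scaleC_add_right scaleC_add_left scaleC_scaleC scaleC_one)

abbreviation clinear :: "('a::complex_vector \<Rightarrow> 'b::complex_vector) \<Rightarrow> bool" where
  "clinear \<equiv> Vector_Spaces.linear scaleC scaleC"

abbreviation csubspace :: "'a::complex_vector set \<Rightarrow> bool" where
  "csubspace \<equiv> module.subspace scaleC"

definition fscale :: "complex \<Rightarrow> ('k \<Rightarrow>\<^sub>0 complex) \<Rightarrow> ('k \<Rightarrow>\<^sub>0 complex)" where
  "fscale c f = Poly_Mapping.map ((*) c) f"

lemma lookup_fscale: "Poly_Mapping.lookup (fscale c f) k = c * Poly_Mapping.lookup f k"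
  unfolding fscale_def by transfer (auto simp: when_def)

interpretation free_vs: vector_space fscale
  by unfold_locales
    (auto intro!: poly_mapping_eqI simp: lookup_fscale lookup_add algebra_simps)

lemma fscale_single: "fscale c (Poly_Mapping.single k e) = Poly_Mapping.single k (c * e)"
  by (auto intro!: poly_mapping_eqI simp: lookup_fscale lookup_single when_def)

text \<open>The tensor product is the quotient of the free vector space on pairs by the span of the
  bilinearity relators.\<close>

definition tensor_relators :: "('a::complex_vector \<times> 'b::complex_vector \<Rightarrow>\<^sub>0 complex) set" where
  "tensor_relators =
     {Poly_Mapping.single (u + u', v) 1 - Poly_Mapping.single (u, v) 1
        - Poly_Mapping.single (u', v) 1 | u u' v. True}
   \<union> {Poly_Mapping.single (u, v + v') 1 - Poly_Mapping.single (u, v) 1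
        - Poly_Mapping.single (u, v') 1 | u v v'. True}
   \<union> {Poly_Mapping.single (c *\<^sub>C u, v) 1 - Poly_Mapping.single (u, v) c | c u v. True}
   \<union> {Poly_Mapping.single (u, c *\<^sub>C v) 1 - Poly_Mapping.single (u, v) c | c u v. True}"

definition tensor_eq ::
  "('a::complex_vector \<times> 'b::complex_vector \<Rightarrow>\<^sub>0 complex) \<Rightarrow> ('a \<times> 'b \<Rightarrow>\<^sub>0 complex) \<Rightarrow> bool" where
  "tensor_eq f g \<longleftrightarrow> f - g \<in> module.span fscale tensor_relators"

lemma equivp_tensor_eq:
  "equivp (tensor_eq :: ('a::complex_vector \<times> 'b::complex_vector \<Rightarrow>\<^sub>0 complex) \<Rightarrow> _)"
proof (rule equivpI)
  show "reflp tensor_eq"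
    by (simp add: reflp_def tensor_eq_def free_vs.span_zero)
  show "symp tensor_eq"
    unfolding symp_def tensor_eq_def
    by (metis free_vs.span_neg minus_diff_eq)
  show "transp (tensor_eq :: ('a \<times> 'b \<Rightarrow>\<^sub>0 complex) \<Rightarrow> _)"
    unfolding transp_def tensor_eq_def
  proof (intro allI impI)
    fix f g h :: "'a \<times> 'b \<Rightarrow>\<^sub>0 complex"
    assume "f - g \<in> free_vs.span tensor_relators" "g - h \<in> free_vs.span tensor_relators"
    from free_vs.span_add[OF this] show "f - h \<in> free_vs.span tensor_relators" by simp
  qed
qed

quotient_type (overloaded) ('a, 'b) tensor =
  "'a::complex_vector \<times> 'b::complex_vector \<Rightarrow>\<^sub>0 complex" / tensor_eq
  by (rule equivp_tensor_eq)

instantiation tensor :: (complex_vector, complex_vector) complex_vector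
begin

lift_definition zero_tensor :: "('a, 'b) tensor" is 0 .

lift_definition plus_tensor :: "('a, 'b) tensor \<Rightarrow> ('a, 'b) tensor \<Rightarrow> ('a, 'b) tensor" is "(+)"
  unfolding tensor_eq_def by (metis add_diff_add free_vs.span_add)

lift_definition uminus_tensor :: "('a, 'b) tensor \<Rightarrow> ('a, 'b) tensor" is uminus
  unfolding tensor_eq_def
  by (metis free_vs.span_neg minus_diff_minus)

lift_definition minus_tensor :: "('a, 'b) tensor \<Rightarrow> ('a, 'b) tensor \<Rightarrow> ('a, 'b) tensor" is "(-)"
  unfolding tensor_eq_def
proof -
  fix f f' g g' :: "'a \<times> 'b \<Rightarrow>\<^sub>0 complex"
  assume "f - f' \<in> free_vs.span tensor_relators" "g - g' \<in> free_vs.span tensor_relators"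
  from free_vs.span_diff[OF this] show "f - g - (f' - g') \<in> free_vs.span tensor_relators"
    by (simp add: algebra_simps)
qed

lift_definition scaleC_tensor :: "complex \<Rightarrow> ('a, 'b) tensor \<Rightarrow> ('a, 'b) tensor" is fscale
  unfolding tensor_eq_def by (metis free_vs.scale_right_diff_distrib free_vs.span_scale)

lemma tensor_eq_refl: "tensor_eq f f"
  by (rule equivp_reflp[OF equivp_tensor_eq])

instance
  by standard (transfer, simp add: tensor_eq_refl algebra_simps free_vs.scale_right_distrib
    free_vs.scale_left_distrib)+

end

lift_definition pure_tensor ::
  "'a::complex_vector \<Rightarrow> 'b::complex_vector \<Rightarrow> ('a, 'b) tensor"  (infixl \<open>\<otimes>\<^sub>t\<close> 70)
  is "\<lambda>u v. Poly_Mapping.single (u, v) 1" .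

definition free_lift ::
  "('a \<Rightarrow> 'b \<Rightarrow> 'c::complex_vector) \<Rightarrow> ('a \<times> 'b \<Rightarrow>\<^sub>0 complex) \<Rightarrow> 'c" where
  "free_lift \<beta> f = (\<Sum>(u, v) \<in> Poly_Mapping.keys f. Poly_Mapping.lookup f (u, v) *\<^sub>C \<beta> u v)"

text \<open>The linear map out of the tensor product induced by a bilinear map; by
  \<open>tensor_lift_pure\<close> and \<open>clinear_tensor_lift\<close> the chosen representative is immaterial.\<close>

definition tensor_lift ::
  "('a::complex_vector \<Rightarrow> 'b::complex_vector \<Rightarrow> 'c::complex_vector) \<Rightarrow> ('a, 'b) tensor \<Rightarrow> 'c" where
  "tensor_lift \<beta> t = free_lift \<beta> (rep_tensor t)"

definition tensor_map ::
  "('a::complex_vector \<Rightarrow> 'c::complex_vector) \<Rightarrow> ('b::complex_vector \<Rightarrow> 'd::complex_vector)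
    \<Rightarrow> ('a, 'b) tensor \<Rightarrow> ('c, 'd) tensor" where
  "tensor_map f g = tensor_lift (\<lambda>u v. f u \<otimes>\<^sub>t g v)"

definition cbilinear :: "('a::complex_vector \<Rightarrow> 'b::complex_vector \<Rightarrow> 'c::complex_vector) \<Rightarrow> bool" where
  "cbilinear \<beta> \<longleftrightarrow> (\<forall>v. clinear (\<lambda>u. \<beta> u v)) \<and> (\<forall>u. clinear (\<beta> u))"

lemma free_lift_superset:
  assumes "finite S" "Poly_Mapping.keys f \<subseteq> S"
  shows "free_lift \<beta> f = (\<Sum>(u, v)\<in>S. Poly_Mapping.lookup f (u, v) *\<^sub>C \<beta> u v)"
  unfolding free_lift_def using assms
  by (intro sum.mono_neutral_left) (auto simp: in_keys_iff)

lemma free_lift_add: "free_lift \<beta> (f + g) = free_lift \<beta> f + free_lift \<beta> g"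
proof -
  let ?S = "Poly_Mapping.keys f \<union> Poly_Mapping.keys g"
  have "finite ?S" by simp
  moreover have "Poly_Mapping.keys (f + g) \<subseteq> ?S" by (rule Poly_Mapping.keys_add)
  ultimately show ?thesis
    by (simp add: free_lift_superset[of ?S] lookup_add scaleC_add_left case_prod_unfold
        flip: sum.distrib)
qed

lemma free_lift_fscale: "free_lift \<beta> (fscale c f) = c *\<^sub>C free_lift \<beta> f"
proof -
  have "Poly_Mapping.keys (fscale c f) \<subseteq> Poly_Mapping.keys f"
    by (auto simp: in_keys_iff lookup_fscale)
  then show ?thesis
    by (simp add: free_lift_superset[of "Poly_Mapping.keys f"] lookup_fscale case_prod_unfold
        complex_vector.scale_sum_right scaleC_scaleC)
qed

lemma free_lift_diff: "free_lift \<beta> (f - g) = free_lift \<beta> f - free_lift \<beta> g"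
  using free_lift_add[of \<beta> "f - g" g] by (simp add: algebra_simps)

lemma free_lift_single: "free_lift \<beta> (Poly_Mapping.single (u, v) c) = c *\<^sub>C \<beta> u v"
  by (simp add: free_lift_superset[of "{(u, v)}"])

lemma free_lift_null:
  assumes "cbilinear \<beta>" "f \<in> free_vs.span tensor_relators"
  shows "free_lift \<beta> f = 0"
  using assms(2)
proof (induction rule: free_vs.span_induct_alt)
  case base
  show ?case by (simp add: free_lift_def)
next
  case (step c r f)
  have l: "\<beta> (u + u') v = \<beta> u v + \<beta> u' v" "\<beta> (e *\<^sub>C u) v = e *\<^sub>C \<beta> u v"
      "\<beta> u (v + v') = \<beta> u v + \<beta> u v'" "\<beta> u (e *\<^sub>C v) = e *\<^sub>C \<beta> u v" for e u u' v v'
    using assms(1) unfolding cbilinear_def Vector_Spaces.linear_iff by auto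
  have "free_lift \<beta> r = 0"
    using step(1) unfolding tensor_relators_def
    by (auto simp: free_lift_diff free_lift_single l scaleC_one)
  with step show ?case by (simp add: free_lift_add free_lift_fscale)
qed

lemma tensor_lift_abs:
  assumes "cbilinear \<beta>"
  shows "tensor_lift \<beta> (abs_tensor f) = free_lift \<beta> f"
proof -
  have "tensor_eq (rep_tensor (abs_tensor f)) f"
    by (rule Quotient3_rep_abs[OF Quotient3_tensor tensor_eq_refl])
  then show ?thesis
    using free_lift_null[OF assms, of "rep_tensor (abs_tensor f) - f"]
    by (simp add: tensor_lift_def tensor_eq_def free_lift_diff)
qed

lemma tensor_lift_pure: "cbilinear \<beta> \<Longrightarrow> tensor_lift \<beta> (u \<otimes>\<^sub>t v) = \<beta> u v"
  by (simp add: pure_tensor.abs_eq tensor_lift_abs free_lift_single scaleC_one)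

lemma clinear_tensor_lift:
  assumes "cbilinear \<beta>"
  shows "clinear (tensor_lift \<beta>)"
proof -
  have "tensor_lift \<beta> (s + t) = tensor_lift \<beta> s + tensor_lift \<beta> t" for s t
    by (induct s rule: tensor.abs_induct, induct t rule: tensor.abs_induct)
      (simp add: plus_tensor.abs_eq tensor_lift_abs[OF assms] free_lift_add)
  moreover have "tensor_lift \<beta> (c *\<^sub>C t) = c *\<^sub>C tensor_lift \<beta> t" for c t
    by (induct t rule: tensor.abs_induct) (simp add: scaleC_tensor.abs_eq tensor_lift_abs[OF assms] free_lift_fscale)
  ultimately show ?thesis
    by (simp add: Vector_Spaces.linear_iff complex_vector.vector_space_axioms)
qed

lemma cbilinear_pure: "cbilinear ((\<otimes>\<^sub>t) :: 'a::complex_vector \<Rightarrow> 'b::complex_vector \<Rightarrow> _)"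
proof -
  have eq: "abs_tensor f = abs_tensor g" if "f - g \<in> free_vs.span tensor_relators"
    for f g :: "'a \<times> 'b \<Rightarrow>\<^sub>0 complex"
    using that by (simp add: tensor.abs_eq_iff tensor_eq_def)
  have rel:
      "Poly_Mapping.single (u + u', v) 1 - Poly_Mapping.single (u, v) 1
         - Poly_Mapping.single (u', v) 1 \<in> tensor_relators"
      "Poly_Mapping.single (u, v + v') 1 - Poly_Mapping.single (u, v) 1
         - Poly_Mapping.single (u, v') 1 \<in> tensor_relators"
      "Poly_Mapping.single (c *\<^sub>C u, v) 1 - Poly_Mapping.single (u, v) c \<in> tensor_relators"
      "Poly_Mapping.single (u, c *\<^sub>C v) 1 - Poly_Mapping.single (u, v) c \<in> tensor_relators"
    for c and u u' :: 'a and v v' :: 'b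
    unfolding tensor_relators_def by blast+
  have "(u + u') \<otimes>\<^sub>t v = u \<otimes>\<^sub>t v + u' \<otimes>\<^sub>t v" for u u' :: 'a and v :: 'b
    unfolding pure_tensor.abs_eq plus_tensor.abs_eq
    by (rule eq, rule free_vs.span_base) (use rel(1)[of u u' v] in \<open>simp add: diff_diff_eq\<close>)
  moreover have "u \<otimes>\<^sub>t (v + v') = u \<otimes>\<^sub>t v + u \<otimes>\<^sub>t v'" for u :: 'a and v v' :: 'b
    unfolding pure_tensor.abs_eq plus_tensor.abs_eq
    by (rule eq, rule free_vs.span_base) (use rel(2)[of u v v'] in \<open>simp add: diff_diff_eq\<close>)
  moreover have "(c *\<^sub>C u) \<otimes>\<^sub>t v = c *\<^sub>C (u \<otimes>\<^sub>t v)" for c and u :: 'a and v :: 'b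
    unfolding pure_tensor.abs_eq scaleC_tensor.abs_eq fscale_single
    by (rule eq, rule free_vs.span_base) (use rel(3)[of c u v] in simp)
  moreover have "u \<otimes>\<^sub>t (c *\<^sub>C v) = c *\<^sub>C (u \<otimes>\<^sub>t v)" for c and u :: 'a and v :: 'b
    unfolding pure_tensor.abs_eq scaleC_tensor.abs_eq fscale_single
    by (rule eq, rule free_vs.span_base) (use rel(4)[of u c v] in simp)
  ultimately show ?thesis
    by (simp add: cbilinear_def Vector_Spaces.linear_iff complex_vector.vector_space_axioms)
qed

lemma cbilinear_compose:
  fixes f :: "'a::complex_vector \<Rightarrow> 'c::complex_vector" and g :: "'b::complex_vector \<Rightarrow> 'd::complex_vector"
  assumes "clinear f" "clinear g"
  shows "cbilinear (\<lambda>u v. f u \<otimes>\<^sub>t g v)"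
  using assms cbilinear_pure[where 'a = 'c and 'b = 'd]
  by (simp add: cbilinear_def Vector_Spaces.linear_iff complex_vector.vector_space_axioms)

lemma tensor_map_pure: "clinear f \<Longrightarrow> clinear g \<Longrightarrow> tensor_map f g (u \<otimes>\<^sub>t v) = f u \<otimes>\<^sub>t g v"
  by (simp add: tensor_map_def tensor_lift_pure cbilinear_compose)

section \<open>Supermodules over the general linear Lie superalgebra\<close>

text \<open>All matrix indices and all labels of the basis of the natural module are shifted by one:
  they range over \<open>{..<n + m}\<close>, and index \<open>i\<close> is even iff \<open>i < n\<close>.\<close>

definition par :: "nat \<Rightarrow> nat \<Rightarrow> bit" where
  "par n i = (if i < n then 0 else 1)"

text \<open>\<open>par_sign s\<close> is \<open>(-1)^s\<close>.\<close>

definition par_sign :: "bit \<Rightarrow> complex" where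
  "par_sign s = (if s = 0 then 1 else - 1)"

definition mat_E :: "nat \<Rightarrow> nat \<Rightarrow> nat \<Rightarrow> nat \<Rightarrow> complex mat" where
  "mat_E n m i j = mat (n + m) (n + m) (\<lambda>rc. if rc = (i, j) then 1 else 0)"

definition gl :: "nat \<Rightarrow> nat \<Rightarrow> complex mat set" where
  "gl n m = carrier_mat (n + m) (n + m)"

definition gl_hom :: "nat \<Rightarrow> nat \<Rightarrow> bit \<Rightarrow> complex mat set" where
  "gl_hom n m s =
     {x \<in> gl n m. \<forall>i < n + m. \<forall>j < n + m. x $$ (i, j) \<noteq> 0 \<longrightarrow> par n i + par n j = s}"

definition gl_bracket :: "bit \<Rightarrow> bit \<Rightarrow> complex mat \<Rightarrow> complex mat \<Rightarrow> complex mat" where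
  "gl_bracket s r x y = x * y - par_sign (s * r) \<cdot>\<^sub>m (y * x)"

text \<open>The underlying space of a supermodule is a whole type; \<open>hcomp M s\<close> is its subspace of
  homogeneous elements of parity \<open>s\<close>.\<close>

record 'a supermod =
  hcomp :: "bit \<Rightarrow> 'a set"
  act :: "complex mat \<Rightarrow> 'a \<Rightarrow> 'a"

definition gl_supermodule :: "nat \<Rightarrow> nat \<Rightarrow> 'a::complex_vector supermod \<Rightarrow> bool" where
  "gl_supermodule n m M \<longleftrightarrow>
     (\<forall>s. csubspace (hcomp M s)) \<and>
     (\<forall>v. \<exists>!u. u \<in> hcomp M 0 \<and> v - u \<in> hcomp M 1) \<and>
     (\<forall>x \<in> gl n m. clinear (act M x)) \<and>
     (\<forall>x \<in> gl n m. \<forall>y \<in> gl n m. \<forall>v. act M (x + y) v = act M x v + act M y v) \<and>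
     (\<forall>c. \<forall>x \<in> gl n m. \<forall>v. act M (c \<cdot>\<^sub>m x) v = c *\<^sub>C act M x v) \<and>
     (\<forall>s r. \<forall>x \<in> gl_hom n m s. \<forall>v \<in> hcomp M r. act M x v \<in> hcomp M (s + r)) \<and>
     (\<forall>s r. \<forall>x \<in> gl_hom n m s. \<forall>y \<in> gl_hom n m r. \<forall>v.
        act M (gl_bracket s r x y) v
          = act M x (act M y v) - par_sign (s * r) *\<^sub>C act M y (act M x v))"

definition even_part :: "'a::complex_vector supermod \<Rightarrow> 'a \<Rightarrow> 'a" where
  "even_part M v = (THE u. u \<in> hcomp M 0 \<and> v - u \<in> hcomp M 1)"

text \<open>\<open>par_op M s\<close> multiplies a homogeneous \<open>v\<close> of parity \<open>r\<close> by \<open>(-1)^(s r)\<close>: the sign of moving an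
  element of parity \<open>s\<close> past \<open>v\<close>.\<close>

definition par_op :: "'a::complex_vector supermod \<Rightarrow> bit \<Rightarrow> 'a \<Rightarrow> 'a" where
  "par_op M s v = even_part M v + par_sign s *\<^sub>C (v - even_part M v)"

definition sub_supermodule :: "nat \<Rightarrow> nat \<Rightarrow> 'a::complex_vector supermod \<Rightarrow> 'a set \<Rightarrow> bool" where
  "sub_supermodule n m M S \<longleftrightarrow>
     csubspace S \<and> (\<forall>v \<in> S. even_part M v \<in> S) \<and> (\<forall>x \<in> gl n m. \<forall>v \<in> S. act M x v \<in> S)"

definition irreducible_supermodule :: "nat \<Rightarrow> nat \<Rightarrow> 'a::complex_vector supermod \<Rightarrow> bool" where
  "irreducible_supermodule n m M \<longleftrightarrow>
     gl_supermodule n m M \<and> (UNIV :: 'a set) \<noteq> {0} \<and>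
     (\<forall>S. sub_supermodule n m M S \<longrightarrow> S = {0} \<or> S = UNIV)"

text \<open>\<open>is_L n m w M\<close>: \<open>M\<close> is (a copy of) \<open>L(w)\<close>, where \<open>w i\<close> is the coefficient at the dual of
  \<open>mat_E n m i i\<close>. The parity of the highest weight vector is not prescribed.\<close>

definition is_L :: "nat \<Rightarrow> nat \<Rightarrow> (nat \<Rightarrow> complex) \<Rightarrow> 'a::complex_vector supermod \<Rightarrow> bool" where
  "is_L n m w M \<longleftrightarrow>
     irreducible_supermodule n m M \<and>
     (\<exists>s. \<exists>v \<in> hcomp M s. v \<noteq> 0 \<and>
        (\<forall>i j. i < j \<and> j < n + m \<longrightarrow> act M (mat_E n m i j) v = 0) \<and>
        (\<forall>i < n + m. act M (mat_E n m i i) v = w i *\<^sub>C v))"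

text \<open>A partition is a function with \<open>lam k\<close> the size of row \<open>k + 1\<close>. At the odd positions the weight
  lists the column lengths of the part of the diagram below row \<open>n\<close>.\<close>

definition hook_weight :: "nat \<Rightarrow> (nat \<Rightarrow> nat) \<Rightarrow> nat \<Rightarrow> complex" where
  "hook_weight n lam i =
     of_nat (if i < n then lam i else card {k. n \<le> k \<and> i - n < lam k})"

definition rectangle :: "nat \<Rightarrow> nat \<Rightarrow> nat \<Rightarrow> nat" where
  "rectangle a p k = (if k < p then a else 0)"

section \<open>The mixed tensor space and the Casimir operators\<close>

text \<open>\<open>V\<close> has the basis \<open>e\<^sub>0, \<dots>, e\<^sub>n\<^sub>+\<^sub>m\<^sub>-\<^sub>1\<close>, so an element of \<open>M \<otimes> N \<otimes> V\<^sup>\<otimes>\<^sup>d\<close> is a unique sum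
  \<open>\<Sum>\<^sub>w f w \<otimes> e\<^sub>w\<close> over words \<open>w\<close> of length \<open>d\<close>; it is represented by the coefficient function
  \<open>f\<close>, which has values in \<open>M \<otimes> N\<close>.\<close>

definition words :: "nat \<Rightarrow> nat \<Rightarrow> nat \<Rightarrow> nat list set" where
  "words n m d = {w. length w = d \<and> set w \<subseteq> {..<n + m}}"

definition tspace :: "nat \<Rightarrow> nat \<Rightarrow> nat \<Rightarrow> (nat list \<Rightarrow> ('a::complex_vector, 'b::complex_vector) tensor) set" where
  "tspace n m d = {f. \<forall>w. w \<notin> words n m d \<longrightarrow> f w = 0}"

definition word_par :: "nat \<Rightarrow> nat list \<Rightarrow> bit" where
  "word_par n w = sum_list (map (par n) w)"

text \<open>Tensor factors of \<open>M \<otimes> N \<otimes> V\<^sup>\<otimes>\<^sup>d\<close>; \<open>FV k\<close> is the \<open>k\<close>-th copy of \<open>V\<close>, starting from \<open>1\<close>.\<close>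

datatype factor = FM | FN | FV nat

text \<open>The action of the matrix unit \<open>E\<^sub>i\<^sub>j\<close> on a single factor, with the super sign for moving it past
  the factors to its left. As \<open>E\<^sub>i\<^sub>j e\<^sub>j = e\<^sub>i\<close>, the coefficient at a word with letter \<open>i\<close> in the
  position of that factor comes from the word with that letter replaced by \<open>j\<close>.\<close>

fun E_factor :: "nat \<Rightarrow> nat \<Rightarrow> 'a::complex_vector supermod \<Rightarrow> 'b::complex_vector supermod
    \<Rightarrow> nat \<Rightarrow> nat \<Rightarrow> factor \<Rightarrow> (nat list \<Rightarrow> ('a, 'b) tensor) \<Rightarrow> nat list \<Rightarrow> ('a, 'b) tensor" where
  "E_factor n m M N i j FM f w = tensor_map (act M (mat_E n m i j)) id (f w)"
| "E_factor n m M N i j FN f w =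
     tensor_map (par_op M (par n i + par n j)) (act N (mat_E n m i j)) (f w)"
| "E_factor n m M N i j (FV k) f w =
     (if 1 \<le> k \<and> k \<le> length w \<and> w ! (k - 1) = i
      then par_sign ((par n i + par n j) * word_par n (take (k - 1) w)) *\<^sub>C
             tensor_map (par_op M (par n i + par n j)) (par_op N (par n i + par n j))
               (f (w[k - 1 := j]))
      else 0)"

text \<open>Iterated comultiplication: \<open>E\<^sub>i\<^sub>j\<close> acting on the tensor product of the factors in \<open>S\<close>.\<close>

definition E_on :: "nat \<Rightarrow> nat \<Rightarrow> 'a::complex_vector supermod \<Rightarrow> 'b::complex_vector supermod
    \<Rightarrow> factor set \<Rightarrow> nat \<Rightarrow> nat \<Rightarrow> (nat list \<Rightarrow> ('a, 'b) tensor) \<Rightarrow> nat list \<Rightarrow> ('a, 'b) tensor" where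
  "E_on n m M N S i j f w = (\<Sum>F\<in>S. E_factor n m M N i j F f w)"

definition casimir_on :: "nat \<Rightarrow> nat \<Rightarrow> 'a::complex_vector supermod \<Rightarrow> 'b::complex_vector supermod
    \<Rightarrow> factor set \<Rightarrow> (nat list \<Rightarrow> ('a, 'b) tensor) \<Rightarrow> nat list \<Rightarrow> ('a, 'b) tensor" where
  "casimir_on n m M N S f w =
     (\<Sum>i<n + m. \<Sum>j<n + m.
        par_sign (par n j) *\<^sub>C E_on n m M N S i j (E_on n m M N S j i f) w)"

definition casimir_V :: "nat \<Rightarrow> nat \<Rightarrow> complex" where
  "casimir_V n m =
     (THE c. mat (n + m) (n + m) (\<lambda>rc. \<Sum>i<n + m. \<Sum>j<n + m.
               par_sign (par n j) * (mat_E n m i j * mat_E n m j i) $$ rc)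
             = c \<cdot>\<^sub>m 1\<^sub>m (n + m))"

section \<open>Algebras given by generators and relations\<close>

text \<open>Algebras over the complex numbers are records of type \<^typ>\<open>(complex, 'a) module\<close>; the locale
  \<^locale>\<open>algebra\<close> is not used since it requires commutativity.\<close>

definition alg_hom :: "(complex, 'a) module \<Rightarrow> (complex, 'b) module \<Rightarrow> ('a \<Rightarrow> 'b) set" where
  "alg_hom A B =
     {h \<in> Ring.ring_hom A B. \<forall>c. \<forall>x \<in> carrier A. h (c \<odot>\<^bsub>A\<^esub> x) = c \<odot>\<^bsub>B\<^esub> h x}"

definition quot_alg :: "(complex, 'a) module \<Rightarrow> 'a set \<Rightarrow> (complex, 'a set) module" where
  "quot_alg A I =
     ring.extend (A Quot I) \<lparr>smult = (\<lambda>c X. \<Union>x\<in>X. I +>\<^bsub>A\<^esub> (c \<odot>\<^bsub>A\<^esub> x))\<rparr>"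

text \<open>The monoid algebra of words with concatenation is the free algebra on the letters.\<close>

datatype 'g word = Word (letters: "'g list")

instantiation word :: (type) monoid_add
begin

definition zero_word :: "'a word" where "0 = Word []"

definition plus_word :: "'a word \<Rightarrow> 'a word \<Rightarrow> 'a word" where
  "u + v = Word (letters u @ letters v)"

instance
  by standard (auto simp: zero_word_def plus_word_def)

end

definition free_alg :: "'g set \<Rightarrow> (complex, 'g word \<Rightarrow>\<^sub>0 complex) module" where
  "free_alg G =
     \<lparr>carrier = {f. \<forall>w \<in> Poly_Mapping.keys f. set (letters w) \<subseteq> G},
      monoid.mult = (*), one = 1, zero = 0, add = (+), smult = fscale\<rparr>"

datatype gen = GX nat | GY nat | GZ nat | GT nat

type_synonym free = "gen word \<Rightarrow>\<^sub>0 complex"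

definition letter :: "gen \<Rightarrow> free" where
  "letter g = Poly_Mapping.single (Word [g]) 1"

abbreviation X :: "nat \<Rightarrow> free" where "X i \<equiv> letter (GX i)"
abbreviation Y :: "nat \<Rightarrow> free" where "Y i \<equiv> letter (GY i)"
abbreviation Z :: "nat \<Rightarrow> free" where "Z i \<equiv> letter (GZ i)"
abbreviation T :: "nat \<Rightarrow> free" where "T i \<equiv> letter (GT i)"

definition gens :: "nat \<Rightarrow> gen set" where
  "gens d = GX ` {1..d} \<union> GY ` {1..d} \<union> GZ ` {0..d} \<union> GT ` {1..<d}"

text \<open>\<open>transp i j\<close> is the transposition \<open>(i j)\<close>, for \<open>i < j\<close>, as a word in the simple ones; the first
  equation is never used.\<close>

fun transp :: "nat \<Rightarrow> nat \<Rightarrow> free" where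
  "transp i 0 = 1"
| "transp i (Suc j) = (if j \<le> i then T i else T j * transp i j * T j)"

definition m2 :: "nat \<Rightarrow> nat \<Rightarrow> free" where
  "m2 i j =
     (if j = i + 1 then X j - T i * X i * T i
      else transp i (j - 1) * (X j - T (j - 1) * X (j - 1) * T (j - 1)) * transp i (j - 1))"

definition m1 :: "nat \<Rightarrow> free" where
  "m1 j = (\<Sum>i\<in>{1..<j}. m2 i j)"

text \<open>Relations are listed as differences of their two sides. The first two sets present
  \<open>\<complex>[x\<^sub>1,\<dots>,x\<^sub>d]\<close>, \<open>\<complex>[y\<^sub>1,\<dots>,y\<^sub>d]\<close>, \<open>\<complex>[z\<^sub>0,\<dots>,z\<^sub>d]\<close> and \<open>\<complex>\<Sigma>\<^sub>d\<close>.\<close>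

definition polynomial_relators :: "nat \<Rightarrow> free set" where
  "polynomial_relators d =
     {X i * X j - X j * X i | i j. i \<in> {1..d} \<and> j \<in> {1..d}}
   \<union> {Y i * Y j - Y j * Y i | i j. i \<in> {1..d} \<and> j \<in> {1..d}}
   \<union> {Z i * Z j - Z j * Z i | i j. i \<in> {0..d} \<and> j \<in> {0..d}}"

definition symmetric_relators :: "nat \<Rightarrow> free set" where
  "symmetric_relators d =
     {T i * T i - 1 | i. i \<in> {1..<d}}
   \<union> {T i * T j - T j * T i | i j. i \<in> {1..<d} \<and> j \<in> {1..<d} \<and> i + 1 < j}
   \<union> {T i * T (i + 1) * T i - T (i + 1) * T i * T (i + 1) | i. 1 \<le> i \<and> i + 1 < d}"

definition R1 :: "nat \<Rightarrow> free set" where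
  "R1 d =
     {X i * T j - T j * X i | i j. i \<in> {1..d} \<and> j \<in> {1..<d} \<and> i \<noteq> j \<and> i \<noteq> j + 1}
   \<union> {Y i * T j - T j * Y i | i j. i \<in> {1..d} \<and> j \<in> {1..<d} \<and> i \<noteq> j \<and> i \<noteq> j + 1}
   \<union> {Z i * T j - T j * Z i | i j. i \<in> {0..d} \<and> j \<in> {1..<d} \<and> i \<noteq> j \<and> i \<noteq> j + 1}"

definition R2 :: "nat \<Rightarrow> free set" where
  "R2 d =
     {(\<Sum>k\<in>{0..i}. Z k) * X j - X j * (\<Sum>k\<in>{0..i}. Z k) | i j. 1 \<le> j \<and> j \<le> i \<and> i \<le> d}
   \<union> {(\<Sum>k\<in>{0..i}. Z k) * Y j - Y j * (\<Sum>k\<in>{0..i}. Z k) | i j. 1 \<le> j \<and> j \<le> i \<and> i \<le> d}"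

definition R3 :: "nat \<Rightarrow> free set" where
  "R3 d =
     {T i * (X i + X (i + 1)) - (X i + X (i + 1)) * T i | i. i \<in> {1..<d}}
   \<union> {T i * (Y i + Y (i + 1)) - (Y i + Y (i + 1)) * T i | i. i \<in> {1..<d}}"

definition R4 :: "nat \<Rightarrow> free set" where
  "R4 d =
     {T i * T (i + 1) * (X (i + 1) - T i * X i * T i) * T (i + 1) * T i
        - (X (i + 2) - T (i + 1) * X (i + 1) * T (i + 1)) | i. 1 \<le> i \<and> i + 2 \<le> d}
   \<union> {T i * T (i + 1) * (Y (i + 1) - T i * Y i * T i) * T (i + 1) * T i
        - (Y (i + 2) - T (i + 1) * Y (i + 1) * T (i + 1)) | i. 1 \<le> i \<and> i + 2 \<le> d}"

definition R5 :: "nat \<Rightarrow> free set" where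
  "R5 d =
     {(X (i + 1) - T i * X i * T i) - (Y (i + 1) - T i * Y i * T i) | i. i \<in> {1..<d}}"

definition R6 :: "nat \<Rightarrow> free set" where
  "R6 d = {Z i - (X i + Y i - m1 i) | i. i \<in> {1..d}}"

definition braid_relators :: "nat \<Rightarrow> free set" where
  "braid_relators d =
     polynomial_relators d \<union> symmetric_relators d
       \<union> R1 d \<union> R2 d \<union> R3 d \<union> R4 d \<union> R5 d \<union> R6 d"

definition braid_ideal :: "nat \<Rightarrow> free set" where
  "braid_ideal d = Idl\<^bsub>free_alg (gens d)\<^esub> (braid_relators d)"

definition braid_alg :: "nat \<Rightarrow> (complex, free set) module" where
  "braid_alg d = quot_alg (free_alg (gens d)) (braid_ideal d)"

definition braid_class :: "nat \<Rightarrow> free \<Rightarrow> free set" where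
  "braid_class d f = braid_ideal d +>\<^bsub>free_alg (gens d)\<^esub> f"

definition hecke_relators :: "nat \<Rightarrow> complex \<Rightarrow> complex \<Rightarrow> complex \<Rightarrow> complex \<Rightarrow> free set" where
  "hecke_relators d a b p q =
     {(X 1 - fscale a 1) * (X 1 + fscale p 1), (Y 1 - fscale b 1) * (Y 1 + fscale q 1)}
   \<union> {X (i + 1) - (T i * X i * T i + T i) | i. i \<in> {1..<d}}
   \<union> {Y (i + 1) - (T i * Y i * T i + T i) | i. i \<in> {1..<d}}"

definition hecke_ideal :: "nat \<Rightarrow> complex \<Rightarrow> complex \<Rightarrow> complex \<Rightarrow> complex \<Rightarrow> free set set" where
  "hecke_ideal d a b p q = Idl\<^bsub>braid_alg d\<^esub> (braid_class d ` hecke_relators d a b p q)"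

definition hecke_alg ::
  "nat \<Rightarrow> complex \<Rightarrow> complex \<Rightarrow> complex \<Rightarrow> complex \<Rightarrow> (complex, free set set) module" where
  "hecke_alg d a b p q = quot_alg (braid_alg d) (hecke_ideal d a b p q)"

definition hecke_class ::
  "nat \<Rightarrow> complex \<Rightarrow> complex \<Rightarrow> complex \<Rightarrow> complex \<Rightarrow> free set \<Rightarrow> free set set" where
  "hecke_class d a b p q g = hecke_ideal d a b p q +>\<^bsub>braid_alg d\<^esub> g"

section \<open>The endomorphism algebra and the representation of the braid algebra\<close>

type_synonym ('a, 'b) top =
  "(nat list \<Rightarrow> ('a, 'b) tensor) \<Rightarrow> (nat list \<Rightarrow> ('a, 'b) tensor)"

definition all_factors :: "nat \<Rightarrow> factor set" where
  "all_factors d = {FM, FN} \<union> FV ` {1..d}"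

text \<open>The parity involution of \<open>M \<otimes> N \<otimes> V\<^sup>\<otimes>\<^sup>d\<close>.\<close>

definition tpar :: "nat \<Rightarrow> 'a::complex_vector supermod \<Rightarrow> 'b::complex_vector supermod \<Rightarrow> ('a, 'b) top" where
  "tpar n M N f w =
     par_sign (word_par n w) *\<^sub>C tensor_map (par_op M 1) (par_op N 1) (f w)"

text \<open>Endomorphisms in the category of supermodules: linear maps which preserve parity and commute with
  the action. Operators are extensional functions on the tensor space.\<close>

definition End_gl :: "nat \<Rightarrow> nat \<Rightarrow> nat \<Rightarrow> 'a::complex_vector supermod \<Rightarrow> 'b::complex_vector supermod
    \<Rightarrow> (complex, ('a, 'b) top) module" where
  "End_gl n m d M N =
     \<lparr>carrier = {F \<in> tspace n m d \<rightarrow>\<^sub>E tspace n m d.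
        (\<forall>f \<in> tspace n m d. \<forall>g \<in> tspace n m d. F (\<lambda>w. f w + g w) = (\<lambda>w. F f w + F g w)) \<and>
        (\<forall>c. \<forall>f \<in> tspace n m d. F (\<lambda>w. c *\<^sub>C f w) = (\<lambda>w. c *\<^sub>C F f w)) \<and>
        (\<forall>f \<in> tspace n m d. F (tpar n M N f) = tpar n M N (F f)) \<and>
        (\<forall>i < n + m. \<forall>j < n + m. \<forall>f \<in> tspace n m d.
           F (E_on n m M N (all_factors d) i j f) = E_on n m M N (all_factors d) i j (F f))},
      monoid.mult = compose (tspace n m d),
      one = (\<lambda>f \<in> tspace n m d. f),
      zero = (\<lambda>f \<in> tspace n m d. \<lambda>w. 0),
      add = (\<lambda>F G. \<lambda>f \<in> tspace n m d. \<lambda>w. F f w + G f w),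
      smult = (\<lambda>c F. \<lambda>f \<in> tspace n m d. \<lambda>w. c *\<^sub>C F f w)\<rparr>"

definition swap_op :: "nat \<Rightarrow> nat \<Rightarrow> ('a::complex_vector, 'b::complex_vector) top" where
  "swap_op n i f w =
     par_sign (par n (w ! (i - 1)) * par n (w ! i)) *\<^sub>C f (w[i - 1 := w ! i, i := w ! (i - 1)])"

text \<open>For \<open>S\<close> one of \<open>{FM}\<close>, \<open>{FN}\<close>, \<open>{FM, FN}\<close>: half of the Casimir element on \<open>S\<close> and the first \<open>i\<close>
  copies of \<open>V\<close>, minus that for \<open>i - 1\<close> copies, minus the scalar on \<open>V\<close>.\<close>

definition casimir_step :: "nat \<Rightarrow> nat \<Rightarrow> 'a::complex_vector supermod \<Rightarrow> 'b::complex_vector supermod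
    \<Rightarrow> factor set \<Rightarrow> nat \<Rightarrow> ('a, 'b) top" where
  "casimir_step n m M N S i f w =
     (1 / 2) *\<^sub>C (casimir_on n m M N (S \<union> FV ` {1..i}) f w
                 - casimir_on n m M N (S \<union> FV ` {1..i - 1}) f w
                 - casimir_V n m *\<^sub>C f w)"

definition casimir_zero :: "nat \<Rightarrow> nat \<Rightarrow> 'a::complex_vector supermod \<Rightarrow> 'b::complex_vector supermod
    \<Rightarrow> ('a, 'b) top" where
  "casimir_zero n m M N f w =
     (1 / 2) *\<^sub>C (casimir_on n m M N {FM, FN} f w
                 - casimir_on n m M N {FM} f w - casimir_on n m M N {FN} f w)"

fun gen_op :: "nat \<Rightarrow> nat \<Rightarrow> 'a::complex_vector supermod \<Rightarrow> 'b::complex_vector supermod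
    \<Rightarrow> gen \<Rightarrow> ('a, 'b) top" where
  "gen_op n m M N (GT i) = swap_op n i"
| "gen_op n m M N (GX i) = casimir_step n m M N {FM} i"
| "gen_op n m M N (GY i) = casimir_step n m M N {FN} i"
| "gen_op n m M N (GZ i) =
     (if i = 0 then casimir_zero n m M N else casimir_step n m M N {FM, FN} i)"

text \<open>The two conditions determine \<open>\<rho>\<close> on the carrier of the braid algebra.\<close>

definition is_rho :: "nat \<Rightarrow> nat \<Rightarrow> nat \<Rightarrow> 'a::complex_vector supermod \<Rightarrow> 'b::complex_vector supermod
    \<Rightarrow> (free set \<Rightarrow> ('a, 'b) top) \<Rightarrow> bool" where
  "is_rho n m d M N \<rho> \<longleftrightarrow>
     \<rho> \<in> alg_hom (braid_alg d) (End_gl n m d M N) \<and>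
     (\<forall>g \<in> gens d. \<rho> (braid_class d (letter g)) = restrict (gen_op n m M N g) (tspace n m d))"

end

theory Submission
  imports Defs "HOL-Library.Function_Algebras" "HOL-Combinatorics.Transposition"
begin

text \<open>Write \<open>\<Omega>\<^sub>F\<^sub>G\<close> for the split Casimir operator on two tensor factors \<open>F\<close> and \<open>G\<close>. Since
  \<open>\<kappa>\<close> on a product of factors is the sum of the Casimir operators of the factors plus twice the sum of the
  \<open>\<Omega>\<^sub>F\<^sub>G\<close>, the generator \<open>x\<^sub>i\<close> acts by \<open>\<Omega>\<^sub>M\<^sub>,\<^sub>i + \<Sum> \<Omega>\<^sub>k\<^sub>,\<^sub>i\<close> over
  \<open>k < i\<close>, and similarly for \<open>y\<^sub>i\<close> and \<open>z\<^sub>i\<close>, while \<open>t\<^sub>i = \<Omega>\<^sub>i\<^sub>,\<^sub>i\<^sub>+\<^sub>1\<close> permutes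
  the factors. All relations except the two quadratic ones follow from this and from the centrality of
  \<open>\<kappa>\<close>.

  The components of \<open>(\<Omega>\<^sub>M\<^sub>,\<^sub>1 - a)(\<Omega>\<^sub>M\<^sub>,\<^sub>1 + p)\<close> with respect to the matrix units of
  \<open>V\<close> form a tensor operator of adjoint type on \<open>M\<close>, so the vectors killed by all of them form a
  submodule. As \<open>M\<close> is irreducible, it suffices that the highest weight vector is killed; the off-diagonal
  components map it to singular vectors of a different weight, which vanish, and the diagonal ones multiply
  it by scalars, which vanish for a rectangle.\<close>

section \<open>Endomorphism rings of complex vector spaces\<close>

text \<open>The roots a and -p are the contents of the two boxes that can be added to the rectangle,
  hence the values expected of x_1 on the summands of M \<otimes> V. The proof tests them on one
  highest weight vector instead of decomposing M \<otimes> V. Nothing says that M has finite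
  dimension or is a sum of weight spaces, so the vanishing of singular vectors of another weight
  needs its own argument. A weight is replaced by one number, the eigenvalue of H = - \<Sum> i E_ii.
  Lowering operators decrease it by positive integers, and every nonzero singular vector generates M
  under lowering; each of two such vectors therefore lies below the other by a natural number, and
  the heights agree. The component of index (k, j) changes the height by j - k, which singles out
  the diagonal ones. The tensor space is a set of functions and not a type. All identities are
  therefore proved for linear maps on the functions on all words, where the projection
  \<open>P\<close> onto the tensor space plays the role of 1; operators are restricted to the tensor
  space only at the end.\<close>

class complex_alg = complex_vector + ring + monoid_mult +
  assumes scaleC_mult_left [simp]: "(c *\<^sub>C x) * y = c *\<^sub>C (x * y)"
    and scaleC_mult_right [simp]: "x * (c *\<^sub>C y) = c *\<^sub>C (x * y)"

declare scaleC_scaleC [simp] scaleC_one [simp]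

text \<open>Parities stay sums and products, so that distributivity and \<open>par_sign_add\<close>
  apply to sign exponents.\<close>

declare add_bit_eq_xor [simp del] mult_bit_eq_and [simp del]

lemmas scaleC_ring_simps =
  scaleC_add_right complex_vector.scale_right_diff_distrib complex_vector.scale_sum_right

lemma par_sign_simps [simp]:
  "par_sign 0 = 1" "par_sign 1 = - 1" "par_sign s * par_sign s = 1"
  "par_sign s * (par_sign s * c) = c"
  by (auto simp: par_sign_def)

lemma par_sign_add: "par_sign (s + r) = par_sign s * par_sign r"
  by (cases s; cases r) (simp_all add: par_sign_def)

lemma bit_self_simps [simp]:
  fixes s r :: bit
  shows "s + s = 0" "s * s = s" "s + (s + r) = r" "s * (s * r) = s * r"
  by (cases s; cases r; simp)+

lemma clinear_iff: "clinear f \<longleftrightarrow> (\<forall>u v. f (u + v) = f u + f v) \<and> (\<forall>c v. f (c *\<^sub>C v) = c *\<^sub>C f v)"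
  by (simp add: Vector_Spaces.linear_iff complex_vector.vector_space_axioms)

text \<open>Linearity inside the type yields both distributive laws, so that operator identities
  become identities in a ring.\<close>

typedef (overloaded) 'v endo = "{f :: 'v::complex_vector \<Rightarrow> 'v. clinear f}"
  morphisms app Endo
  by (rule exI[of _ id]) (simp add: clinear_iff)

setup_lifting type_definition_endo

instantiation endo :: (complex_vector) ring
begin

lift_definition zero_endo :: "'a endo" is "\<lambda>v. 0" by (simp add: clinear_iff)
lift_definition plus_endo :: "'a endo \<Rightarrow> 'a endo \<Rightarrow> 'a endo" is "\<lambda>f g v. f v + g v"
  by (simp add: clinear_iff scaleC_add_right)
lift_definition uminus_endo :: "'a endo \<Rightarrow> 'a endo" is "\<lambda>f v. - f v"
  by (simp add: clinear_iff)
lift_definition minus_endo :: "'a endo \<Rightarrow> 'a endo \<Rightarrow> 'a endo" is "\<lambda>f g v. f v - g v"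
  by (simp add: clinear_iff complex_vector.scale_right_diff_distrib)
lift_definition times_endo :: "'a endo \<Rightarrow> 'a endo \<Rightarrow> 'a endo" is "\<lambda>f g v. f (g v)"
  by (simp add: clinear_iff)

instance
  by standard (transfer; simp add: clinear_iff fun_eq_iff)+

end

instantiation endo :: (complex_vector) complex_vector
begin

lift_definition scaleC_endo :: "complex \<Rightarrow> 'a endo \<Rightarrow> 'a endo" is "\<lambda>c f v. c *\<^sub>C f v"
  by (simp add: clinear_iff scaleC_add_right mult.commute)

instance
  by standard (transfer; simp add: fun_eq_iff scaleC_add_left scaleC_add_right)+

end

lemma app_linear:
  "app f (u + v) = app f u + app f v" "app f (c *\<^sub>C v) = c *\<^sub>C app f v"
  using app[of f] by (simp_all add: clinear_iff)

lemma app_0 [simp]: "app f 0 = 0"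
  using app_linear(1)[of f 0 0] by simp

lemma app_uminus [simp]: "app f (- v) = - app f v"
  using app_linear(1)[of f v "- v"] by (simp add: eq_neg_iff_add_eq_0 add.commute)

lemma app_diff [simp]: "app f (u - v) = app f u - app f v"
  using app_linear(1)[of f "u - v" v] by simp

lemma app_ring [simp]:
  "app 0 v = 0" "app (f + g) v = app f v + app g v" "app (- f) v = - app f v"
  "app (f - g) v = app f v - app g v" "app (f * g) v = app f (app g v)" "app (c *\<^sub>C f) v = c *\<^sub>C app f v"
  by (transfer; simp)+

lemma app_sum_left: "app (\<Sum>i\<in>A. f i) v = (\<Sum>i\<in>A. app (f i) v)"
  by (induction A rule: infinite_finite_induct) simp_all

lemma endo_eqI: "(\<And>v. app f v = app g v) \<Longrightarrow> f = g"
  by (simp add: app_inject[symmetric] fun_eq_iff)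

text \<open>The endomorphisms of a zero space form the zero ring, so 0 \<noteq> 1 cannot be an
  axiom. This is why \<open>complex_alg\<close> joins \<open>ring\<close> and
  \<open>monoid_mult\<close> instead of extending \<open>ring_1\<close>.\<close>

instantiation endo :: (complex_vector) one
begin

lift_definition one_endo :: "'a endo" is "\<lambda>v. v" by (simp add: clinear_iff)

instance ..

end

lemma app_one [simp]: "app 1 v = v"
  by transfer simp

lemma app_Endo: "clinear f \<Longrightarrow> app (Endo f) = f"
  by (simp add: Endo_inverse)

instance endo :: (complex_vector) complex_alg
  by standard (rule endo_eqI; simp add: app_linear)+

text \<open>This makes the coefficient functions on all words a vector space type, to which
  \<open>endo\<close> applies; the tensor space is a subspace of it.\<close>

instantiation "fun" :: (type, complex_vector) complex_vector
begin

definition scaleC_fun :: "complex \<Rightarrow> ('a \<Rightarrow> 'b) \<Rightarrow> 'a \<Rightarrow> 'b" where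
  "scaleC_fun c f = (\<lambda>x. c *\<^sub>C f x)"

instance
  by standard (simp_all add: scaleC_fun_def fun_eq_iff scaleC_add_left scaleC_add_right)

end

section \<open>Families satisfying the relations of the general linear Lie superalgebra\<close>

text \<open>A homomorphism from the enveloping algebra is recorded by the images of the matrix
  units. The signs come from the index parities \<pi>, so the target algebra needs no
  grading.\<close>

definition gl_rep :: "nat \<Rightarrow> (nat \<Rightarrow> bit) \<Rightarrow> (nat \<Rightarrow> nat \<Rightarrow> 'r::complex_alg) \<Rightarrow> bool" where
  "gl_rep L \<pi> e \<longleftrightarrow> (\<forall>i<L. \<forall>j<L. \<forall>k<L. \<forall>l<L.
     e i j * e k l - par_sign ((\<pi> i + \<pi> j) * (\<pi> k + \<pi> l)) *\<^sub>C (e k l * e i j)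
       = (if j = k then e i l else 0)
         - par_sign ((\<pi> i + \<pi> j) * (\<pi> k + \<pi> l)) *\<^sub>C (if i = l then e k j else 0))"

definition super_commuting ::
  "nat \<Rightarrow> (nat \<Rightarrow> bit) \<Rightarrow> (nat \<Rightarrow> nat \<Rightarrow> 'r::complex_alg) \<Rightarrow> (nat \<Rightarrow> nat \<Rightarrow> 'r) \<Rightarrow> bool" where
  "super_commuting L \<pi> e f \<longleftrightarrow> (\<forall>i<L. \<forall>j<L. \<forall>k<L. \<forall>l<L.
     e i j * f k l = par_sign ((\<pi> i + \<pi> j) * (\<pi> k + \<pi> l)) *\<^sub>C (f k l * e i j))"

text \<open>For e = f this is the Casimir element \<kappa>; for the actions on two different tensor
  factors it is \<Omega>.\<close>

definition split_casimir ::
  "nat \<Rightarrow> (nat \<Rightarrow> bit) \<Rightarrow> (nat \<Rightarrow> nat \<Rightarrow> 'r::complex_alg) \<Rightarrow> (nat \<Rightarrow> nat \<Rightarrow> 'r) \<Rightarrow> 'r" where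
  "split_casimir L \<pi> e f = (\<Sum>i<L. \<Sum>j<L. par_sign (\<pi> j) *\<^sub>C (e i j * f j i))"

text \<open>The coefficients of the square of the split Casimir element, see \<open>split_casimir_square\<close>.\<close>

definition adjoint_square ::
  "nat \<Rightarrow> (nat \<Rightarrow> bit) \<Rightarrow> (nat \<Rightarrow> nat \<Rightarrow> 'r::complex_alg) \<Rightarrow> nat \<Rightarrow> nat \<Rightarrow> 'r" where
  "adjoint_square L \<pi> e k j =
     (\<Sum>i<L. par_sign (\<pi> i + (\<pi> i + \<pi> j) * (\<pi> k + \<pi> i)) *\<^sub>C (e i j * e k i))"

lemma gl_repD:
  assumes "gl_rep L \<pi> e" "i < L" "j < L" "k < L" "l < L"
  shows "e i j * e k l = par_sign ((\<pi> i + \<pi> j) * (\<pi> k + \<pi> l)) *\<^sub>C (e k l * e i j)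
    + (if j = k then e i l else 0)
    - par_sign ((\<pi> i + \<pi> j) * (\<pi> k + \<pi> l)) *\<^sub>C (if i = l then e k j else 0)"
  using assms unfolding gl_rep_def by (simp add: algebra_simps)

lemma super_commutingD:
  assumes "super_commuting L \<pi> e f" "i < L" "j < L" "k < L" "l < L"
  shows "e i j * f k l = par_sign ((\<pi> i + \<pi> j) * (\<pi> k + \<pi> l)) *\<^sub>C (f k l * e i j)"
  using assms unfolding super_commuting_def by blast

lemma super_commuting_sym: "super_commuting L \<pi> e f \<Longrightarrow> super_commuting L \<pi> f e"
proof -
  have "f i j * e k l = par_sign ((\<pi> i + \<pi> j) * (\<pi> k + \<pi> l)) *\<^sub>C (e k l * f i j)"
    if "e k l * f i j = par_sign ((\<pi> k + \<pi> l) * (\<pi> i + \<pi> j)) *\<^sub>C (f i j * e k l)" for i j k l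
    unfolding that scaleC_scaleC mult.commute[of "\<pi> k + \<pi> l"] by simp
  then show "super_commuting L \<pi> e f \<Longrightarrow> super_commuting L \<pi> f e"
    unfolding super_commuting_def by blast
qed

lemma super_commuting_sum:
  assumes "\<And>F. F \<in> S \<Longrightarrow> super_commuting L \<pi> (e F) g"
  shows "super_commuting L \<pi> (\<lambda>i j. \<Sum>F\<in>S. e F i j) g"
  using assms unfolding super_commuting_def
  by (simp add: sum_distrib_left sum_distrib_right complex_vector.scale_sum_right)

lemma gl_rep_add:
  assumes "gl_rep L \<pi> e" "gl_rep L \<pi> f" and ef: "super_commuting L \<pi> e f"
  shows "gl_rep L \<pi> (\<lambda>i j. e i j + f i j)"
  unfolding gl_rep_def
proof (intro allI impI)
  fix i j k l assume l: "i < L" "j < L" "k < L" "l < L"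
  define c where "c = par_sign ((\<pi> i + \<pi> j) * (\<pi> k + \<pi> l))"
  show "(e i j + f i j) * (e k l + f k l) - par_sign ((\<pi> i + \<pi> j) * (\<pi> k + \<pi> l)) *\<^sub>C ((e k l + f k l) * (e i j + f i j))
       = (if j = k then e i l + f i l else 0)
         - par_sign ((\<pi> i + \<pi> j) * (\<pi> k + \<pi> l)) *\<^sub>C (if i = l then e k j + f k j else 0)"
    using gl_repD[OF assms(1) l] gl_repD[OF assms(2) l] super_commutingD[OF ef l]
      super_commutingD[OF super_commuting_sym[OF ef] l]
    unfolding c_def[symmetric] by (simp add: distrib_left distrib_right scaleC_add_right)
qed

lemma gl_rep_sum:
  assumes "finite S" "\<And>F. F \<in> S \<Longrightarrow> gl_rep L \<pi> (e F)"
    and "\<And>F G. F \<in> S \<Longrightarrow> G \<in> S \<Longrightarrow> F \<noteq> G \<Longrightarrow> super_commuting L \<pi> (e F) (e G)"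
  shows "gl_rep L \<pi> (\<lambda>i j. \<Sum>F\<in>S. e F i j)"
  using assms
proof (induction S rule: finite_induct)
  case empty
  show ?case by (simp add: gl_rep_def)
next
  case (insert F S)
  have "super_commuting L \<pi> (e F) (\<lambda>i j. \<Sum>F\<in>S. e F i j)"
    by (rule super_commuting_sym, rule super_commuting_sum) (use insert in auto)
  then show ?case
    using insert by (simp add: gl_rep_add)
qed

text \<open>Here c and c' stand for signs, p and q for the superbrackets of x with y and with
  z.\<close>

lemma super_leibniz:
  fixes x y z :: "'r::complex_alg"
  assumes "x * y = c *\<^sub>C (y * x) + p" "x * z = c' *\<^sub>C (z * x) + q"
  shows "x * (y * z) - (c * c') *\<^sub>C (y * z * x) = p * z + c *\<^sub>C (y * q)"
proof -
  have "x * (y * z) = (x * y) * z" by (simp add: mult.assoc)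
  also have "\<dots> = c *\<^sub>C (y * (x * z)) + p * z"
    unfolding assms(1) by (simp add: distrib_right mult.assoc)
  also have "\<dots> = (c * c') *\<^sub>C (y * z * x) + c *\<^sub>C (y * q) + p * z"
    unfolding assms(2) by (simp add: distrib_left mult.assoc scaleC_add_right)
  finally show ?thesis by simp
qed

text \<open>By the Leibniz rule each summand E_ij E_ki produces four brackets. Those that meet the
  outer indices k and j reassemble to the right-hand side; those that meet the contracted index i
  survive only at i = b and i = a, and cancel. Hence the family transforms like the E_kj
  themselves.\<close>

lemma adjoint_square_commutator:
  assumes e: "gl_rep L \<pi> e" and l: "a < L" "b < L" "k < L" "j < L"
  defines "s \<equiv> par_sign ((\<pi> a + \<pi> b) * (\<pi> k + \<pi> j))"
  shows "e a b * adjoint_square L \<pi> e k j - s *\<^sub>C (adjoint_square L \<pi> e k j * e a b)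
    = (if b = k then adjoint_square L \<pi> e a j else 0)
      - s *\<^sub>C (if a = j then adjoint_square L \<pi> e k b else 0)"
proof -
  define w where "w i k j = par_sign (\<pi> i + (\<pi> i + \<pi> j) * (\<pi> k + \<pi> i))" for i k j
  define r where "r i j = par_sign ((\<pi> a + \<pi> b) * (\<pi> i + \<pi> j))" for i j
  have d: "adjoint_square L \<pi> e k j = (\<Sum>i<L. w i k j *\<^sub>C (e i j * e k i))" for k j
    by (simp only: adjoint_square_def w_def)
  have "par_sign ((a + b) * (i + j)) * par_sign ((a + b) * (k + i)) = par_sign ((a + b) * (k + j))"
    for a b i j k :: bit
    by (cases i; cases "a + b"; cases k; cases j; simp)
  then have rs: "r i j * r k i = s" for i
    unfolding r_def s_def .
  \<comment> \<open>The weights at i = b and i = a differ by exactly the sign s, which makes the two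
    contracted terms cancel.\<close>
  have "par_sign (b + (b + j) * (k + b)) = par_sign ((a + b) * (k + j)) * par_sign (a + (a + j) * (k + a))"
    for a b j k :: bit
    by (cases a; cases b; cases k; cases j; simp)
  then have wb: "w b k j = s * w a k j"
    unfolding w_def s_def .
  \<comment> \<open>This rule and the next one turn the outer terms into summands of
    \<open>adjoint_square\<close> with k replaced by a, respectively j by b.\<close>
  have "par_sign (i + (i + j) * (b + i)) * par_sign ((a + b) * (i + j)) = par_sign (i + (i + j) * (a + i))"
    for a b i j :: bit
    by (cases i; cases a; cases b; cases j; simp)
  then have wk: "w i b j * r i j = w i a j" for i
    unfolding w_def r_def .
  have "par_sign (i + (i + a) * (k + i)) * par_sign ((a + b) * (i + a))
      = par_sign ((a + b) * (k + a)) * par_sign (i + (i + b) * (k + i))" for a b i k :: bit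
    by (cases i; cases a; cases b; cases k; simp)
  then have wj: "w i k a * r i a = r k a * w i k b" for i
    unfolding w_def r_def .
  have step: "e a b * (e i j * e k i) - s *\<^sub>C (e i j * e k i * e a b)
    = ((if i = b then e a j * e k b else 0) + (if b = k then r i j *\<^sub>C (e i j * e a i) else 0))
      - ((if a = j then r i j *\<^sub>C (e i b * e k i) else 0) + (if i = a then s *\<^sub>C (e a j * e k b) else 0))"
    if i: "i < L" for i
  proof -
    have "e a b * (e i j * e k i) - (r i j * r k i) *\<^sub>C (e i j * e k i * e a b)
      = ((if b = i then e a j else 0) - r i j *\<^sub>C (if a = j then e i b else 0)) * e k i
        + r i j *\<^sub>C (e i j * ((if b = k then e a i else 0) - r k i *\<^sub>C (if a = i then e k b else 0)))"
      by (rule super_leibniz)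
        (use gl_repD[OF e l(1,2) i l(4)] gl_repD[OF e l(1,2,3) i] in \<open>simp_all only: r_def add_diff_eq\<close>)
    also have "\<dots> = (if b = i then e a j * e k i else 0) - (if a = j then r i j *\<^sub>C (e i b * e k i) else 0)
        + ((if b = k then r i j *\<^sub>C (e i j * e a i) else 0) - (if a = i then (r i j * r k i) *\<^sub>C (e i j * e k b) else 0))"
      by (cases "b = i"; cases "a = j"; cases "b = k"; cases "a = i";
          simp add: left_diff_distrib right_diff_distrib complex_vector.scale_right_diff_distrib)
    finally show ?thesis
      unfolding rs by (cases "b = i"; cases "a = i"; simp)
  qed
  have sumif: "(\<Sum>i<L. if Q then f i else 0) = (if Q then sum f {..<L} else 0)" for Q and f :: "nat \<Rightarrow> 'a"
    by simp
  have "e a b * adjoint_square L \<pi> e k j - s *\<^sub>C (adjoint_square L \<pi> e k j * e a b)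
    = (\<Sum>i<L. w i k j *\<^sub>C (e a b * (e i j * e k i) - s *\<^sub>C (e i j * e k i * e a b)))"
    by (simp add: d sum_distrib_left sum_distrib_right scaleC_ring_simps sum_subtractf mult.commute)
  also have "\<dots> = (\<Sum>i<L. ((if i = b then w b k j *\<^sub>C (e a j * e k b) else 0)
        + (if b = k then w i a j *\<^sub>C (e i j * e a i) else 0))
      - ((if a = j then s *\<^sub>C (w i k b *\<^sub>C (e i b * e k i)) else 0)
        + (if i = a then w b k j *\<^sub>C (e a j * e k b) else 0)))"
  proof (rule sum.cong[OF refl])
    fix i assume "i \<in> {..<L}"
    then have i: "i < L" by simp
    have "b = k \<Longrightarrow> w i k j * r i j = w i a j" "a = j \<Longrightarrow> w i k j * r i j = s * w i k b"
      using wk[of i] wj[of i] by (simp_all add: s_def r_def)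
    moreover have "w a k j * s = w b k j" by (simp add: wb)
    ultimately show "w i k j *\<^sub>C (e a b * (e i j * e k i) - s *\<^sub>C (e i j * e k i * e a b)) =
      ((if i = b then w b k j *\<^sub>C (e a j * e k b) else 0)
        + (if b = k then w i a j *\<^sub>C (e i j * e a i) else 0))
      - ((if a = j then s *\<^sub>C (w i k b *\<^sub>C (e i b * e k i)) else 0)
        + (if i = a then w b k j *\<^sub>C (e a j * e k b) else 0))"
      unfolding step[OF i] complex_vector.scale_right_diff_distrib scaleC_add_right if_distrib[of "scaleC _"]
        scaleC_scaleC complex_vector.scale_zero_right
      by (simp cong: if_cong)
  qed
  also have "\<dots> = (if b = k then adjoint_square L \<pi> e a j else 0)
      - s *\<^sub>C (if a = j then adjoint_square L \<pi> e k b else 0)"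
    unfolding sum_subtractf sum.distrib sumif d using l
    by (simp add: sum.delta complex_vector.scale_sum_right)
  finally show ?thesis .
qed

lemma casimir_eq_trace: "split_casimir L \<pi> e e = (\<Sum>k<L. adjoint_square L \<pi> e k k)"
proof -
  have "par_sign (\<pi> i + (\<pi> i + \<pi> k) * (\<pi> k + \<pi> i)) = par_sign (\<pi> k)" for i k
    by (cases "\<pi> i"; cases "\<pi> k") simp_all
  then show ?thesis
    unfolding split_casimir_def adjoint_square_def by (subst sum.swap) simp
qed

text \<open>The trace of \<open>adjoint_square_commutator\<close> is taken: for equal indices the
  sign is 1, and only k = b and k = a contribute, with the same entry (a, b) and opposite
  signs.\<close>

lemma casimir_central:
  assumes e: "gl_rep L \<pi> e" and l: "a < L" "b < L"
  shows "e a b * split_casimir L \<pi> e e = split_casimir L \<pi> e e * e a b"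
proof -
  have "e a b * adjoint_square L \<pi> e k k - adjoint_square L \<pi> e k k * e a b
    = (if k = b then adjoint_square L \<pi> e a b else 0) - (if k = a then adjoint_square L \<pi> e a b else 0)"
    if "k < L" for k
    using adjoint_square_commutator[OF e l that that] by simp
  then have "(\<Sum>k<L. e a b * adjoint_square L \<pi> e k k - adjoint_square L \<pi> e k k * e a b)
    = (\<Sum>k<L. (if k = b then adjoint_square L \<pi> e a b else 0) - (if k = a then adjoint_square L \<pi> e a b else 0))"
    by (intro sum.cong) auto
  also have "\<dots> = 0" using l by (simp add: sum_subtractf)
  finally show ?thesis
    by (simp add: casimir_eq_trace sum_distrib_left sum_distrib_right sum_subtractf)
qed

lemma casimir_commutes:
  assumes "super_commuting L \<pi> f e" and l: "a < L" "b < L"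
  shows "f a b * split_casimir L \<pi> e e = split_casimir L \<pi> e e * f a b"
proof -
  have "f a b * (e i j * e j i) = e i j * e j i * f a b" if "i < L" "j < L" for i j
  proof -
    have "f a b * (e i j * e j i) = (f a b * e i j) * e j i" by (simp add: mult.assoc)
    also have "\<dots> = par_sign ((\<pi> a + \<pi> b) * (\<pi> i + \<pi> j)) *\<^sub>C (e i j * (f a b * e j i))"
      using super_commutingD[OF assms(1) l that] by (simp add: mult.assoc)
    also have "f a b * e j i = par_sign ((\<pi> a + \<pi> b) * (\<pi> i + \<pi> j)) *\<^sub>C (e j i * f a b)"
      using super_commutingD[OF assms(1) l that(2,1)] by (simp add: add.commute)
    finally show ?thesis by (simp add: mult.assoc)
  qed
  then show ?thesis
    by (simp add: split_casimir_def sum_distrib_left sum_distrib_right)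
qed

text \<open>Exchanging the two legs costs (-1)^(i+j), which turns the weight (-1)^j into (-1)^i, as
  the renaming of the summation indices requires.\<close>

lemma split_casimir_sym:
  assumes "super_commuting L \<pi> e f"
  shows "split_casimir L \<pi> e f = split_casimir L \<pi> f e"
proof -
  have "par_sign (\<pi> j) *\<^sub>C (e i j * f j i) = par_sign (\<pi> i) *\<^sub>C (f j i * e i j)"
    if "i < L" "j < L" for i j
  proof -
    have "par_sign (\<pi> j) * par_sign ((\<pi> i + \<pi> j) * (\<pi> j + \<pi> i)) = par_sign (\<pi> i)"
      by (cases "\<pi> i"; cases "\<pi> j") simp_all
    then show ?thesis
      using super_commutingD[OF assms that that(2,1)] by simp
  qed
  then show ?thesis
    unfolding split_casimir_def by (subst sum.swap) simp
qed

lemma split_casimir_sum_left: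
  "split_casimir L \<pi> (\<lambda>i j. \<Sum>F\<in>S. e F i j) f = (\<Sum>F\<in>S. split_casimir L \<pi> (e F) f)"
proof -
  have "split_casimir L \<pi> (\<lambda>i j. \<Sum>F\<in>S. e F i j) f
      = (\<Sum>i<L. \<Sum>j<L. \<Sum>F\<in>S. par_sign (\<pi> j) *\<^sub>C (e F i j * f j i))"
    by (simp add: split_casimir_def sum_distrib_right complex_vector.scale_sum_right)
  also have "\<dots> = (\<Sum>i<L. \<Sum>F\<in>S. \<Sum>j<L. par_sign (\<pi> j) *\<^sub>C (e F i j * f j i))"
    by (rule sum.cong[OF refl], rule sum.swap)
  also have "\<dots> = (\<Sum>F\<in>S. split_casimir L \<pi> (e F) f)"
    unfolding split_casimir_def by (rule sum.swap)
  finally show ?thesis .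
qed

lemma split_casimir_add:
  "split_casimir L \<pi> (\<lambda>i j. e i j + g i j) f = split_casimir L \<pi> e f + split_casimir L \<pi> g f"
  "split_casimir L \<pi> f (\<lambda>i j. e i j + g i j) = split_casimir L \<pi> f e + split_casimir L \<pi> f g"
  by (simp_all add: split_casimir_def algebra_simps scaleC_add_right sum.distrib)

text \<open>Matrix units contract: v_ji v_lk vanishes unless l = i and is v_jk otherwise. The sign
  in \<open>adjoint_square\<close> is the one of moving v_ji past E_ki, times the remaining weight
  (-1)^i.\<close>

lemma split_casimir_square:
  assumes ev: "super_commuting L \<pi> e v"
    and v: "\<And>i j k l. i < L \<Longrightarrow> j < L \<Longrightarrow> k < L \<Longrightarrow> l < L \<Longrightarrow>
      v i j * v k l = (if j = k then v i l else 0)"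
  shows "split_casimir L \<pi> e v * split_casimir L \<pi> e v
    = (\<Sum>k<L. \<Sum>j<L. par_sign (\<pi> j) *\<^sub>C (adjoint_square L \<pi> e k j * v j k))"
proof -
  have *: "(par_sign (\<pi> j) *\<^sub>C (e i j * v j i)) * (par_sign (\<pi> l) *\<^sub>C (e k l * v l k))
    = (if l = i then par_sign (\<pi> j) *\<^sub>C (par_sign (\<pi> i + (\<pi> i + \<pi> j) * (\<pi> k + \<pi> i)) *\<^sub>C (e i j * e k i * v j k)) else 0)"
    if l: "i < L" "j < L" "k < L" "l < L" for i j k l
  proof -
    have c: "v j i * e k l = par_sign ((\<pi> i + \<pi> j) * (\<pi> k + \<pi> l)) *\<^sub>C (e k l * v j i)"
      using super_commutingD[OF super_commuting_sym[OF ev] l(2,1,3,4)] by (simp add: add.commute)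
    have "(e i j * v j i) * (e k l * v l k) = e i j * (v j i * e k l) * v l k"
      by (simp add: mult.assoc)
    also have "\<dots> = par_sign ((\<pi> i + \<pi> j) * (\<pi> k + \<pi> l)) *\<^sub>C (e i j * e k l * (v j i * v l k))"
      unfolding c by (simp add: mult.assoc)
    finally show ?thesis
      using v[OF l(2,1,4,3)] by (auto simp: par_sign_add mult_ac)
  qed
  have row: "(\<Sum>l<L. (par_sign (\<pi> j) *\<^sub>C (e i j * v j i)) * (par_sign (\<pi> l) *\<^sub>C (e k l * v l k)))
    = par_sign (\<pi> j) *\<^sub>C (par_sign (\<pi> i + (\<pi> i + \<pi> j) * (\<pi> k + \<pi> i)) *\<^sub>C (e i j * e k i * v j k))"
    if l: "i < L" "j < L" "k < L" for i j k
  proof -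
    have "(\<Sum>l<L. (par_sign (\<pi> j) *\<^sub>C (e i j * v j i)) * (par_sign (\<pi> l) *\<^sub>C (e k l * v l k)))
      = (\<Sum>l<L. if l = i then par_sign (\<pi> j) *\<^sub>C (par_sign (\<pi> i + (\<pi> i + \<pi> j) * (\<pi> k + \<pi> i)) *\<^sub>C (e i j * e k i * v j k)) else 0)"
      by (intro sum.cong refl *) (use l in auto)
    then show ?thesis using l by simp
  qed
  have "split_casimir L \<pi> e v * split_casimir L \<pi> e v
    = (\<Sum>i<L. \<Sum>j<L. \<Sum>k<L. \<Sum>l<L. (par_sign (\<pi> j) *\<^sub>C (e i j * v j i)) * (par_sign (\<pi> l) *\<^sub>C (e k l * v l k)))"
    unfolding split_casimir_def sum_distrib_right unfolding sum_distrib_left by (rule refl)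
  also have "\<dots> = (\<Sum>i<L. \<Sum>j<L. \<Sum>k<L.
      par_sign (\<pi> j) *\<^sub>C (par_sign (\<pi> i + (\<pi> i + \<pi> j) * (\<pi> k + \<pi> i)) *\<^sub>C (e i j * e k i * v j k)))"
    by (intro sum.cong refl row) auto
  also have "\<dots> = (\<Sum>i<L. \<Sum>k<L. \<Sum>j<L.
      par_sign (\<pi> j) *\<^sub>C (par_sign (\<pi> i + (\<pi> i + \<pi> j) * (\<pi> k + \<pi> i)) *\<^sub>C (e i j * e k i * v j k)))"
    by (intro sum.cong refl sum.swap)
  also have "\<dots> = (\<Sum>k<L. \<Sum>i<L. \<Sum>j<L.
      par_sign (\<pi> j) *\<^sub>C (par_sign (\<pi> i + (\<pi> i + \<pi> j) * (\<pi> k + \<pi> i)) *\<^sub>C (e i j * e k i * v j k)))"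
    by (rule sum.swap)
  also have "\<dots> = (\<Sum>k<L. \<Sum>j<L. \<Sum>i<L.
      par_sign (\<pi> j) *\<^sub>C (par_sign (\<pi> i + (\<pi> i + \<pi> j) * (\<pi> k + \<pi> i)) *\<^sub>C (e i j * e k i * v j k)))"
    by (intro sum.cong refl sum.swap)
  also have "\<dots> = (\<Sum>k<L. \<Sum>j<L. par_sign (\<pi> j) *\<^sub>C (adjoint_square L \<pi> e k j * v j k))"
    by (simp add: adjoint_square_def sum_distrib_right complex_vector.scale_sum_right mult.assoc)
  finally show ?thesis .
qed

section \<open>Supermodules\<close>

definition unit_op :: "nat \<Rightarrow> nat \<Rightarrow> 'a::complex_vector supermod \<Rightarrow> nat \<Rightarrow> nat \<Rightarrow> 'a endo" where
  "unit_op n m M i j = Endo (act M (mat_E n m i j))"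

definition sign_op :: "'a::complex_vector supermod \<Rightarrow> bit \<Rightarrow> 'a endo" where
  "sign_op M s = Endo (par_op M s)"

lemma mat_E_hom: "mat_E n m i j \<in> gl_hom n m (par n i + par n j)"
  by (auto simp: mat_E_def gl_hom_def gl_def)

lemma mat_E_gl [simp]: "mat_E n m i j \<in> gl n m"
  by (simp add: mat_E_def gl_def)

lemma mat_E_mult:
  assumes "j < n + m"
  shows "mat_E n m i j * mat_E n m k l = (if j = k then mat_E n m i l else 0\<^sub>m (n + m) (n + m))"
proof (rule eq_matI)
  fix r c assume rc: "r < dim_row (if j = k then mat_E n m i l else 0\<^sub>m (n + m) (n + m))"
    "c < dim_col (if j = k then mat_E n m i l else 0\<^sub>m (n + m) (n + m))"
  then have rc': "r < n + m" "c < n + m"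
    by (simp_all add: mat_E_def split: if_splits)
  have "(mat_E n m i j * mat_E n m k l) $$ (r, c)
      = (\<Sum>x\<in>{0..<n + m}. (if r = i \<and> x = j then 1 else 0) * (if x = k \<and> c = l then 1 else 0))"
    using rc' by (simp add: mat_E_def scalar_prod_def)
  also have "\<dots> = (\<Sum>x\<in>{0..<n + m}. (if x = j then (if r = i \<and> j = k \<and> c = l then 1 else 0) else 0))"
    by (rule sum.cong) auto
  finally have "(mat_E n m i j * mat_E n m k l) $$ (r, c)
      = (\<Sum>x\<in>{0..<n + m}. (if x = j then (if r = i \<and> j = k \<and> c = l then 1 else 0) else 0))" .
  then show "(mat_E n m i j * mat_E n m k l) $$ (r, c)
      = (if j = k then mat_E n m i l else 0\<^sub>m (n + m) (n + m)) $$ (r, c)"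
    using rc' assms by (auto simp: mat_E_def)
qed (simp_all add: mat_E_def)

context
  fixes n m :: nat and M :: "'a::complex_vector supermod"
  assumes M: "gl_supermodule n m M"
begin

lemma subspace_hcomp: "csubspace (hcomp M s)"
  using M by (simp add: gl_supermodule_def)

lemma act_add: "x \<in> gl n m \<Longrightarrow> y \<in> gl n m \<Longrightarrow> act M (x + y) v = act M x v + act M y v"
  using M unfolding gl_supermodule_def by blast

lemma act_smult: "x \<in> gl n m \<Longrightarrow> act M (c \<cdot>\<^sub>m x) v = c *\<^sub>C act M x v"
  using M unfolding gl_supermodule_def by blast

lemma act_hcomp: "x \<in> gl_hom n m s \<Longrightarrow> v \<in> hcomp M r \<Longrightarrow> act M x v \<in> hcomp M (s + r)"
  using M unfolding gl_supermodule_def by blast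

lemma act_bracket:
  assumes "x \<in> gl_hom n m s" "y \<in> gl_hom n m r"
  shows "act M (gl_bracket s r x y) v = act M x (act M y v) - par_sign (s * r) *\<^sub>C act M y (act M x v)"
  using M assms unfolding gl_supermodule_def by (elim conjE) blast

lemma even_part_props: "even_part M v \<in> hcomp M 0" "v - even_part M v \<in> hcomp M 1"
proof -
  have "\<exists>!u. u \<in> hcomp M 0 \<and> v - u \<in> hcomp M 1"
    using M by (simp add: gl_supermodule_def)
  from theI'[OF this] show "even_part M v \<in> hcomp M 0" "v - even_part M v \<in> hcomp M 1"
    by (simp_all add: even_part_def)
qed

lemma even_part_eqI: "u \<in> hcomp M 0 \<Longrightarrow> v - u \<in> hcomp M 1 \<Longrightarrow> even_part M v = u"
proof -
  assume u: "u \<in> hcomp M 0" "v - u \<in> hcomp M 1"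
  have "\<exists>!u. u \<in> hcomp M 0 \<and> v - u \<in> hcomp M 1"
    using M by (simp add: gl_supermodule_def)
  with u even_part_props[of v] show ?thesis by blast
qed

lemma clinear_even_part: "clinear (even_part M)"
  unfolding clinear_iff
proof (intro conjI allI)
  fix u v c
  show "even_part M (u + v) = even_part M u + even_part M v"
  proof (rule even_part_eqI)
    have "u + v - (even_part M u + even_part M v) = (u - even_part M u) + (v - even_part M v)"
      by simp
    then show "u + v - (even_part M u + even_part M v) \<in> hcomp M 1"
      using even_part_props complex_vector.subspace_add[OF subspace_hcomp] by metis
  qed (simp add: even_part_props complex_vector.subspace_add subspace_hcomp)
  show "even_part M (c *\<^sub>C v) = c *\<^sub>C even_part M v"
    by (rule even_part_eqI)
      (simp_all add: even_part_props complex_vector.subspace_scale subspace_hcomp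
        flip: complex_vector.scale_right_diff_distrib)
qed

lemma clinear_par_op: "clinear (par_op M s)"
  using clinear_even_part by (simp add: par_op_def clinear_iff scaleC_ring_simps mult.commute)

lemma app_sign_op: "app (sign_op M s) = par_op M s"
  by (simp add: sign_op_def app_Endo clinear_par_op)

lemma clinear_act: "x \<in> gl n m \<Longrightarrow> clinear (act M x)"
  using M by (simp add: gl_supermodule_def)

lemma app_unit_op: "app (unit_op n m M i j) = act M (mat_E n m i j)"
  by (simp add: unit_op_def app_Endo clinear_act)

lemma par_op_hcomp:
  assumes "v \<in> hcomp M r"
  shows "par_op M s v = par_sign (s * r) *\<^sub>C v"
proof (cases r)
  case zero
  then have "even_part M v = v"
    using assms by (intro even_part_eqI) (simp_all add: complex_vector.subspace_0[OF subspace_hcomp])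
  then show ?thesis using zero by (simp add: par_op_def)
next
  case one
  then have "even_part M v = 0"
    using assms by (intro even_part_eqI) (simp_all add: complex_vector.subspace_0[OF subspace_hcomp])
  then show ?thesis using one by (simp add: par_op_def)
qed

lemma sign_op_eqI:
  assumes "\<And>r v. v \<in> hcomp M r \<Longrightarrow> app f v = app g v"
  shows "f = g"
proof (rule endo_eqI)
  fix v
  have "app f (even_part M v + (v - even_part M v)) = app g (even_part M v + (v - even_part M v))"
    unfolding app_linear using assms even_part_props by metis
  then show "app f v = app g v" by simp
qed

lemma sign_op_0 [simp]: "sign_op M 0 = 1"
  by (rule sign_op_eqI) (simp add: app_sign_op par_op_hcomp)

lemma sign_op_mult: "sign_op M s * sign_op M r = sign_op M (s + r)"
proof (rule sign_op_eqI)
  fix t v assume "v \<in> hcomp M t"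
  then have "app (sign_op M s * sign_op M r) v = par_sign (s * t) *\<^sub>C par_sign (r * t) *\<^sub>C v"
    using app_linear(2)[of "sign_op M s"] by (simp add: app_sign_op par_op_hcomp mult.commute)
  also have "\<dots> = app (sign_op M (s + r)) v"
    using \<open>v \<in> hcomp M t\<close> by (simp add: app_sign_op par_op_hcomp distrib_right par_sign_add)
  finally show "app (sign_op M s * sign_op M r) v = app (sign_op M (s + r)) v" .
qed

lemma sign_op_unit_op:
  "sign_op M s * unit_op n m M i j = par_sign (s * (par n i + par n j)) *\<^sub>C (unit_op n m M i j * sign_op M s)"
proof (rule sign_op_eqI)
  fix t v assume v: "v \<in> hcomp M t"
  then have "act M (mat_E n m i j) v \<in> hcomp M (par n i + par n j + t)"
    by (intro act_hcomp mat_E_hom)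
  then show "app (sign_op M s * unit_op n m M i j) v
    = app (par_sign (s * (par n i + par n j)) *\<^sub>C (unit_op n m M i j * sign_op M s)) v"
    using v app_linear(2)[of "unit_op n m M i j"]
    by (simp add: app_sign_op app_unit_op par_op_hcomp distrib_left par_sign_add mult.commute)
qed

text \<open>Being homogeneous becomes an eigenvector equation for the parity involution, which can
  be carried through operator identities.\<close>

lemma hcomp_iff: "v \<in> hcomp M s \<longleftrightarrow> app (sign_op M 1) v = par_sign s *\<^sub>C v"
proof
  assume "app (sign_op M 1) v = par_sign s *\<^sub>C v"
  then have *: "even_part M v + (even_part M v - v) = par_sign s *\<^sub>C v"
    by (simp add: app_sign_op par_op_def algebra_simps)
  have d: "u = 0" if "u + u = 0" for u :: 'a
    using complex_vector.scale_eq_0_iff[of 2 u] that scaleC_add_left[of 1 1 u] by simp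
  show "v \<in> hcomp M s"
  proof (cases s)
    case zero
    have "(v - even_part M v) + (v - even_part M v) = 0"
      using * zero by (simp add: algebra_simps)
    from d[OF this] show ?thesis using even_part_props(1)[of v] zero by simp
  next
    case one
    have "even_part M v + even_part M v = 0"
      using * one by (simp add: algebra_simps)
    from d[OF this] show ?thesis using even_part_props(2)[of v] one by simp
  qed
qed (simp add: app_sign_op par_op_hcomp)

lemma gl_rep_unit_op: "gl_rep (n + m) (par n) (unit_op n m M)"
  unfolding gl_rep_def
proof (intro allI impI)
  fix i j k l assume l: "i < n + m" "j < n + m" "k < n + m" "l < n + m"
  define s where "s = par_sign ((par n i + par n j) * (par n k + par n l))"
  have z: "act M (0\<^sub>m (n + m) (n + m)) v = 0" for v
    using act_smult[of "0\<^sub>m (n + m) (n + m)" 0 v] by (simp add: gl_def)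
  have br: "gl_bracket (par n i + par n j) (par n k + par n l) (mat_E n m i j) (mat_E n m k l)
    = (if j = k then mat_E n m i l else 0\<^sub>m (n + m) (n + m))
      + (- s) \<cdot>\<^sub>m (if i = l then mat_E n m k j else 0\<^sub>m (n + m) (n + m))"
    unfolding gl_bracket_def mat_E_mult[OF l(2)] mat_E_mult[OF l(4)] s_def
    by (rule eq_matI) (auto simp: mat_E_def)
  show "unit_op n m M i j * unit_op n m M k l - s *\<^sub>C (unit_op n m M k l * unit_op n m M i j)
    = (if j = k then unit_op n m M i l else 0) - s *\<^sub>C (if i = l then unit_op n m M k j else 0)"
  proof (rule endo_eqI)
    fix v
    have "act M (gl_bracket (par n i + par n j) (par n k + par n l) (mat_E n m i j) (mat_E n m k l)) v
      = act M (mat_E n m i j) (act M (mat_E n m k l) v) - s *\<^sub>C act M (mat_E n m k l) (act M (mat_E n m i j) v)"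
      unfolding s_def by (rule act_bracket[OF mat_E_hom mat_E_hom])
    moreover have "act M (gl_bracket (par n i + par n j) (par n k + par n l) (mat_E n m i j) (mat_E n m k l)) v
      = act M (if j = k then mat_E n m i l else 0\<^sub>m (n + m) (n + m)) v
        - s *\<^sub>C act M (if i = l then mat_E n m k j else 0\<^sub>m (n + m) (n + m)) v"
      unfolding br by (subst act_add) (simp_all add: act_smult gl_def mat_E_def)
    ultimately show "app (unit_op n m M i j * unit_op n m M k l - s *\<^sub>C (unit_op n m M k l * unit_op n m M i j)) v
      = app ((if j = k then unit_op n m M i l else 0) - s *\<^sub>C (if i = l then unit_op n m M k j else 0)) v"
      by (simp add: app_unit_op z split: if_splits)
  qed
qed

text \<open>The even part of v is half the sum of v and its image under the parity involution, and
  every matrix is a finite combination of matrix units.\<close>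

lemma sub_supermoduleI:
  assumes S: "csubspace S"
    and sign: "\<And>v. v \<in> S \<Longrightarrow> app (sign_op M 1) v \<in> S"
    and unit: "\<And>i j v. i < n + m \<Longrightarrow> j < n + m \<Longrightarrow> v \<in> S \<Longrightarrow> app (unit_op n m M i j) v \<in> S"
  shows "sub_supermodule n m M S"
  unfolding sub_supermodule_def
proof (intro conjI ballI)
  fix v assume v: "v \<in> S"
  have "(1 / 2) *\<^sub>C (v + app (sign_op M 1) v) = (1 / 2) *\<^sub>C (even_part M v + even_part M v)"
    by (simp add: app_sign_op par_op_def)
  also have "\<dots> = (1 / 2 + 1 / 2) *\<^sub>C even_part M v"
    by (simp only: scaleC_add_left scaleC_add_right)
  finally have "(1 / 2) *\<^sub>C (v + app (sign_op M 1) v) = even_part M v"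
    by simp
  then show "even_part M v \<in> S"
    using v sign complex_vector.subspace_add[OF S] complex_vector.subspace_scale[OF S] by metis
next
  fix x v assume x: "x \<in> gl n m" and v: "v \<in> S"
  \<comment> \<open>The truncation of x to the entries in A; the induction on A adds one matrix unit
    at a time.\<close>
  define y where "y A = mat (n + m) (n + m) (\<lambda>ij. if ij \<in> A then x $$ ij else 0)" for A
  have "act M (y A) v \<in> S" if "finite A" "A \<subseteq> {..<n + m} \<times> {..<n + m}" for A
    using that
  proof (induction A rule: finite_induct)
    case empty
    have "y {} = 0 \<cdot>\<^sub>m 0\<^sub>m (n + m) (n + m)"
      by (rule eq_matI) (simp_all add: y_def)
    then have "act M (y {}) v = 0 *\<^sub>C act M (0\<^sub>m (n + m) (n + m)) v"
      using act_smult[of "0\<^sub>m (n + m) (n + m)" 0 v] by (simp add: gl_def)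
    then show ?case by (simp add: complex_vector.subspace_0[OF S])
  next
    case (insert ij A)
    obtain i j where ij: "ij = (i, j)" "i < n + m" "j < n + m"
      using insert.prems by auto
    have "y (insert ij A) = x $$ (i, j) \<cdot>\<^sub>m mat_E n m i j + y A"
      using insert.hyps ij by (intro eq_matI) (auto simp: y_def mat_E_def)
    moreover have "x $$ (i, j) \<cdot>\<^sub>m mat_E n m i j \<in> gl n m" "y A \<in> gl n m"
      by (simp_all add: gl_def mat_E_def y_def)
    ultimately have "act M (y (insert ij A)) v = act M (x $$ (i, j) \<cdot>\<^sub>m mat_E n m i j) v + act M (y A) v"
      by (simp add: act_add)
    also have "\<dots> = x $$ (i, j) *\<^sub>C app (unit_op n m M i j) v + act M (y A) v"
      by (simp add: act_smult app_unit_op)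
    finally show ?case
      using insert ij unit[OF ij(2,3) v] complex_vector.subspace_add[OF S]
        complex_vector.subspace_scale[OF S] by simp
  qed
  from this[of "{..<n + m} \<times> {..<n + m}"] have "act M (y ({..<n + m} \<times> {..<n + m})) v \<in> S" by simp
  moreover have "y ({..<n + m} \<times> {..<n + m}) = x"
    using x by (intro eq_matI) (auto simp: y_def gl_def)
  ultimately show "act M x v \<in> S" by simp
qed (rule S)

end

section \<open>Singular vectors in irreducible supermodules\<close>

text \<open>The images of u under words in the negative root vectors; their span is the cyclic
  module of u under the strictly lower triangular matrices.\<close>

inductive_set descendants :: "nat \<Rightarrow> (nat \<Rightarrow> nat \<Rightarrow> 'a::complex_vector endo) \<Rightarrow> 'a \<Rightarrow> 'a set"
  for L e u where
  base: "u \<in> descendants L e u"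
| step: "z \<in> descendants L e u \<Longrightarrow> b < a \<Longrightarrow> a < L \<Longrightarrow> app (e a b) z \<in> descendants L e u"

text \<open>Its bracket with E_ab is (b - a) E_ab, negative on every lowering operator, so that this
  one element can replace the whole Cartan subalgebra.\<close>

definition height_op :: "nat \<Rightarrow> (nat \<Rightarrow> nat \<Rightarrow> 'r::complex_alg) \<Rightarrow> 'r" where
  "height_op L e = (\<Sum>i<L. (- of_nat i) *\<^sub>C e i i)"

lemma height_op_commutator:
  assumes e: "gl_rep L \<pi> e" and l: "a < L" "b < L"
  shows "height_op L e * e a b = e a b * height_op L e + (of_nat b - of_nat a) *\<^sub>C e a b"
proof -
  have "e i i * e a b = e a b * e i i + (if i = a then e a b else 0) - (if i = b then e a b else 0)"
    if "i < L" for i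
    using gl_repD[OF e that that l] by auto
  then have "height_op L e * e a b = (\<Sum>i<L. (- of_nat i) *\<^sub>C (e a b * e i i)
      + (if i = a then (- of_nat a) *\<^sub>C e a b else 0) - (if i = b then (- of_nat b) *\<^sub>C e a b else 0))"
    unfolding height_op_def sum_distrib_right
    by (intro sum.cong refl) (simp add: scaleC_add_right complex_vector.scale_right_diff_distrib)
  also have "\<dots> = e a b * height_op L e + (- of_nat a) *\<^sub>C e a b - (- of_nat b) *\<^sub>C e a b"
    unfolding sum_subtractf sum.distrib height_op_def sum_distrib_left using l by simp
  finally show ?thesis
    by (simp add: complex_vector.scale_left_diff_distrib)
qed

text \<open>\<open>annihilate h r z\<close> is \<open>(H - h)(H - h + 1) \<dots> (H - h + r - 1)\<close> applied to \<open>z\<close>.\<close>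

fun annihilate :: "'a::complex_vector endo \<Rightarrow> complex \<Rightarrow> nat \<Rightarrow> 'a \<Rightarrow> 'a" where
  "annihilate H h 0 z = z"
| "annihilate H h (Suc r) z = app H (annihilate H h r z) - (h - of_nat r) *\<^sub>C annihilate H h r z"

lemma annihilate_linear:
  "annihilate H h r (u + v) = annihilate H h r u + annihilate H h r v"
  "annihilate H h r (c *\<^sub>C v) = c *\<^sub>C annihilate H h r v"
  by (induction r) (simp_all add: app_linear scaleC_ring_simps algebra_simps)

lemma annihilate_mono: "r \<le> r' \<Longrightarrow> annihilate H h r z = 0 \<Longrightarrow> annihilate H h r' z = 0"
  by (induction r' rule: dec_induct) simp_all

lemma annihilate_eigen:
  "app H z = c *\<^sub>C z \<Longrightarrow> annihilate H h r z = (\<Prod>k<r. c - h + of_nat k) *\<^sub>C z"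
proof (induction r)
  case (Suc r)
  assume z: "app H z = c *\<^sub>C z"
  have "annihilate H h (Suc r) z = ((\<Prod>k<r. c - h + of_nat k) * c - (h - of_nat r) * (\<Prod>k<r. c - h + of_nat k)) *\<^sub>C z"
    using Suc z by (simp add: app_linear complex_vector.scale_left_diff_distrib)
  then show ?case by (simp add: algebra_simps)
qed simp

text \<open>The products are nested: a larger r only adds factors, so a common r serves for two
  vectors.\<close>

lemma subspace_annihilated: "csubspace {z. \<exists>r. annihilate H h r z = 0}"
proof (rule complex_vector.subspaceI)
  show "0 \<in> {z. \<exists>r. annihilate H h r z = 0}" by (auto intro: exI[of _ 0])
next
  fix u v assume "u \<in> {z. \<exists>r. annihilate H h r z = 0}" "v \<in> {z. \<exists>r. annihilate H h r z = 0}"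
  then obtain r r' where "annihilate H h r u = 0" "annihilate H h r' v = 0" by auto
  then have "annihilate H h (max r r') (u + v) = 0"
    by (simp add: annihilate_linear annihilate_mono[of r] annihilate_mono[of r'])
  then show "u + v \<in> {z. \<exists>r. annihilate H h r z = 0}" by blast
qed (auto simp: annihilate_linear)

lemma descendants_eigen:
  assumes e: "gl_rep L \<pi> e" and u: "app (height_op L e) u = h *\<^sub>C u"
    and z: "z \<in> descendants L e u"
  shows "\<exists>k::nat. app (height_op L e) z = (h - of_nat k) *\<^sub>C z"
  using z
proof induction
  case base
  show ?case using u by (intro exI[of _ 0]) simp
next
  case (step z b a)
  then obtain k :: nat where k: "app (height_op L e) z = (h - of_nat k) *\<^sub>C z" by blast
  have "app (height_op L e) (app (e a b) z) = app (height_op L e * e a b) z" by simp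
  also have "\<dots> = (h - of_nat k) *\<^sub>C app (e a b) z + (of_nat b - of_nat a) *\<^sub>C app (e a b) z"
    using step by (subst height_op_commutator[OF e]) (simp_all add: k app_linear)
  also have "\<dots> = (h - of_nat (k + (a - b))) *\<^sub>C app (e a b) z"
    unfolding scaleC_add_left[symmetric] using step by (simp add: of_nat_diff)
  finally show ?case by blast
qed

text \<open>The zero vector is singular for every weight; nonvanishing is asked for where it
  matters.\<close>

definition singular ::
  "nat \<Rightarrow> nat \<Rightarrow> 'a::complex_vector supermod \<Rightarrow> (nat \<Rightarrow> complex) \<Rightarrow> 'a \<Rightarrow> bool" where
  "singular n m M w v \<longleftrightarrow> (\<exists>s. v \<in> hcomp M s) \<and>
     (\<forall>i j. i < j \<and> j < n + m \<longrightarrow> app (unit_op n m M i j) v = 0) \<and>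
     (\<forall>i < n + m. app (unit_op n m M i i) v = w i *\<^sub>C v)"

definition height :: "nat \<Rightarrow> (nat \<Rightarrow> complex) \<Rightarrow> complex" where
  "height L w = (\<Sum>i<L. - of_nat i * w i)"

lemma singular_height:
  assumes "singular n m M w v"
  shows "app (height_op (n + m) (unit_op n m M)) v = height (n + m) w *\<^sub>C v"
  using assms unfolding singular_def height_op_def height_def
  by (simp add: app_sum_left complex_vector.scale_sum_left)

context
  fixes n m :: nat and M :: "'a::complex_vector supermod"
  assumes irr: "irreducible_supermodule n m M"
begin

lemma irr_supermodule: "gl_supermodule n m M"
  using irr by (simp add: irreducible_supermodule_def)

text \<open>The span is a submodule, without any basis theorem: by induction on the lowering word,
  an arbitrary matrix unit is commuted past the leftmost letter. The brackets are again matrix units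
  applied to the shorter word, and the induction hypothesis holds for all of them at once. At the
  end the matrix unit meets u, which it kills, scales or lowers.\<close>

lemma span_descendants:
  assumes u: "singular n m M w u" "u \<noteq> 0"
  shows "complex_vector.span (descendants (n + m) (unit_op n m M) u) = UNIV"
proof -
  let ?e = "unit_op n m M"
  let ?S = "complex_vector.span (descendants (n + m) ?e u)"
  have sub: "csubspace ?S" by (rule complex_vector.subspace_span)
  have closed: "app f z \<in> ?S" if "\<And>y. y \<in> descendants (n + m) ?e u \<Longrightarrow> app f y \<in> ?S" "z \<in> ?S" for f z
    using that(2)
    by (induction rule: complex_vector.span_induct_alt)
      (simp_all add: app_linear that(1) complex_vector.span_add complex_vector.span_scale complex_vector.span_zero)
  have lower: "app (?e a b) z \<in> ?S" if "b < a" "a < n + m" "z \<in> ?S" for a b z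
    by (rule closed) (use that in \<open>auto intro: complex_vector.span_base descendants.step\<close>)
  have gen: "app (?e a b) z \<in> ?S"
    if "z \<in> descendants (n + m) ?e u" "a < n + m" "b < n + m" for a b z
    using that
  proof (induction arbitrary: a b)
    case base
    consider "a < b" | "a = b" | "b < a" by linarith
    then show ?case
      using u(1) base lower[of b a u] unfolding singular_def
      by cases (auto simp: complex_vector.span_zero complex_vector.span_scale complex_vector.span_base
          descendants.base)
  next
    case (step z d c)
    note gl_repD[OF gl_rep_unit_op[OF irr_supermodule] step.prems, of c d]
    then have "app (?e a b) (app (?e c d) z)
      = app (par_sign ((par n a + par n b) * (par n c + par n d)) *\<^sub>C (?e c d * ?e a b)
        + (if b = c then ?e a d else 0)
        - par_sign ((par n a + par n b) * (par n c + par n d)) *\<^sub>C (if a = d then ?e c b else 0)) z"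
      using step by (simp del: app_ring(2,4,6) flip: app_ring(5))
    also have "\<dots> = par_sign ((par n a + par n b) * (par n c + par n d)) *\<^sub>C app (?e c d) (app (?e a b) z)
        + (if b = c then app (?e a d) z else 0)
        - par_sign ((par n a + par n b) * (par n c + par n d)) *\<^sub>C (if a = d then app (?e c b) z else 0)"
      by simp
    also have "\<dots> \<in> ?S"
    proof -
      have "app (?e c d) (app (?e a b) z) \<in> ?S"
        by (rule lower) (use step in auto)
      then show ?thesis
        using step.IH step.hyps step.prems
        by (intro complex_vector.span_add complex_vector.span_diff complex_vector.span_scale)
          (simp_all add: complex_vector.span_zero)
    qed
    finally show ?case .
  qed
  have sign: "app (sign_op M 1) z \<in> ?S" if "z \<in> descendants (n + m) ?e u" for z
  proof -
    have "\<exists>s. app (sign_op M 1) z = par_sign s *\<^sub>C z"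
      using that
    proof induction
      case base
      show ?case using u(1) hcomp_iff[OF irr_supermodule] unfolding singular_def by blast
    next
      case (step z b a)
      then obtain s where s: "app (sign_op M 1) z = par_sign s *\<^sub>C z" by blast
      have "app (sign_op M 1) (app (?e a b) z) = app (sign_op M 1 * ?e a b) z" by simp
      also have "\<dots> = par_sign (par n a + par n b + s) *\<^sub>C app (?e a b) z"
        unfolding sign_op_unit_op[OF irr_supermodule] by (simp add: s app_linear par_sign_add)
      finally show ?case by blast
    qed
    then show ?thesis
      using complex_vector.span_scale[OF complex_vector.span_base[OF that]] by (elim exE) simp
  qed
  have "sub_supermodule n m M ?S"
    by (rule sub_supermoduleI[OF irr_supermodule sub]) (auto intro: closed gen sign)
  moreover have "u \<in> ?S" by (simp add: complex_vector.span_base descendants.base)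
  ultimately show ?thesis
    using irr u(2) unfolding irreducible_supermodule_def by blast
qed

text \<open>Since v lies in the span of the descendants of u, some product (H - h)(H - h + 1) ...
  kills it. On the eigenvector v this product is a scalar, so one factor vanishes and the height of
  v is h minus a natural number. By symmetry the difference is also the negative of a natural
  number.\<close>

lemma singular_height_unique:
  assumes u: "singular n m M w u" "u \<noteq> 0" and v: "singular n m M w' v" "v \<noteq> 0"
  shows "height (n + m) w = height (n + m) w'"
proof -
  let ?H = "height_op (n + m) (unit_op n m M)"
  have *: "\<exists>k::nat. height (n + m) w' = height (n + m) w - of_nat k"
    if u: "singular n m M w u" "u \<noteq> 0" and v: "singular n m M w' v" "v \<noteq> 0" for u v w w'
  proof -
    have "descendants (n + m) (unit_op n m M) u \<subseteq> {z. \<exists>r. annihilate ?H (height (n + m) w) r z = 0}"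
    proof
      fix z assume "z \<in> descendants (n + m) (unit_op n m M) u"
      from descendants_eigen[OF gl_rep_unit_op[OF irr_supermodule] singular_height[OF u(1)] this]
      obtain k :: nat where "app ?H z = (height (n + m) w - of_nat k) *\<^sub>C z" by blast
      \<comment> \<open>The vanishing factor has index k counted from 0, hence k + 1
        factors.\<close>
      from annihilate_eigen[OF this, of "height (n + m) w" "Suc k"]
      show "z \<in> {z. \<exists>r. annihilate ?H (height (n + m) w) r z = 0}" by (auto intro!: exI[of _ "Suc k"])
    qed
    then have "UNIV \<subseteq> {z. \<exists>r. annihilate ?H (height (n + m) w) r z = 0}"
      unfolding span_descendants[OF u, symmetric]
      by (rule complex_vector.span_minimal[OF _ subspace_annihilated])
    then obtain r where "annihilate ?H (height (n + m) w) r v = 0" by blast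
    then have "(\<Prod>k<r. height (n + m) w' - height (n + m) w + of_nat k) = 0"
      using annihilate_eigen[OF singular_height[OF v(1)]] v(2) by (simp add: complex_vector.scale_eq_0_iff)
    then obtain k where "height (n + m) w' - height (n + m) w + of_nat k = 0"
      by (auto simp: prod_zero_iff)
    then show ?thesis by (intro exI[of _ k]) (simp add: algebra_simps add_eq_0_iff)
  qed
  obtain k k' :: nat where "height (n + m) w' = height (n + m) w - of_nat k"
    "height (n + m) w = height (n + m) w' - of_nat k'"
    using *[OF u v] *[OF v u] by blast
  then have "of_nat k = height (n + m) w - height (n + m) w'" "of_nat k' = height (n + m) w' - height (n + m) w"
    by simp_all
  then have "of_nat (k + k') = (0 :: complex)" by simp
  then have "k = 0" by (metis add_is_0 of_nat_eq_0_iff)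
  then show ?thesis using \<open>height (n + m) w' = height (n + m) w - of_nat k\<close> by simp
qed

end

section \<open>Rectangular highest weights\<close>

text \<open>The coefficient of \<open>v j k\<close> in (\<Omega> - a)(\<Omega> + p) after the weight
  \<open>par_sign (\<pi> j)\<close> of the split Casimir is taken out; dividing the identity by this
  weight leaves a sign in the constant term.\<close>

definition rect_tensor ::
  "nat \<Rightarrow> (nat \<Rightarrow> bit) \<Rightarrow> complex \<Rightarrow> complex \<Rightarrow> (nat \<Rightarrow> nat \<Rightarrow> 'r::complex_alg) \<Rightarrow> nat \<Rightarrow> nat \<Rightarrow> 'r" where
  "rect_tensor L \<pi> a p e k j = adjoint_square L \<pi> e k j + (p - a) *\<^sub>C e k j
     - (if k = j then (a * p * par_sign (\<pi> j)) *\<^sub>C 1 else 0)"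

text \<open>The three summands transform alike. For the constant one this rests on its sign: in the
  present convention the invariant family is diagonal with entries (-1)^j, not the Kronecker
  delta.\<close>

lemma rect_tensor_commutator:
  assumes e: "gl_rep L \<pi> e" and l: "c < L" "d < L" "k < L" "j < L"
  defines "s \<equiv> par_sign ((\<pi> c + \<pi> d) * (\<pi> k + \<pi> j))"
  shows "e c d * rect_tensor L \<pi> a p e k j - s *\<^sub>C (rect_tensor L \<pi> a p e k j * e c d)
    = (if d = k then rect_tensor L \<pi> a p e c j else 0)
      - s *\<^sub>C (if c = j then rect_tensor L \<pi> a p e k d else 0)"
proof -
  define q where "q k j = (if k = j then (a * p * par_sign (\<pi> j)) *\<^sub>C (1::'a) else 0)" for k j
  have Q: "rect_tensor L \<pi> a p e k j = adjoint_square L \<pi> e k j + (p - a) *\<^sub>C e k j - q k j" for k j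
    by (simp add: rect_tensor_def q_def)
  have 1: "e c d * adjoint_square L \<pi> e k j = s *\<^sub>C (adjoint_square L \<pi> e k j * e c d)
      + ((if d = k then adjoint_square L \<pi> e c j else 0) - s *\<^sub>C (if c = j then adjoint_square L \<pi> e k d else 0))"
    using adjoint_square_commutator[OF e l] unfolding s_def by (simp add: algebra_simps)
  have 2: "e c d * e k j = s *\<^sub>C (e k j * e c d) + ((if d = k then e c j else 0) - s *\<^sub>C (if c = j then e k d else 0))"
    using gl_repD[OF e l] unfolding s_def by (simp add: add_diff_eq)
  \<comment> \<open>This settles the case k \<noteq> j with (c, d) = (j, k), where the diagonal
    entries at j and at k meet.\<close>
  have "par_sign ((x + y) * (y + x)) * par_sign y = par_sign x" for x y
    by (cases x; cases y; simp)
  then have s1: "d = k \<Longrightarrow> c = j \<Longrightarrow> s * par_sign (\<pi> d) = par_sign (\<pi> j)"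
    unfolding s_def by simp
  have s2: "k = j \<Longrightarrow> s = 1"
    unfolding s_def by simp
  have 3: "e c d * q k j = s *\<^sub>C (q k j * e c d) + ((if d = k then q c j else 0) - s *\<^sub>C (if c = j then q k d else 0))"
  proof (cases "k = j")
    case True
    then show ?thesis using s2 by (auto simp: q_def)
  next
    case False
    have "s * (a * p * par_sign (\<pi> d)) = a * p * par_sign (\<pi> j)" if "d = k" "c = j"
      using s1[OF that] by (simp add: mult.left_commute)
    then show ?thesis using False by (auto simp: q_def)
  qed
  show ?thesis
    unfolding Q distrib_left distrib_right left_diff_distrib right_diff_distrib scaleC_mult_left scaleC_mult_right
      1 2 3
    by (cases "d = k"; cases "c = j"; simp add: scaleC_ring_simps mult.commute algebra_simps)
qed

text \<open>In E_ik E_ki v the right operator kills v for i > k. For i < k the two are interchanged,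
  which leaves only the Cartan part of their bracket, and i = k gives the square of the
  weight.\<close>

lemma adjoint_square_diagonal:
  assumes e: "gl_rep L \<pi> e" and k: "k < L"
    and up: "\<And>i j. i < j \<Longrightarrow> j < L \<Longrightarrow> app (e i j) v = 0"
    and diag: "\<And>i. i < L \<Longrightarrow> app (e i i) v = w i *\<^sub>C v"
  shows "app (adjoint_square L \<pi> e k k) v
    = (par_sign (\<pi> k) * (w k * w k + (\<Sum>i<k. w i - par_sign (\<pi> i + \<pi> k) * w k))) *\<^sub>C v"
proof -
  have s: "par_sign (\<pi> i + (\<pi> i + \<pi> k) * (\<pi> k + \<pi> i)) = par_sign (\<pi> k)" for i
    by (cases "\<pi> i"; cases "\<pi> k"; simp)
  have t: "app (e i k) (app (e k i) v)
      = (if i < k then (w i - par_sign (\<pi> i + \<pi> k) * w k) *\<^sub>C v else if i = k then (w k * w k) *\<^sub>C v else 0)"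
    if i: "i < L" for i
  proof -
    consider "i < k" | "i = k" | "k < i" by linarith
    then show ?thesis
    proof cases
      case 1
      have "e i k * e k i = par_sign (\<pi> i + \<pi> k) *\<^sub>C (e k i * e i k) + e i i - par_sign (\<pi> i + \<pi> k) *\<^sub>C e k k"
        using gl_repD[OF e i k k i] by (simp add: add.commute[of "\<pi> k"])
      then have "app (e i k * e k i) v
        = app (par_sign (\<pi> i + \<pi> k) *\<^sub>C (e k i * e i k) + e i i - par_sign (\<pi> i + \<pi> k) *\<^sub>C e k k) v"
        by simp
      then show ?thesis
        using 1 up[OF 1 k] diag[OF i] diag[OF k] by (simp add: complex_vector.scale_left_diff_distrib)
    next
      case 2
      then show ?thesis using diag[OF k] by (simp add: app_linear)
    next
      case 3
      then show ?thesis using up[OF 3 i] by simp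
    qed
  qed
  have sub: "{..<k} \<subseteq> {..<L}" "k \<in> {..<L} - {..<k}" using k by auto
  have "app (adjoint_square L \<pi> e k k) v = (\<Sum>i<L. par_sign (\<pi> k) *\<^sub>C app (e i k) (app (e k i) v))"
    by (simp add: adjoint_square_def app_sum_left s)
  also have "\<dots> = (\<Sum>i<L. par_sign (\<pi> k) *\<^sub>C (if i < k then (w i - par_sign (\<pi> i + \<pi> k) * w k) *\<^sub>C v
      else if i = k then (w k * w k) *\<^sub>C v else 0))"
    by (intro sum.cong refl) (use t in auto)
  also have "\<dots> = (\<Sum>i<Suc k. par_sign (\<pi> k) *\<^sub>C (if i < k then (w i - par_sign (\<pi> i + \<pi> k) * w k) *\<^sub>C v
      else if i = k then (w k * w k) *\<^sub>C v else 0))"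
    by (rule sum.mono_neutral_right) (use k in auto)
  also have "\<dots> = (\<Sum>i<k. par_sign (\<pi> k) *\<^sub>C (w i - par_sign (\<pi> i + \<pi> k) * w k) *\<^sub>C v)
      + par_sign (\<pi> k) *\<^sub>C (w k * w k) *\<^sub>C v"
    by simp
  also have "\<dots> = (par_sign (\<pi> k) * (w k * w k + (\<Sum>i<k. w i - par_sign (\<pi> i + \<pi> k) * w k))) *\<^sub>C v"
    by (simp add: distrib_left scaleC_add_left sum_distrib_left complex_vector.scale_sum_left add.commute)
  finally show ?thesis .
qed

text \<open>The subtraction p - n is truncated: a rectangle with p \<le> n leaves nothing below row
  n.\<close>

lemma hook_weight_rectangle:
  "hook_weight n (rectangle a p) i
    = of_nat (if i < n then (if i < p then a else 0) else (if i - n < a then p - n else 0))"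
proof -
  have "{k. n \<le> k \<and> i - n < rectangle a p k} = (if i - n < a then {n..<p} else {})"
    by (auto simp: rectangle_def split: if_splits)
  then show ?thesis by (simp add: hook_weight_def) (simp add: rectangle_def)
qed

lemma sum_if_less: "(\<Sum>i<k. if i < p then c else (0::complex)) = of_nat (min k p) * c"
  by (induction k) (auto simp: algebra_simps min_def)

text \<open>The shape enters here. At an even position inside the rectangle all earlier weights
  equal a, the sum vanishes, and a^2 + (p - a) a - a p = 0 remains. Beyond the rectangle the weight
  is 0 and the sum has collected the whole area a p. At an odd position the rows contribute a min(n,
  p) and each earlier column p - n.\<close>

lemma rectangle_weight_identity:
  fixes n a p k :: nat
  defines "w \<equiv> hook_weight n (rectangle a p)"
  shows "w k * w k + (\<Sum>i<k. w i - par_sign (par n i + par n k) * w k)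
    + par_sign (par n k) * (of_nat p - of_nat a) * w k - of_nat a * of_nat p = 0"
proof (cases "k < n")
  case True
  have "(\<Sum>i<k. w i - par_sign (par n i + par n k) * w k)
      = (\<Sum>i<k. (if i < p then of_nat a else 0) - w k)"
    using True by (intro sum.cong) (auto simp: w_def hook_weight_rectangle par_def)
  then have "(\<Sum>i<k. w i - par_sign (par n i + par n k) * w k) = of_nat (min k p) * of_nat a - of_nat k * w k"
    by (simp add: sum_subtractf sum_if_less)
  then show ?thesis
    using True by (auto simp: w_def hook_weight_rectangle par_def algebra_simps min_def)
next
  case False
  then obtain r where k: "k = n + r" by (metis le_add_diff_inverse not_less)
  have e: "w i = (if i < p then of_nat a else 0)" if "i < n" for i
    using that by (simp add: w_def hook_weight_rectangle)
  have o: "w (n + i) = (if i < a then of_nat (p - n) else 0)" for i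
    by (simp add: w_def hook_weight_rectangle)
  have "(\<Sum>i<n + r. f i) = (\<Sum>i<n. f i) + (\<Sum>i<r. f (n + i))" for f :: "nat \<Rightarrow> complex"
    by (induction r) (simp_all add: add.assoc)
  then have "(\<Sum>i<k. w i - par_sign (par n i + par n k) * w k)
      = (\<Sum>i<n. w i - par_sign (par n i + par n k) * w k) + (\<Sum>i<r. w (n + i) - par_sign (par n (n + i) + par n k) * w k)"
    unfolding k by blast
  \<comment> \<open>For i < n \<le> k the parities differ and the subtraction becomes an addition;
    between two odd positions it stays a subtraction.\<close>
  also have "(\<Sum>i<n. w i - par_sign (par n i + par n k) * w k) = (\<Sum>i<n. (if i < p then of_nat a else 0) + w k)"
    using k by (intro sum.cong) (auto simp: e par_def)
  also have "\<dots> = of_nat (min n p) * of_nat a + of_nat n * w k"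
    by (simp add: sum.distrib sum_if_less)
  also have "(\<Sum>i<r. w (n + i) - par_sign (par n (n + i) + par n k) * w k)
      = (\<Sum>i<r. (if i < a then of_nat (p - n) else 0) - w k)"
    using k by (intro sum.cong) (auto simp: o par_def)
  also have "\<dots> = of_nat (min r a) * of_nat (p - n) - of_nat r * w k"
    by (simp add: sum_subtractf sum_if_less)
  finally have *: "(\<Sum>i<k. w i - par_sign (par n i + par n k) * w k)
      = of_nat (min n p) * of_nat a + of_nat n * w k + (of_nat (min r a) * of_nat (p - n) - of_nat r * w k)" .
  have wk: "w k = (if r < a then of_nat (p - n) else 0)"
    using o[of r] k by simp
  have pk: "par_sign (par n k) = -1" using k by (simp add: par_def)
  show ?thesis
  proof (cases "p \<le> n")
    case True
    then show ?thesis unfolding * by (simp add: wk)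
  next
    case False
    then obtain u where "p = n + u" by (metis le_add_diff_inverse nat_le_linear)
    then show ?thesis unfolding * by (cases "r < a") (simp_all add: wk pk algebra_simps)
  qed
qed

text \<open>Homogeneity of the components makes their common kernel stable under the parity
  involution.\<close>

lemma sign_op_rect_tensor:
  assumes M: "gl_supermodule n m M"
  shows "sign_op M 1 * rect_tensor (n + m) (par n) a p (unit_op n m M) k j
    = par_sign (par n k + par n j) *\<^sub>C (rect_tensor (n + m) (par n) a p (unit_op n m M) k j * sign_op M 1)"
proof -
  let ?e = "unit_op n m M"
  have g: "sign_op M 1 * ?e i j = par_sign (par n i + par n j) *\<^sub>C (?e i j * sign_op M 1)" for i j
    using sign_op_unit_op[OF M, of 1] by simp
  have "sign_op M 1 * (?e i j * ?e k i) = par_sign (par n k + par n j) *\<^sub>C (?e i j * ?e k i * sign_op M 1)" for i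
  proof -
    have "sign_op M 1 * (?e i j * ?e k i) = sign_op M 1 * ?e i j * ?e k i" by (simp add: mult.assoc)
    also have "\<dots> = (par_sign (par n i + par n j) * par_sign (par n k + par n i)) *\<^sub>C (?e i j * ?e k i * sign_op M 1)"
      by (simp add: g mult.assoc)
    also have "par_sign (par n i + par n j) * par_sign (par n k + par n i) = par_sign (par n k + par n j)"
      by (cases "par n i"; cases "par n j"; cases "par n k"; simp)
    finally show ?thesis .
  qed
  then have "sign_op M 1 * adjoint_square (n + m) (par n) ?e k j
    = par_sign (par n k + par n j) *\<^sub>C (adjoint_square (n + m) (par n) ?e k j * sign_op M 1)"
    by (simp add: adjoint_square_def sum_distrib_left sum_distrib_right complex_vector.scale_sum_right mult.commute)
  then show ?thesis
    unfolding rect_tensor_def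
    by (simp add: distrib_left distrib_right left_diff_distrib right_diff_distrib scaleC_ring_simps g mult.commute)
qed

text \<open>The common kernel of the components of the tensor operator is a submodule, and it contains
  the highest weight vector: applied to it, a component gives a singular vector, whose weight is the
  highest one only for a diagonal component.\<close>

theorem rect_tensor_eq_0:
  assumes L: "is_L n m (hook_weight n (rectangle a p)) M" and kj: "k < n + m" "j < n + m"
  shows "rect_tensor (n + m) (par n) (of_nat a) (of_nat p) (unit_op n m M) k j = 0"
proof -
  define w where "w = hook_weight n (rectangle a p)"
  define Q where "Q = rect_tensor (n + m) (par n) (of_nat a) (of_nat p) (unit_op n m M)"
  let ?e = "unit_op n m M"
  have irr: "irreducible_supermodule n m M" using L by (simp add: is_L_def)
  note M = irr_supermodule[OF irr]
  note e = gl_rep_unit_op[OF M]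
  from L obtain v where v: "singular n m M w v" "v \<noteq> 0"
    unfolding is_L_def singular_def app_unit_op[OF M] w_def by blast
  then have up: "\<And>i j. i < j \<Longrightarrow> j < n + m \<Longrightarrow> app (?e i j) v = 0"
    and diag: "\<And>i. i < n + m \<Longrightarrow> app (?e i i) v = w i *\<^sub>C v"
    by (simp_all add: singular_def)
  obtain s where s: "v \<in> hcomp M s" using v(1) by (auto simp: singular_def)
  have comm: "app (?e c d) (app (Q k j) u)
      = par_sign ((par n c + par n d) * (par n k + par n j)) *\<^sub>C app (Q k j) (app (?e c d) u)
        + (if d = k then app (Q c j) u else 0)
        - par_sign ((par n c + par n d) * (par n k + par n j)) *\<^sub>C (if c = j then app (Q k d) u else 0)"
    if "c < n + m" "d < n + m" "k < n + m" "j < n + m" for c d k j u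
  proof -
    let ?s = "par_sign ((par n c + par n d) * (par n k + par n j))"
    have "?e c d * Q k j = ?s *\<^sub>C (Q k j * ?e c d) + (if d = k then Q c j else 0) - ?s *\<^sub>C (if c = j then Q k d else 0)"
      using rect_tensor_commutator[OF e that, of "of_nat a" "of_nat p"] unfolding Q_def[symmetric]
      by (simp only: diff_eq_eq) (simp only: algebra_simps)
    then have "app (?e c d * Q k j) u
      = app (?s *\<^sub>C (Q k j * ?e c d) + (if d = k then Q c j else 0) - ?s *\<^sub>C (if c = j then Q k d else 0)) u"
      by simp
    then show ?thesis by simp
  qed
  have Qv: "app (Q k j) v = 0" if "k < n + m" "j < n + m" for k j
    using that
  \<comment> \<open>A raising operator E_cd sends Q k j v to combinations of Q c j v, if d = k, and
    Q k d v, if c = j. As c < d, the first index drops or the second grows, and the measure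
    decreases.\<close>
  proof (induction "k + (n + m - j)" arbitrary: k j rule: less_induct)
    case less
    have IH: "app (Q c j) v = 0" if "c < k" for c
      using less.hyps[of c j] less.prems that by auto
    have IH': "app (Q k d) v = 0" if "j < d" "d < n + m" for d
      using less.hyps[of k d] less.prems that by auto
    define u where "u = app (Q k j) v"
    \<comment> \<open>The weight w + \<epsilon>_k - \<epsilon>_j of the vector u.\<close>
    define w' where "w' i = w i + of_bool (i = k) - of_bool (i = j)" for i
    have "app (sign_op M 1) u = app (sign_op M 1 * Q k j) v" by (simp add: u_def)
    also have "\<dots> = par_sign (par n k + par n j + s) *\<^sub>C u"
      using s hcomp_iff[OF M, of v s] unfolding Q_def sign_op_rect_tensor[OF M] u_def
      by (simp add: app_linear par_sign_add)
    finally have "\<exists>s. u \<in> hcomp M s"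
      using hcomp_iff[OF M] by blast
    moreover have "app (?e c d) u = 0" if "c < d" "d < n + m" for c d
      using comm[of c d k j v] that less.prems IH[of c] IH'[of d] up[OF that] unfolding u_def
      by (auto split: if_splits)
    moreover have "app (?e c c) u = w' c *\<^sub>C u" if "c < n + m" for c
      using comm[of c c k j v] that less.prems unfolding u_def w'_def diag[OF that]
      by (auto simp: app_linear scaleC_add_left complex_vector.scale_left_diff_distrib)
    ultimately have sing: "singular n m M w' u" by (simp add: singular_def)
    show ?case
    proof (rule ccontr)
      assume "app (Q k j) v \<noteq> 0"
      then have "u \<noteq> 0" by (simp add: u_def)
      then have "height (n + m) w' = height (n + m) w"
        using singular_height_unique[OF irr sing _ v] by simp
      moreover have "height (n + m) w' = height (n + m) w + (\<Sum>i<n + m. if i = k then - of_nat k else 0)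
          - (\<Sum>i<n + m. if i = j then - of_nat j else 0)"
        unfolding height_def sum.distrib[symmetric] sum_subtractf[symmetric] w'_def
        by (intro sum.cong refl) (auto simp: algebra_simps)
      \<comment> \<open>The height of w' exceeds that of w by j - k, so equal heights leave only the
        diagonal case.\<close>
      ultimately have "of_nat j = (of_nat k :: complex)" using less.prems by simp
      then have jk: "j = k" by simp
      define x where "x = w k * w k + (\<Sum>i<k. w i - par_sign (par n i + par n k) * w k)"
      have "app (adjoint_square (n + m) (par n) ?e k k) v = (par_sign (par n k) * x) *\<^sub>C v"
        unfolding x_def by (rule adjoint_square_diagonal[OF e less.prems(1) up diag])
      then have "app (Q k k) v = (par_sign (par n k) * x) *\<^sub>C v + ((of_nat p - of_nat a) * w k) *\<^sub>C v
          - (of_nat a * of_nat p * par_sign (par n k)) *\<^sub>C v"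
        by (simp add: Q_def rect_tensor_def diag[OF less.prems(1)])
      also have "\<dots> = (par_sign (par n k) * x + (of_nat p - of_nat a) * w k
          - of_nat a * of_nat p * par_sign (par n k)) *\<^sub>C v"
        by (simp only: scaleC_add_left complex_vector.scale_left_diff_distrib)
      also have "par_sign (par n k) * x + (of_nat p - of_nat a) * w k - of_nat a * of_nat p * par_sign (par n k)
          = par_sign (par n k) * (x + par_sign (par n k) * (of_nat p - of_nat a) * w k - of_nat a * of_nat p)"
        by (simp add: algebra_simps)
      also have "\<dots> = 0"
        using rectangle_weight_identity[where n = n and a = a and p = p and k = k] by (simp add: x_def w_def)
      finally show False using \<open>app (Q k j) v \<noteq> 0\<close> jk by simp
    qed
  qed
  define K where "K = {u. \<forall>k<n + m. \<forall>j<n + m. app (Q k j) u = 0}"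
  have "sub_supermodule n m M K"
  proof (rule sub_supermoduleI[OF M])
    show "csubspace K"
      by (rule complex_vector.subspaceI) (auto simp: K_def app_linear)
  next
    fix u assume u: "u \<in> K"
    have "app (Q k j) (app (sign_op M 1) u) = 0" if "k < n + m" "j < n + m" for k j
    proof -
      have "app (sign_op M 1 * Q k j) u = 0" using u that by (simp add: K_def)
      then show ?thesis
        unfolding Q_def sign_op_rect_tensor[OF M] by (simp add: par_sign_def split: if_splits)
    qed
    then show "app (sign_op M 1) u \<in> K" by (simp add: K_def)
  next
    fix c d u assume cd: "c < n + m" "d < n + m" and u: "u \<in> K"
    have "app (Q k j) (app (?e c d) u) = 0" if "k < n + m" "j < n + m" for k j
      using comm[OF cd that, of u] u cd that
      by (auto simp: K_def par_sign_def split: if_splits)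
    then show "app (?e c d) u \<in> K" by (simp add: K_def)
  qed
  then have "K = {0} \<or> K = UNIV"
    using irr unfolding irreducible_supermodule_def by blast
  moreover have "v \<in> K" using Qv by (simp add: K_def)
  ultimately have "K = UNIV" using v(2) by blast
  then have "app (Q k j) u = 0" for u
    using kj unfolding K_def by blast
  then show ?thesis
    unfolding Q_def[symmetric] by (intro endo_eqI) simp
qed

section \<open>Split Casimir operators and the braid relations\<close>

fun move_factor :: "(nat \<Rightarrow> nat) \<Rightarrow> factor \<Rightarrow> factor" where
  "move_factor f FM = FM"
| "move_factor f FN = FN"
| "move_factor f (FV k) = FV (f k)"

lemma inj_move_factor: "inj f \<Longrightarrow> inj (move_factor f)"
  by (rule injI, case_tac x; case_tac y; auto dest: injD)

lemma commute_linear: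
  fixes x y z :: "'r::complex_alg"
  shows "x * y = y * x \<Longrightarrow> x * z = z * x \<Longrightarrow> x * (y + z) = (y + z) * x"
    and "x * y = y * x \<Longrightarrow> x * z = z * x \<Longrightarrow> x * (y - z) = (y - z) * x"
    and "x * y = y * x \<Longrightarrow> x * (c *\<^sub>C y) = (c *\<^sub>C y) * x"
    and "x * y = y * x \<Longrightarrow> z * y = y * z \<Longrightarrow> (x + z) * y = y * (x + z)"
    and "x * y = y * x \<Longrightarrow> z * y = y * z \<Longrightarrow> (x - z) * y = y * (x - z)"
    and "x * y = y * x \<Longrightarrow> (c *\<^sub>C x) * y = y * (c *\<^sub>C x)"
  by (simp_all add: algebra_simps)

text \<open>This serves with A' = A and B' = B, to show that x commutes with a Casimir operator, and
  with permuted factors, to conjugate by t_i.\<close>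

lemma split_casimir_intertwine:
  assumes "\<And>i j. i < L \<Longrightarrow> j < L \<Longrightarrow> x * A i j = A' i j * x"
    and "\<And>i j. i < L \<Longrightarrow> j < L \<Longrightarrow> x * B i j = B' i j * x"
  shows "x * split_casimir L \<pi> A B = split_casimir L \<pi> A' B' * x"
proof -
  have "x * (A i j * B j i) = A' i j * B' j i * x" if "i < L" "j < L" for i j
    using assms(1)[OF that] assms(2)[OF that(2,1)] by (metis mult.assoc)
  then show ?thesis
    by (simp add: split_casimir_def sum_distrib_left sum_distrib_right)
qed

lemma split_casimir_corner:
  "(\<And>i j. x * A i j = A i j) \<Longrightarrow> x * split_casimir L \<pi> A B = split_casimir L \<pi> A B"
  "(\<And>i j. B i j * x = B i j) \<Longrightarrow> split_casimir L \<pi> A B * x = split_casimir L \<pi> A B"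
proof -
  assume "\<And>i j. x * A i j = A i j"
  then have "x * (A i j * B j i) = A i j * B j i" for i j
    by (simp flip: mult.assoc)
  then show "x * split_casimir L \<pi> A B = split_casimir L \<pi> A B"
    by (simp add: split_casimir_def sum_distrib_left)
next
  assume "\<And>i j. B i j * x = B i j"
  then show "split_casimir L \<pi> A B * x = split_casimir L \<pi> A B"
    by (simp add: split_casimir_def sum_distrib_right mult.assoc)
qed

text \<open>The operators live in the corner of the ring cut out by the idempotent \<open>P\<close>, which is the
  projection to the coefficient functions supported on words of length \<open>d\<close>.\<close>

locale braid_action =
  fixes L d :: nat and \<pi> :: "nat \<Rightarrow> bit" and P :: "'r::complex_alg"
    and e :: "factor \<Rightarrow> nat \<Rightarrow> nat \<Rightarrow> 'r" and t :: "nat \<Rightarrow> 'r"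
  assumes P_P [simp]: "P * P = P"
    and e_P [simp]: "e F i j * P = e F i j" and P_e [simp]: "P * e F i j = e F i j"
    and t_P [simp]: "t i * P = t i" and P_t [simp]: "P * t i = t i"
    and rep: "F \<in> all_factors d \<Longrightarrow> gl_rep L \<pi> (e F)"
    and comm: "F \<in> all_factors d \<Longrightarrow> G \<in> all_factors d \<Longrightarrow> F \<noteq> G \<Longrightarrow> super_commuting L \<pi> (e F) (e G)"
    and unit_mult: "k \<in> {1..d} \<Longrightarrow> i < L \<Longrightarrow> j < L \<Longrightarrow> r < L \<Longrightarrow> l < L \<Longrightarrow>
      e (FV k) i j * e (FV k) r l = (if j = r then e (FV k) i l else 0)"
    and unit_sum: "k \<in> {1..d} \<Longrightarrow> (\<Sum>i<L. e (FV k) i i) = P"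
    and t_t: "i \<in> {1..<d} \<Longrightarrow> t i * t i = P"
    and t_e: "i \<in> {1..<d} \<Longrightarrow> F \<in> all_factors d \<Longrightarrow> r < L \<Longrightarrow> l < L \<Longrightarrow>
      t i * e F r l = e (move_factor (transpose i (Suc i)) F) r l * t i"
    and t_casimir: "i \<in> {1..<d} \<Longrightarrow> t i = split_casimir L \<pi> (e (FV i)) (e (FV (Suc i)))"
begin

definition om :: "factor \<Rightarrow> factor \<Rightarrow> 'r" where
  "om F G = split_casimir L \<pi> (e F) (e G)"

definition e_sum :: "factor set \<Rightarrow> nat \<Rightarrow> nat \<Rightarrow> 'r" where
  "e_sum S i j = (\<Sum>F\<in>S. e F i j)"

definition cas :: "factor set \<Rightarrow> 'r" where
  "cas S = split_casimir L \<pi> (e_sum S) (e_sum S)"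

definition cas_V :: complex where
  "cas_V = (\<Sum>j<L. par_sign (\<pi> j))"

definition step_op :: "factor set \<Rightarrow> nat \<Rightarrow> 'r" where
  "step_op S i = (1 / 2) *\<^sub>C (cas (S \<union> FV ` {1..i}) - cas (S \<union> FV ` {1..i - 1}) - cas_V *\<^sub>C P)"

definition zero_op :: 'r where
  "zero_op = (1 / 2) *\<^sub>C (cas {FM, FN} - cas {FM} - cas {FN})"

lemma finite_factors: "S \<subseteq> all_factors d \<Longrightarrow> finite S"
  by (erule finite_subset) (simp add: all_factors_def)

lemma factor_in [simp]: "FM \<in> all_factors d" "FN \<in> all_factors d" "FV k \<in> all_factors d \<longleftrightarrow> k \<in> {1..d}"
  by (auto simp: all_factors_def)

lemma sc_e_sum:
  assumes "S \<subseteq> all_factors d" "F \<in> all_factors d" "F \<notin> S"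
  shows "super_commuting L \<pi> (e F) (e_sum S)"
  unfolding e_sum_def
  by (rule super_commuting_sym, rule super_commuting_sum, rule comm) (use assms in auto)

lemma rep_e_sum: "S \<subseteq> all_factors d \<Longrightarrow> gl_rep L \<pi> (e_sum S)"
  unfolding e_sum_def by (rule gl_rep_sum) (auto intro: rep comm finite_factors)

lemma P_om [simp]: "P * om F G = om F G" "om F G * P = om F G"
  unfolding om_def by (intro split_casimir_corner e_P P_e)+

lemma P_e_sum [simp]: "P * e_sum S i j = e_sum S i j" "e_sum S i j * P = e_sum S i j"
  by (simp_all add: e_sum_def sum_distrib_left sum_distrib_right)

lemma P_cas [simp]: "P * cas S = cas S" "cas S * P = cas S"
  unfolding cas_def by (intro split_casimir_corner P_e_sum)+

lemma P_step_op [simp]: "P * step_op S i = step_op S i" "step_op S i * P = step_op S i"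
  by (simp_all add: step_op_def left_diff_distrib right_diff_distrib)

lemma P_zero_op [simp]: "P * zero_op = zero_op" "zero_op * P = zero_op"
  by (simp_all add: zero_op_def left_diff_distrib right_diff_distrib)

text \<open>When S is part of S', the action on S' is the action on S, for which \<kappa> is
  central, plus the action on the disjoint rest, which commutes with the even element
  \<kappa>.\<close>

lemma cas_commute_e_sum:
  assumes "S' \<subseteq> all_factors d" "S \<subseteq> S' \<or> S \<inter> S' = {}" "S \<subseteq> all_factors d" "i < L" "j < L"
  shows "cas S * e_sum S' i j = e_sum S' i j * cas S"
proof -
  have out: "cas S * e_sum R i j = e_sum R i j * cas S" if "R \<subseteq> all_factors d" "S \<inter> R = {}" for R
  proof -
    have "e F i j * cas S = cas S * e F i j" if "F \<in> R" for F
      unfolding cas_def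
      by (rule casimir_commutes[OF sc_e_sum assms(4,5)])
        (use that assms(3) \<open>R \<subseteq> all_factors d\<close> \<open>S \<inter> R = {}\<close> in auto)
    then show ?thesis by (simp add: e_sum_def sum_distrib_left sum_distrib_right)
  qed
  show ?thesis
  proof (cases "S \<subseteq> S'")
    case True
    have "e_sum S' i j = e_sum (S' - S) i j + e_sum S i j"
      unfolding e_sum_def by (rule sum.subset_diff[OF True finite_factors[OF assms(1)]])
    moreover have "cas S * e_sum S i j = e_sum S i j * cas S"
      unfolding cas_def by (rule casimir_central[symmetric, OF rep_e_sum[OF assms(3)] assms(4,5)])
    moreover have "cas S * e_sum (S' - S) i j = e_sum (S' - S) i j * cas S"
      by (rule out) (use assms in auto)
    ultimately show ?thesis by (simp add: distrib_left distrib_right)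
  qed (use assms out in auto)
qed

text \<open>For nested sets the smaller Casimir operator commutes with the action on the larger set
  and so with its Casimir operator. The commutation of the x_i, of the y_i, of the z_i, and (R2) all
  come from here.\<close>

lemma cas_commute:
  assumes "S' \<subseteq> all_factors d" "S \<subseteq> S' \<or> S' \<subseteq> S \<or> S \<inter> S' = {}" "S \<subseteq> all_factors d"
  shows "cas S * cas S' = cas S' * cas S"
proof -
  have *: "cas S * cas S' = cas S' * cas S"
    if "S' \<subseteq> all_factors d" "S \<subseteq> S' \<or> S \<inter> S' = {}" "S \<subseteq> all_factors d" for S S'
    unfolding cas_def[of S'] by (rule split_casimir_intertwine) (use that cas_commute_e_sum in blast)+
  show ?thesis using assms *[of S' S] *[of S S'] by auto
qed

lemma step_op_commute:
  assumes "S \<subseteq> {FM, FN}" "i \<le> d" "j \<le> d"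
  shows "step_op S i * step_op S j = step_op S j * step_op S i"
proof -
  have a: "S \<union> FV ` {1..k} \<subseteq> all_factors d" if "k \<le> d" for k
    using assms(1) that by (auto simp: all_factors_def)
  have c: "cas (S \<union> FV ` {1..k}) * cas (S \<union> FV ` {1..l}) = cas (S \<union> FV ` {1..l}) * cas (S \<union> FV ` {1..k})"
    if "k \<le> d" "l \<le> d" for k l
  proof (rule cas_commute[OF a[OF that(2)] _ a[OF that(1)]])
    have "{1..k} \<subseteq> {1..l} \<or> {1..l} \<subseteq> {1..k}" by auto
    then show "S \<union> FV ` {1..k} \<subseteq> S \<union> FV ` {1..l} \<or> S \<union> FV ` {1..l} \<subseteq> S \<union> FV ` {1..k}
        \<or> (S \<union> FV ` {1..k}) \<inter> (S \<union> FV ` {1..l}) = {}"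
      by blast
  qed
  show ?thesis
    unfolding step_op_def using assms by (intro commute_linear c) simp_all
qed

lemma zero_op_commute:
  assumes "i \<le> d"
  shows "zero_op * step_op {FM, FN} i = step_op {FM, FN} i * zero_op"
proof -
  have c: "cas U * cas ({FM, FN} \<union> FV ` {1..k}) = cas ({FM, FN} \<union> FV ` {1..k}) * cas U"
    if "k \<le> d" "U \<subseteq> {FM, FN}" for k U
    by (rule cas_commute) (use that in \<open>auto simp: all_factors_def\<close>)
  show ?thesis
    unfolding zero_op_def step_op_def
    by (intro commute_linear c) (use assms in simp_all)
qed

text \<open>The sum telescopes to the Casimir operator of M, N and the first i copies of V; those of
  M and of N alone remain.\<close>

lemma zero_op_sum:
  "zero_op + (\<Sum>k\<in>{1..i}. step_op {FM, FN} k)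
    = (1 / 2) *\<^sub>C (cas ({FM, FN} \<union> FV ` {1..i}) - cas {FM} - cas {FN} - (of_nat i * cas_V) *\<^sub>C P)"
proof (induction i)
  case 0
  show ?case by (simp add: zero_op_def)
next
  case (Suc i)
  have "zero_op + (\<Sum>k\<in>{1..Suc i}. step_op {FM, FN} k)
    = (zero_op + (\<Sum>k\<in>{1..i}. step_op {FM, FN} k)) + step_op {FM, FN} (Suc i)"
    by (simp add: add.assoc)
  also have "\<dots> = (1 / 2) *\<^sub>C ((cas ({FM, FN} \<union> FV ` {1..i}) - cas {FM} - cas {FN} - (of_nat i * cas_V) *\<^sub>C P)
      + (cas ({FM, FN} \<union> FV ` {1..Suc i}) - cas ({FM, FN} \<union> FV ` {1..i}) - cas_V *\<^sub>C P))"
    unfolding Suc.IH step_op_def[of _ "Suc i"] scaleC_add_right diff_Suc_1 by (rule refl)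
  also have "(cas ({FM, FN} \<union> FV ` {1..i}) - cas {FM} - cas {FN} - (of_nat i * cas_V) *\<^sub>C P)
      + (cas ({FM, FN} \<union> FV ` {1..Suc i}) - cas ({FM, FN} \<union> FV ` {1..i}) - cas_V *\<^sub>C P)
      = cas ({FM, FN} \<union> FV ` {1..Suc i}) - cas {FM} - cas {FN} - (of_nat (Suc i) * cas_V) *\<^sub>C P"
    by (simp add: scaleC_add_left distrib_right)
  finally show ?case .
qed

text \<open>The bound j \<le> i places the factors of \<open>step_op S j\<close> inside those of the
  telescoped Casimir operator; {FM} and {FN} are nested in them or disjoint from them.\<close>

lemma sum_commute:
  assumes "S = {FM} \<or> S = {FN}" "1 \<le> j" "j \<le> i" "i \<le> d"
  shows "(zero_op + (\<Sum>k\<in>{1..i}. step_op {FM, FN} k)) * step_op S j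
    = step_op S j * (zero_op + (\<Sum>k\<in>{1..i}. step_op {FM, FN} k))"
proof -
  have c: "cas U * cas (S \<union> FV ` {1..k}) = cas (S \<union> FV ` {1..k}) * cas U"
    if "k \<le> i" "U = {FM, FN} \<union> FV ` {1..i} \<or> U = {FM} \<or> U = {FN}" for k U
  proof (rule cas_commute)
    have k: "FV ` {1..k} \<subseteq> FV ` {1..i}" using that by (intro image_mono) auto
    show "S \<union> FV ` {1..k} \<subseteq> all_factors d" "U \<subseteq> all_factors d"
      using assms that by (auto simp: all_factors_def)
    show "U \<subseteq> S \<union> FV ` {1..k} \<or> S \<union> FV ` {1..k} \<subseteq> U \<or> U \<inter> (S \<union> FV ` {1..k}) = {}"
    proof (cases "U = {FM, FN} \<union> FV ` {1..i}")
      case True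
      moreover have "S \<subseteq> {FM, FN}" using assms(1) by auto
      ultimately have "S \<union> FV ` {1..k} \<subseteq> U" using k by (metis Un_mono)
      then show ?thesis by blast
    next
      case False
      then show ?thesis using that(2) assms(1) by auto
    qed
  qed
  show ?thesis
    unfolding zero_op_sum unfolding step_op_def
    by (intro commute_linear c) (use assms in simp_all)
qed

section \<open>Conjugation of Casimir operators by neighbouring transpositions\<close>

lemma t_om:
  assumes "i \<in> {1..<d}" "F \<in> all_factors d" "G \<in> all_factors d"
  shows "t i * om F G = om (move_factor (transpose i (Suc i)) F) (move_factor (transpose i (Suc i)) G) * t i"
  unfolding om_def by (intro split_casimir_intertwine t_e assms)

lemma t_e_sum:
  assumes "i \<in> {1..<d}" "S \<subseteq> all_factors d" "r < L" "l < L"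
  shows "t i * e_sum S r l = e_sum (move_factor (transpose i (Suc i)) ` S) r l * t i"
proof -
  have "inj (move_factor (transpose i (Suc i)))"
    by (rule inj_move_factor) simp
  then have "inj_on (move_factor (transpose i (Suc i))) S"
    by (rule inj_on_subset) simp
  then have "e_sum (move_factor (transpose i (Suc i)) ` S) r l * t i
      = (\<Sum>F\<in>S. e (move_factor (transpose i (Suc i)) F) r l * t i)"
    by (simp add: e_sum_def sum.reindex sum_distrib_right)
  also have "\<dots> = (\<Sum>F\<in>S. t i * e F r l)"
    by (intro sum.cong refl t_e[symmetric]) (use assms in auto)
  finally show ?thesis by (simp add: e_sum_def sum_distrib_left)
qed

lemma t_cas:
  assumes "i \<in> {1..<d}" "S \<subseteq> all_factors d"
  shows "t i * cas S = cas (move_factor (transpose i (Suc i)) ` S) * t i"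
  unfolding cas_def by (intro split_casimir_intertwine t_e_sum assms)

text \<open>The transposition (j, j+1) moves the initial segment {1..i} only for i = j. As
  \<open>step_op S i\<close> involves {1..i} and {1..i - 1}, it is t_j-invariant unless i is j or j
  + 1.\<close>

lemma move_factors:
  assumes "S \<subseteq> {FM, FN}" "i \<noteq> j" "0 < j"
  shows "move_factor (transpose j (Suc j)) ` (S \<union> FV ` {1..i}) = S \<union> FV ` {1..i}"
proof -
  have "transpose j (Suc j) ` {1..i} = {1..i}"
    by (rule transpose_image_eq) (use assms in auto)
  moreover have "move_factor f ` FV ` A = FV ` f ` A" for f A
    by (simp add: image_image)
  moreover have "move_factor f ` S = S" for f
  proof -
    have "move_factor f F = F" if "F \<in> S" for F
      using that assms(1) by auto
    then show ?thesis by (simp cong: image_cong)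
  qed
  ultimately show ?thesis by (simp add: image_Un)
qed

lemma t_cas_initial:
  assumes "j \<in> {1..<d}" "S \<subseteq> {FM, FN}" "i \<noteq> j" "i \<le> d"
  shows "t j * cas (S \<union> FV ` {1..i}) = cas (S \<union> FV ` {1..i}) * t j"
proof -
  have S: "S \<union> FV ` {1..i} \<subseteq> all_factors d" and j: "0 < j"
    using assms by (auto simp: all_factors_def)
  show ?thesis
    using t_cas[OF assms(1) S] unfolding move_factors[OF assms(2,3) j] .
qed

lemma t_step_op:
  assumes "j \<in> {1..<d}" "S \<subseteq> {FM, FN}" "i \<in> {1..d}" "i \<noteq> j" "i \<noteq> j + 1"
  shows "t j * step_op S i = step_op S i * t j"
proof -
  have P: "t j * P = P * t j" by simp
  show ?thesis
    unfolding step_op_def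
    by (intro commute_linear t_cas_initial P) (use assms in auto)
qed

lemma t_zero_op:
  assumes "j \<in> {1..<d}"
  shows "t j * zero_op = zero_op * t j"
proof -
  have "t j * cas S = cas S * t j" if "S \<subseteq> {FM, FN}" for S
    using t_cas_initial[OF assms that, of 0] assms by simp
  then show ?thesis
    unfolding zero_op_def by (intro commute_linear) simp_all
qed

text \<open>In the sum the Casimir operator of {1..i}, the only one that t_i moves, cancels.\<close>

lemma t_step_op_sum:
  assumes "i \<in> {1..<d}" "S \<subseteq> {FM, FN}"
  shows "t i * (step_op S i + step_op S (i + 1)) = (step_op S i + step_op S (i + 1)) * t i"
proof -
  have two: "(2 * cas_V) *\<^sub>C P = cas_V *\<^sub>C P + cas_V *\<^sub>C P"
    by (simp only: mult_2 scaleC_add_left)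
  have sum: "step_op S i + step_op S (i + 1)
      = (1 / 2) *\<^sub>C (cas (S \<union> FV ` {1..i + 1}) - cas (S \<union> FV ` {1..i - 1}) - 2 *\<^sub>C cas_V *\<^sub>C P)"
    unfolding step_op_def scaleC_add_right[symmetric]
    by (simp add: two)
  have c1: "t i * cas (S \<union> FV ` {1..i + 1}) = cas (S \<union> FV ` {1..i + 1}) * t i"
    by (rule t_cas_initial) (use assms in auto)
  have c2: "t i * cas (S \<union> FV ` {1..i - 1}) = cas (S \<union> FV ` {1..i - 1}) * t i"
    by (rule t_cas_initial) (use assms in auto)
  have P: "t i * P = P * t i" by simp
  show ?thesis
    unfolding sum by (intro commute_linear c1 c2 P)
qed

section \<open>The generators as sums of split Casimir operators\<close>

lemma cas_single:
  assumes "k \<in> {1..d}"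
  shows "om (FV k) (FV k) = cas_V *\<^sub>C P"
proof -
  have "om (FV k) (FV k) = (\<Sum>i<L. \<Sum>j<L. par_sign (\<pi> j) *\<^sub>C e (FV k) i i)"
    unfolding om_def split_casimir_def using unit_mult[OF assms] by (intro sum.cong refl) simp
  also have "\<dots> = cas_V *\<^sub>C P"
    unfolding cas_V_def unit_sum[OF assms, symmetric]
    by (simp add: complex_vector.scale_sum_left complex_vector.scale_sum_right)
  finally show ?thesis .
qed

text \<open>Adding one factor to a set adds its own Casimir operator, which is the subtracted scalar
  \<kappa>_V, and two equal sums of cross terms, which absorb the factor 1/2.\<close>

lemma step_op_eq:
  assumes "S \<subseteq> {FM, FN}" "i \<in> {1..d}"
  shows "step_op S i = (\<Sum>F\<in>S \<union> FV ` {1..i - 1}. om F (FV i))"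
proof -
  define R where "R = S \<union> FV ` {1..i - 1}"
  have R: "R \<subseteq> all_factors d" "FV i \<notin> R" "finite R"
    using assms finite_subset[OF assms(1)] by (auto simp: R_def all_factors_def)
  have ins: "S \<union> FV ` {1..i} = insert (FV i) R"
  proof -
    have "{1..i} = insert i {1..i - 1}" using assms(2) by auto
    then show ?thesis by (simp add: R_def)
  qed
  have "e_sum (insert (FV i) R) = (\<lambda>r l. e (FV i) r l + e_sum R r l)"
    using R by (simp add: e_sum_def fun_eq_iff)
  then have "cas (insert (FV i) R) = cas_V *\<^sub>C P + split_casimir L \<pi> (e (FV i)) (e_sum R)
      + (split_casimir L \<pi> (e_sum R) (e (FV i)) + cas R)"
    using cas_single[OF assms(2)] by (simp add: cas_def split_casimir_add om_def)
  moreover have "split_casimir L \<pi> (e (FV i)) (e_sum R) = split_casimir L \<pi> (e_sum R) (e (FV i))"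
    by (rule split_casimir_sym, rule sc_e_sum) (use R assms in auto)
  ultimately have "cas (insert (FV i) R) - cas R - cas_V *\<^sub>C P = 2 *\<^sub>C split_casimir L \<pi> (e_sum R) (e (FV i))"
    using scaleC_add_left[of 1 1 "split_casimir L \<pi> (e_sum R) (e (FV i))"] by simp
  then have "step_op S i = split_casimir L \<pi> (e_sum R) (e (FV i))"
    unfolding step_op_def ins R_def[symmetric] by simp
  also have "e_sum R = (\<lambda>r l. \<Sum>F\<in>R. e F r l)"
    by (simp add: e_sum_def fun_eq_iff)
  finally show ?thesis
    by (simp add: split_casimir_sum_left om_def R_def)
qed

text \<open>Conjugation by t_i turns each \<Omega>_(F,i) into \<Omega>_(F,i+1). The one summand of
  step i + 1 not reached in this way is \<Omega>_(i,i+1) = t_i. Besides the Hecke relation this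
  yields (R4) and (R5), whose differences all become transpositions.\<close>

lemma step_op_Suc:
  assumes "i \<in> {1..<d}" "S \<subseteq> {FM, FN}"
  shows "step_op S (i + 1) - t i * step_op S i * t i = t i"
proof -
  define R where "R = S \<union> FV ` {1..i - 1}"
  have R: "finite R" "FV i \<notin> R" "R \<subseteq> all_factors d"
    using assms finite_subset[OF assms(2)] by (auto simp: R_def all_factors_def)
  have fix_R: "move_factor (transpose i (Suc i)) F = F" if "F \<in> R" for F
    using that assms by (cases F) (auto simp: R_def transpose_def)
  have ins: "S \<union> FV ` {1..i} = insert (FV i) R"
  proof -
    have "{1..i} = insert i {1..i - 1}" using assms(1) by auto
    then show ?thesis by (simp add: R_def)
  qed
  have "t i * om F (FV i) * t i = om F (FV (i + 1))" if "F \<in> R" for F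
  proof -
    have "t i * om F (FV i) = om F (FV (i + 1)) * t i"
      using t_om[OF assms(1), of F "FV i"] R(3) that assms(1) fix_R[OF that] by auto
    then show ?thesis using t_t[OF assms(1)] by (simp add: mult.assoc)
  qed
  then have "t i * step_op S i * t i = (\<Sum>F\<in>R. om F (FV (i + 1)))"
    using step_op_eq[OF assms(2), of i, folded R_def] assms(1)
    by (simp add: sum_distrib_left sum_distrib_right)
  moreover have "step_op S (i + 1) = (\<Sum>F\<in>insert (FV i) R. om F (FV (i + 1)))"
    using step_op_eq[OF assms(2), of "i + 1", unfolded add_diff_cancel_right' ins] assms(1) by simp
  ultimately show ?thesis
    using R t_casimir[OF assms(1)] by (simp add: om_def)
qed

section \<open>Transpositions of distant factors and the elements m_(i,j)\<close>

lemma conj_t_om: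
  assumes "i \<in> {1..<d}" "F \<in> all_factors d" "G \<in> all_factors d"
  shows "t i * om F G * t i = om (move_factor (transpose i (Suc i)) F) (move_factor (transpose i (Suc i)) G)"
  using t_om[OF assms] t_t[OF assms(1)] by (simp add: mult.assoc)

text \<open>Both sides conjugate one transposition by another, which moves its legs to the factors i
  and i + 2.\<close>

lemma braid:
  assumes "1 \<le> i" "i + 1 < d"
  shows "t i * t (i + 1) * t i = t (i + 1) * t i * t (i + 1)"
proof -
  have "t i * t (i + 1) * t i = om (FV i) (FV (i + 2))"
    using conj_t_om[of i "FV (i + 1)" "FV (i + 2)"] assms t_casimir[of "i + 1"] by (simp add: om_def)
  moreover have "t (i + 1) * t i * t (i + 1) = om (FV i) (FV (i + 2))"
    using conj_t_om[of "i + 1" "FV i" "FV (i + 1)"] assms t_casimir[of i] by (simp add: om_def)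
  ultimately show ?thesis by simp
qed

lemma t_commute:
  assumes "i \<in> {1..<d}" "j \<in> {1..<d}" "i + 1 < j"
  shows "t i * t j = t j * t i"
  using t_om[of i "FV j" "FV (j + 1)"] assms t_casimir[of j] by (simp add: om_def transpose_def)

text \<open>This is what (R4) becomes once x_(i+1) - t_i x_i t_i is replaced by t_i.\<close>

lemma braid_conj:
  assumes "1 \<le> i" "i + 1 < d"
  shows "t i * t (i + 1) * t i * t (i + 1) * t i = t (i + 1)"
proof -
  have "t i * t (i + 1) * t i * t (i + 1) * t i = t (i + 1) * t i * (t (i + 1) * t (i + 1)) * t i"
    unfolding braid[OF assms] by (simp add: mult.assoc)
  also have "\<dots> = t (i + 1) * (t i * t i)"
    using assms by (simp add: t_t mult.assoc)
  also have "\<dots> = t (i + 1)"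
    using assms by (simp add: t_t)
  finally show ?thesis .
qed

text \<open>The recursion of \<open>transp\<close> inside the corner; the value \<open>P\<close> at
  0 lets \<open>transp_op_P\<close> hold for all indices.\<close>

fun transp_op :: "nat \<Rightarrow> nat \<Rightarrow> 'r" where
  "transp_op i 0 = P"
| "transp_op i (Suc j) = (if j \<le> i then t i else t j * transp_op i j * t j)"

lemma transp_op_P [simp]: "P * transp_op i j = transp_op i j"
  by (cases j) (simp_all flip: mult.assoc)

text \<open>The induction rests on (i, j+1) = (j, j+1)(i, j)(j, j+1). The action on all pairs of
  legs is proved along with the square, since the inner conjugation meets legs already moved by
  t_j.\<close>

lemma transp_op:
  assumes "1 \<le> i" "i < j" "j \<le> d"
  shows "transp_op i j * transp_op i j = P \<and> (\<forall>F \<in> all_factors d. \<forall>G \<in> all_factors d.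
      transp_op i j * om F G
        = om (move_factor (transpose i j) F) (move_factor (transpose i j) G) * transp_op i j)"
  using assms(2,3)
proof (induction j)
  case (Suc j)
  show ?case
  proof (cases "j \<le> i")
    case True
    then have "j = i" using Suc.prems by simp
    then show ?thesis using Suc.prems assms(1) t_om by (simp add: t_t)
  next
    case False
    then have j: "j \<in> {1..<d}" using Suc.prems by auto
    define \<tau> where "\<tau> = transpose j (Suc j)"
    have IH: "transp_op i j * transp_op i j = P"
      "\<And>F G. F \<in> all_factors d \<Longrightarrow> G \<in> all_factors d \<Longrightarrow> transp_op i j * om F G
        = om (move_factor (transpose i j) F) (move_factor (transpose i j) G) * transp_op i j"
      using Suc False by auto
    have "transp_op i (Suc j) * transp_op i (Suc j) = t j * (transp_op i j * (t j * t j * transp_op i j)) * t j"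
      using False by (simp add: mult.assoc)
    then have sq: "transp_op i (Suc j) * transp_op i (Suc j) = P"
      using j by (simp add: t_t IH)
    have closed: "move_factor (transpose r l) F \<in> all_factors d"
      if "F \<in> all_factors d" "r \<in> {1..d}" "l \<in> {1..d}" for F r l
      using that by (cases F) (auto simp: transpose_def)
    have perm: "move_factor \<tau> (move_factor (transpose i j) (move_factor \<tau> F)) = move_factor (transpose i (Suc j)) F" for F
      using False Suc.prems by (cases F) (auto simp: \<tau>_def transpose_def)
    have "transp_op i (Suc j) * om F G
        = om (move_factor (transpose i (Suc j)) F) (move_factor (transpose i (Suc j)) G) * transp_op i (Suc j)"
      if FG: "F \<in> all_factors d" "G \<in> all_factors d" for F G
    proof -
      have in\<tau>: "move_factor \<tau> F \<in> all_factors d" "move_factor \<tau> G \<in> all_factors d"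
        using closed j FG by (auto simp: \<tau>_def)
      have "transp_op i (Suc j) * om F G = t j * transp_op i j * (t j * om F G)"
        using False by (simp add: mult.assoc)
      also have "\<dots> = t j * (transp_op i j * om (move_factor \<tau> F) (move_factor \<tau> G)) * t j"
        using t_om[OF j FG] by (simp add: \<tau>_def mult.assoc)
      also have "\<dots> = (t j * om (move_factor (transpose i j) (move_factor \<tau> F))
          (move_factor (transpose i j) (move_factor \<tau> G))) * transp_op i j * t j"
        using IH(2)[OF in\<tau>] by (simp add: mult.assoc)
      also have "\<dots> = om (move_factor (transpose i (Suc j)) F) (move_factor (transpose i (Suc j)) G) * transp_op i (Suc j)"
      proof -
        have "i \<in> {1..d}" "j \<in> {1..d}" using assms(1) Suc.prems j by auto
        from t_om[OF j closed[OF in\<tau>(1) this] closed[OF in\<tau>(2) this]]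
        show ?thesis
          using False unfolding \<tau>_def[symmetric] perm by (simp add: mult.assoc)
      qed
      finally show ?thesis .
    qed
    with sq show ?thesis by blast
  qed
qed simp

text \<open>The transposition (i, j-1) moves the first leg of t_(j-1) = \<Omega>_(j-1,j) to i. This
  is the value of m_(i,j).\<close>

lemma transp_op_conj:
  assumes "1 \<le> i" "i + 1 < j" "j \<le> d"
  shows "transp_op i (j - 1) * t (j - 1) * transp_op i (j - 1) = om (FV i) (FV j)"
proof -
  obtain r where j: "j = Suc r" using assms by (cases j) auto
  have r: "r \<in> {1..<d}" "i < r" using assms j by auto
  from transp_op[OF assms(1) r(2)] r
  have *: "transp_op i r * transp_op i r = P"
    "\<forall>F \<in> all_factors d. \<forall>G \<in> all_factors d. transp_op i r * om F G
        = om (move_factor (transpose i r) F) (move_factor (transpose i r) G) * transp_op i r"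
    by auto
  have "transp_op i r * t r = transp_op i r * om (FV r) (FV (Suc r))"
    using t_casimir[OF r(1)] by (simp add: om_def)
  also have "\<dots> = om (FV i) (FV (Suc r)) * transp_op i r"
    using *(2)[rule_format, of "FV r" "FV (Suc r)"] r by (simp add: transpose_def)
  finally have "transp_op i r * t r * transp_op i r = om (FV i) (FV (Suc r)) * transp_op i r * transp_op i r"
    by simp
  then show ?thesis using *(1) j by (simp add: mult.assoc)
qed

text \<open>In x_i + y_i the interaction with the earlier copies of V is counted twice, in z_i once;
  this is (R6).\<close>

lemma step_op_both:
  assumes "i \<in> {1..d}"
  shows "step_op {FM, FN} i = step_op {FM} i + step_op {FN} i - (\<Sum>k\<in>{1..<i}. om (FV k) (FV i))"
proof -
  have "{1..i - 1} = {1..<i}" using assms by auto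
  then have *: "(\<Sum>F\<in>FV ` {1..i - 1}. om F (FV i)) = (\<Sum>k\<in>{1..<i}. om (FV k) (FV i))"
    by (subst sum.reindex) (auto simp: inj_on_def)
  have "FM \<notin> FV ` {1..i - 1}" "FN \<notin> FV ` {1..i - 1}" by auto
  then show ?thesis
    using assms by (simp add: step_op_eq * add.commute del: One_nat_def)
qed

text \<open>Expanded in the matrix units of the first copy of V, the product has the entries of
  \<open>rect_tensor\<close> as coefficients.\<close>

lemma hecke_quadratic:
  assumes F: "F = FM \<or> F = FN" and d: "1 \<le> d"
    and Q: "\<And>k j. k < L \<Longrightarrow> j < L \<Longrightarrow> rect_tensor L \<pi> a p (e F) k j * P = 0"
  shows "(step_op {F} 1 - a *\<^sub>C P) * (step_op {F} 1 + p *\<^sub>C P) = 0"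
proof -
  let ?v = "e (FV 1)"
  have ev: "super_commuting L \<pi> (e F) ?v" by (rule comm) (use F d in auto)
  have step: "step_op {F} 1 = om F (FV 1)"
    using step_op_eq[of "{F}" 1] F d by auto
  have Qv: "(par_sign (\<pi> j)) *\<^sub>C (rect_tensor L \<pi> a p (e F) k j * ?v j k) = 0" if "k < L" "j < L" for k j
  proof -
    \<comment> \<open>The coefficients are known to vanish after multiplication by \<open>P\<close>,
      which the matrix unit to their right absorbs.\<close>
    have "rect_tensor L \<pi> a p (e F) k j * ?v j k = (rect_tensor L \<pi> a p (e F) k j * P) * ?v j k"
      by (simp add: mult.assoc)
    then show ?thesis using Q[OF that] by simp
  qed
  have square: "om F (FV 1) * om F (FV 1)
      = (\<Sum>k<L. \<Sum>j<L. par_sign (\<pi> j) *\<^sub>C (adjoint_square L \<pi> (e F) k j * ?v j k))"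
    unfolding om_def by (rule split_casimir_square[OF ev unit_mult]) (use d in auto)
  have linear: "om F (FV 1) = (\<Sum>k<L. \<Sum>j<L. par_sign (\<pi> j) *\<^sub>C (e F k j * ?v j k))"
    by (simp add: om_def split_casimir_def)
  \<comment> \<open>The unit of the corner is written as a double sum too, so that the three terms
    can be added coefficientwise.\<close>
  have const: "P = (\<Sum>k<L. \<Sum>j<L. if k = j then ?v j k else 0)"
    using unit_sum[of 1] d by simp
  have "(step_op {F} 1 - a *\<^sub>C P) * (step_op {F} 1 + p *\<^sub>C P)
      = om F (FV 1) * om F (FV 1) + (p - a) *\<^sub>C om F (FV 1) - (a * p) *\<^sub>C P"
    unfolding step by (simp add: algebra_simps complex_vector.scale_left_diff_distrib)
  also have "\<dots> = (\<Sum>k<L. \<Sum>j<L. (par_sign (\<pi> j)) *\<^sub>C (rect_tensor L \<pi> a p (e F) k j * ?v j k))"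
    unfolding square
    apply (subst linear, subst const)
    unfolding complex_vector.scale_sum_right sum.distrib[symmetric] sum_subtractf[symmetric]
    by (intro sum.cong refl)
      (simp add: rect_tensor_def distrib_right left_diff_distrib scaleC_ring_simps mult_ac)
  also have "\<dots> = 0" by (intro sum.neutral ballI Qv) auto
  finally show ?thesis .
qed

end

section \<open>Operators on the mixed tensor space\<close>

lemma poly_mapping_add_induct [case_names zero add]:
  assumes "Q 0" "\<And>f k c. k \<notin> Poly_Mapping.keys f \<Longrightarrow> c \<noteq> 0 \<Longrightarrow> Q f \<Longrightarrow> Q (Poly_Mapping.single k c + f)"
  shows "Q (f :: 'k \<Rightarrow>\<^sub>0 'c::comm_monoid_add)"
proof (induction f rule: update_induct)
  case const
  show ?case by (rule assms(1))
next
  case (update f k c)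
  have "Poly_Mapping.update k c f = Poly_Mapping.single k c + f"
    using update by (intro poly_mapping_eqI) (auto simp: lookup_update lookup_add lookup_single in_keys_iff when_def)
  then show ?case using assms(2)[OF update] by simp
qed

lemma clinear_0: "clinear f \<Longrightarrow> f 0 = 0"
  using clinear_iff[of f] complex_vector.scale_zero_left[of 0] by (metis complex_vector.scale_zero_left)

lemma clinear_tensor_eqI:
  fixes f g :: "('a::complex_vector, 'b::complex_vector) tensor \<Rightarrow> 'c::complex_vector"
  assumes "clinear f" "clinear g" and pure: "\<And>u v. f (u \<otimes>\<^sub>t v) = g (u \<otimes>\<^sub>t v)"
  shows "f = g"
proof
  fix s
  show "f s = g s"
  proof (induct s rule: tensor.abs_induct)
    fix q :: "'a \<times> 'b \<Rightarrow>\<^sub>0 complex"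
    show "f (abs_tensor q) = g (abs_tensor q)"
    proof (induction q rule: poly_mapping_add_induct)
      case zero
      then show ?case using assms(1,2) by (simp add: clinear_0 flip: zero_tensor.abs_eq)
    next
      case (add q k c)
      obtain u v where k: "k = (u, v)" by (cases k)
      have "abs_tensor (Poly_Mapping.single k c + q) = c *\<^sub>C (u \<otimes>\<^sub>t v) + abs_tensor q"
        by (simp add: k pure_tensor.abs_eq scaleC_tensor.abs_eq plus_tensor.abs_eq fscale_single)
      then show ?case using add assms by (simp add: clinear_iff)
    qed
  qed
qed

section \<open>Tensor products of endomorphisms and operators on words\<close>

lemma clinear_tensor_map: "clinear f \<Longrightarrow> clinear g \<Longrightarrow> clinear (tensor_map f g)"
  unfolding tensor_map_def by (intro clinear_tensor_lift cbilinear_compose)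

lemma clinear_app: "clinear (app f)"
  by (simp add: clinear_iff app_linear)

text \<open>No sign is built in; the sign of moving g past the left factor is supplied by a
  \<open>sign_op\<close> inside f.\<close>

definition tmap :: "'a::complex_vector endo \<Rightarrow> 'b::complex_vector endo \<Rightarrow> ('a, 'b) tensor endo" where
  "tmap f g = Endo (tensor_map (app f) (app g))"

lemma app_tmap: "app (tmap f g) = tensor_map (app f) (app g)"
  by (simp add: tmap_def app_Endo clinear_tensor_map clinear_app)

lemma app_tmap_pure [simp]: "app (tmap f g) (u \<otimes>\<^sub>t v) = app f u \<otimes>\<^sub>t app g v"
  by (simp add: app_tmap tensor_map_pure clinear_app)

lemma tensor_endo_eqI: "(\<And>u v. app f (u \<otimes>\<^sub>t v) = app g (u \<otimes>\<^sub>t v)) \<Longrightarrow> f = g"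
  using clinear_tensor_eqI[OF clinear_app clinear_app, of f g] by (simp add: app_inject)

lemma pure_linear:
  "(u + u') \<otimes>\<^sub>t v = u \<otimes>\<^sub>t v + u' \<otimes>\<^sub>t v" "u \<otimes>\<^sub>t (v + v') = u \<otimes>\<^sub>t v + u \<otimes>\<^sub>t v'"
  "(c *\<^sub>C u) \<otimes>\<^sub>t v = c *\<^sub>C (u \<otimes>\<^sub>t v)" "u \<otimes>\<^sub>t (c *\<^sub>C v) = c *\<^sub>C (u \<otimes>\<^sub>t v)"
  using cbilinear_pure unfolding cbilinear_def clinear_iff by blast+

lemma tmap_mult: "tmap f g * tmap f' g' = tmap (f * f') (g * g')"
  by (rule tensor_endo_eqI) simp

lemma tmap_1 [simp]: "tmap 1 1 = 1"
  by (rule tensor_endo_eqI) simp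

lemma tmap_add: "tmap (f + f') g = tmap f g + tmap f' g" "tmap f (g + g') = tmap f g + tmap f g'"
  by (rule tensor_endo_eqI; simp add: pure_linear)+

lemma tmap_scale: "tmap (c *\<^sub>C f) g = c *\<^sub>C tmap f g" "tmap f (c *\<^sub>C g) = c *\<^sub>C tmap f g"
  by (rule tensor_endo_eqI; simp add: pure_linear)+

text \<open>Linearity is what can be asked: \<open>pointwise D\<close> sends 1 to a projection, and
  tensoring with a fixed sign operator is not multiplicative in general.\<close>

definition alg_map :: "('r::complex_alg \<Rightarrow> 's::complex_alg) \<Rightarrow> bool" where
  "alg_map h \<longleftrightarrow> (\<forall>x y. h (x + y) = h x + h y) \<and> (\<forall>c x. h (c *\<^sub>C x) = c *\<^sub>C h x)"

lemma alg_mapD: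
  assumes "alg_map h"
  shows "h (x + y) = h x + h y" "h (c *\<^sub>C x) = c *\<^sub>C h x" "h 0 = 0" "h (x - y) = h x - h y"
    "h (\<Sum>i\<in>I. f i) = (\<Sum>i\<in>I. h (f i))"
proof -
  have a: "h (x + y) = h x + h y" for x y using assms by (simp add: alg_map_def)
  have s: "h (c *\<^sub>C x) = c *\<^sub>C h x" for c x using assms by (simp add: alg_map_def)
  show z: "h 0 = 0" using s[of 0 0] by simp
  show "h (x + y) = h x + h y" "h (c *\<^sub>C x) = c *\<^sub>C h x" using a s by auto
  show "h (x - y) = h x - h y" using a[of "x - y" y] by simp
  show "h (\<Sum>i\<in>I. f i) = (\<Sum>i\<in>I. h (f i))"
    by (induction I rule: infinite_finite_induct) (simp_all add: a z)
qed

text \<open>The cut-off at D puts the operator into the corner with unit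
  \<open>pointwise D 1\<close>.\<close>

definition pointwise :: "nat list set \<Rightarrow> 'v::complex_vector endo \<Rightarrow> (nat list \<Rightarrow> 'v) endo" where
  "pointwise D A = Endo (\<lambda>f w. if w \<in> D then app A (f w) else 0)"

lemma app_pointwise: "app (pointwise D A) f w = (if w \<in> D then app A (f w) else 0)"
proof -
  have "clinear (\<lambda>f w. if w \<in> D then app A (f w) else 0)"
    by (auto simp: clinear_iff fun_eq_iff scaleC_fun_def app_linear)
  then show ?thesis by (simp add: pointwise_def app_Endo)
qed

lemma pointwise_mult: "pointwise D A * pointwise D B = pointwise D (A * B)"
  by (rule endo_eqI) (simp add: fun_eq_iff app_pointwise)

lemma alg_map_pointwise: "alg_map (pointwise D)"
  unfolding alg_map_def by (intro conjI allI; rule endo_eqI; simp add: fun_eq_iff app_pointwise scaleC_fun_def)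

text \<open>The part of the action on the \<open>k\<close>-th copy of \<open>V\<close> that does not involve the first two factors.\<close>

definition letter_op :: "nat list set \<Rightarrow> nat \<Rightarrow> nat \<Rightarrow> nat \<Rightarrow> nat \<Rightarrow> (nat list \<Rightarrow> 'v::complex_vector) endo" where
  "letter_op D n k i j = Endo (\<lambda>f w.
     if w \<in> D \<and> w ! (k - 1) = i \<and> w[k - 1 := j] \<in> D
     then par_sign ((par n i + par n j) * word_par n (take (k - 1) w)) *\<^sub>C f (w[k - 1 := j]) else 0)"

lemma app_letter_op: "app (letter_op D n k i j) f w =
    (if w \<in> D \<and> w ! (k - 1) = i \<and> w[k - 1 := j] \<in> D
     then par_sign ((par n i + par n j) * word_par n (take (k - 1) w)) *\<^sub>C f (w[k - 1 := j]) else 0)"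
proof -
  have "clinear (\<lambda>f w. if w \<in> D \<and> w ! (k - 1) = i \<and> w[k - 1 := j] \<in> D
     then par_sign ((par n i + par n j) * word_par n (take (k - 1) w)) *\<^sub>C (f :: nat list \<Rightarrow> 'a) (w[k - 1 := j]) else 0)"
    by (auto simp: clinear_iff fun_eq_iff scaleC_fun_def scaleC_add_right mult.commute)
  then show ?thesis by (simp add: letter_op_def app_Endo)
qed

text \<open>Membership is also demanded of the exchanged word, so that the operator lies in the
  corner for every i, even where the indices leave the word.\<close>

definition swap_endo :: "nat list set \<Rightarrow> nat \<Rightarrow> nat \<Rightarrow> (nat list \<Rightarrow> 'v::complex_vector) endo" where
  "swap_endo D n i = Endo (\<lambda>f w.
     if w \<in> D \<and> w[i - 1 := w ! i, i := w ! (i - 1)] \<in> D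
     then par_sign (par n (w ! (i - 1)) * par n (w ! i)) *\<^sub>C f (w[i - 1 := w ! i, i := w ! (i - 1)]) else 0)"

lemma app_swap_endo: "app (swap_endo D n i) f w =
    (if w \<in> D \<and> w[i - 1 := w ! i, i := w ! (i - 1)] \<in> D
     then par_sign (par n (w ! (i - 1)) * par n (w ! i)) *\<^sub>C f (w[i - 1 := w ! i, i := w ! (i - 1)]) else 0)"
proof -
  have "clinear (\<lambda>f w. if w \<in> D \<and> w[i - 1 := w ! i, i := w ! (i - 1)] \<in> D
     then par_sign (par n (w ! (i - 1)) * par n (w ! i)) *\<^sub>C (f :: nat list \<Rightarrow> 'a) (w[i - 1 := w ! i, i := w ! (i - 1)]) else 0)"
    by (auto simp: clinear_iff fun_eq_iff scaleC_fun_def scaleC_add_right mult.commute)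
  then show ?thesis by (simp add: swap_endo_def app_Endo)
qed

lemma pointwise_letter_op: "pointwise D A * letter_op D n k i j = letter_op D n k i j * pointwise D A"
  by (rule endo_eqI) (simp add: fun_eq_iff app_pointwise app_letter_op app_linear)

lemma pointwise_swap_endo: "pointwise D A * swap_endo D n i = swap_endo D n i * pointwise D A"
  by (rule endo_eqI) (simp add: fun_eq_iff app_pointwise app_swap_endo app_linear)

lemma pointwise_1_letter_op [simp]: "pointwise D 1 * letter_op D n k i j = letter_op D n k i j"
  by (rule endo_eqI) (simp add: fun_eq_iff app_pointwise app_letter_op)

lemma pointwise_1_swap_endo [simp]: "pointwise D 1 * swap_endo D n i = swap_endo D n i"
  by (rule endo_eqI) (simp add: fun_eq_iff app_pointwise app_swap_endo)

lemma words_update: "w \<in> words n m d \<Longrightarrow> j < n + m \<Longrightarrow> w[k := j] \<in> words n m d"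
  using set_update_subset_insert[of w k j] by (auto simp: words_def)

lemma words_swap: "w \<in> words n m d \<Longrightarrow> i \<in> {1..<d} \<Longrightarrow> w[i - 1 := w ! i, i := w ! (i - 1)] \<in> words n m d"
  by (intro words_update) (auto simp: words_def subset_iff)

lemma words_nth: "w \<in> words n m d \<Longrightarrow> k < d \<Longrightarrow> w ! k < n + m"
  by (auto simp: words_def subset_iff)

lemma letter_op_mult:
  assumes "k \<in> {1..d}" "i < n + m" "j < n + m" "l < n + m"
  shows "letter_op (words n m d) n k i j * letter_op (words n m d) n k r l
    = (if j = r then letter_op (words n m d) n k i l else 0)"
proof (rule endo_eqI, rule ext)
  fix f :: "nat list \<Rightarrow> 'a" and w
  have c: "par_sign ((a + b) * x) * par_sign ((b + c) * x) = par_sign ((a + c) * x)" for a b c x :: bit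
    by (cases a; cases b; cases c; cases x; simp)
  show "app (letter_op (words n m d) n k i j * letter_op (words n m d) n k r l) f w
      = app (if j = r then letter_op (words n m d) n k i l else 0) f w"
  proof (cases "w \<in> words n m d \<and> w ! (k - 1) = i")
    case True
    then have "k - 1 < length w" using assms(1) by (auto simp: words_def)
    then show ?thesis
      using True assms by (auto simp: app_letter_op words_update c)
  qed (auto simp: app_letter_op)
qed

lemma word_par_update:
  "k < length w \<Longrightarrow> word_par n (w[k := j]) = word_par n w + par n (w ! k) + par n j"
proof (induction w arbitrary: k)
  case (Cons a w)
  have *: "x + y = x + z + z + y" for x y z :: bit
    by (cases x; cases y; cases z; simp)
  show ?case
    using Cons by (cases k) (auto simp: word_par_def add_ac *)
qed simp

text \<open>The operator at the later position k' reads the parity of a prefix containing letter k.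
  Changing that letter from i to j shifts this parity by the parity of E_ij, which produces the
  super sign.\<close>

lemma letter_op_commute:
  assumes "k \<in> {1..d}" "k' \<in> {1..d}" "k < k'" "i < n + m" "j < n + m" "r < n + m" "l < n + m"
  shows "letter_op (words n m d) n k i j * letter_op (words n m d) n k' r l
    = par_sign ((par n i + par n j) * (par n r + par n l)) *\<^sub>C
      (letter_op (words n m d) n k' r l * letter_op (words n m d) n k i j :: (nat list \<Rightarrow> 'v::complex_vector) endo)"
proof (rule endo_eqI, rule ext)
  fix f :: "nat list \<Rightarrow> 'v" and w
  have c: "par_sign (a * x) * par_sign (b * (y + par n i + par n j))
      = par_sign (a * b) * (par_sign (b * y) * par_sign (a * x))" if "a = par n i + par n j" for a b x y
    using that by (cases "par n i"; cases "par n j"; cases b; cases x; cases y; simp)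
  show "app (letter_op (words n m d) n k i j * letter_op (words n m d) n k' r l) f w
    = app (par_sign ((par n i + par n j) * (par n r + par n l)) *\<^sub>C
      (letter_op (words n m d) n k' r l * letter_op (words n m d) n k i j)) f w"
  proof (cases "w \<in> words n m d \<and> w ! (k - 1) = i \<and> w ! (k' - 1) = r")
    case True
    then have w: "w \<in> words n m d" "length w = d" by (auto simp: words_def)
    have 1: "w[k - 1 := j] ! (k' - 1) = r" "w[k' - 1 := l] ! (k - 1) = i"
      using True assms by auto
    have 2: "word_par n (take (k' - 1) (w[k - 1 := j])) = word_par n (take (k' - 1) w) + par n i + par n j"
      using True assms w by (simp add: take_update_swap word_par_update)
    have 3: "take (k - 1) (w[k' - 1 := l]) = take (k - 1) w"
      using assms by (simp add: take_update_cancel)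
    have 4: "w[k - 1 := j, k' - 1 := l] = w[k' - 1 := l, k - 1 := j]"
      using assms by (intro list_update_swap) auto
    show ?thesis
      using True w assms by (simp add: app_letter_op scaleC_fun_def words_update 1 2 3 4 c del: One_nat_def)
  next
    case False
    then show ?thesis
      using assms by (auto simp: app_letter_op scaleC_fun_def)
  qed
qed

lemma gl_rep_units:
  assumes "\<And>i j k l. i < L \<Longrightarrow> j < L \<Longrightarrow> k < L \<Longrightarrow> l < L \<Longrightarrow> v i j * v k l = (if j = k then v i l else 0)"
  shows "gl_rep L \<pi> v"
  unfolding gl_rep_def using assms by auto

text \<open>For a copy of V, the sign of passing M and N is the pointwise part; the sign of passing
  earlier copies sits in \<open>letter_op\<close>.\<close>

fun factor_op :: "nat \<Rightarrow> nat \<Rightarrow> nat \<Rightarrow> 'a::complex_vector supermod \<Rightarrow> 'b::complex_vector supermod \<Rightarrow> factor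
    \<Rightarrow> nat \<Rightarrow> nat \<Rightarrow> (nat list \<Rightarrow> ('a, 'b) tensor) endo" where
  "factor_op n m d M N FM i j = pointwise (words n m d) (tmap (unit_op n m M i j) 1)"
| "factor_op n m d M N FN i j =
     pointwise (words n m d) (tmap (sign_op M (par n i + par n j)) (unit_op n m N i j))"
| "factor_op n m d M N (FV k) i j =
     pointwise (words n m d) (tmap (sign_op M (par n i + par n j)) (sign_op N (par n i + par n j)))
       * letter_op (words n m d) n k i j"

lemma sum_fun_apply: "(\<Sum>i\<in>I. g i) w = (\<Sum>i\<in>I. g i w)"
  by (induction I rule: infinite_finite_induct) simp_all

definition total_sign :: "nat \<Rightarrow> nat \<Rightarrow> nat \<Rightarrow> (nat list \<Rightarrow> 'v::complex_vector) endo" where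
  "total_sign n m d = Endo (\<lambda>f w. if w \<in> words n m d then par_sign (word_par n w) *\<^sub>C f w else 0)"

lemma app_total_sign:
  "app (total_sign n m d) f w = (if w \<in> words n m d then par_sign (word_par n w) *\<^sub>C f w else 0)"
proof -
  have "clinear (\<lambda>f w. if w \<in> words n m d then par_sign (word_par n w) *\<^sub>C (f :: nat list \<Rightarrow> 'a) w else 0)"
    by (auto simp: clinear_iff fun_eq_iff scaleC_fun_def scaleC_add_right mult.commute)
  then show ?thesis by (simp add: total_sign_def app_Endo)
qed

section \<open>The action of gl(n|m) on the individual tensor factors\<close>

locale two_modules =
  fixes n m d :: nat and M :: "'a::complex_vector supermod" and N :: "'b::complex_vector supermod"
  assumes M: "gl_supermodule n m M" and N: "gl_supermodule n m N"
begin

abbreviation "D \<equiv> words n m d"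
abbreviation "pw \<equiv> pointwise D :: ('a, 'b) tensor endo \<Rightarrow> _"
abbreviation "unit \<equiv> pw 1"
abbreviation "eop \<equiv> factor_op n m d M N"
abbreviation "letop k i j \<equiv> letter_op D n k i j :: (nat list \<Rightarrow> ('a, 'b) tensor) endo"
abbreviation "swop i \<equiv> swap_endo D n i :: (nat list \<Rightarrow> ('a, 'b) tensor) endo"
abbreviation "signs s \<equiv> tmap (sign_op M s) (sign_op N s)"

lemmas pw_linear = alg_mapD[OF alg_map_pointwise[of D]]

lemma pw_scale_left: "pw (tmap (c *\<^sub>C f) g) = c *\<^sub>C pw (tmap f g)"
  by (simp add: tmap_scale pw_linear)

lemma pw_mult: "pw x * pw y = pw (x * y)"
  by (rule pointwise_mult)

lemma unit_eop: "unit * eop F i j = eop F i j" "eop F i j * unit = eop F i j"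
proof -
  show "unit * eop F i j = eop F i j"
    by (cases F) (simp_all add: pw_mult flip: mult.assoc)
  show "eop F i j * unit = eop F i j"
    by (cases F) (simp_all add: pw_mult mult.assoc pointwise_letter_op[symmetric])
qed

lemma unit_swop: "unit * swop i = swop i" "swop i * unit = swop i"
  by (simp_all flip: pointwise_swap_endo)

lemma signs_mult: "signs s * signs r = signs (s + r)"
  by (simp add: tmap_mult sign_op_mult[OF M] sign_op_mult[OF N])

lemma signs_0: "signs 0 = 1"
  by (simp add: sign_op_0[OF M] sign_op_0[OF N])

lemma rep_M: "gl_rep (n + m) (par n) (eop FM)"
  unfolding gl_rep_def
proof (intro allI impI)
  fix i j k l assume l: "i < n + m" "j < n + m" "k < n + m" "l < n + m"
  define s where "s = par_sign ((par n i + par n j) * (par n k + par n l))"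
  let ?e = "unit_op n m M"
  have h: "pw (tmap (x - c *\<^sub>C y) 1) = pw (tmap x 1) - c *\<^sub>C pw (tmap y 1)" for x y c
  proof -
    have "tmap (x - c *\<^sub>C y) (1 :: 'b endo) = tmap x 1 - c *\<^sub>C tmap y 1"
      using tmap_add(1)[of "x - c *\<^sub>C y" "c *\<^sub>C y" "1 :: 'b endo"] by (simp add: tmap_scale)
    then show ?thesis by (simp add: pw_linear)
  qed
  have z: "pw (tmap 0 1) = 0"
    using h[of 0 1 0] by simp
  have "?e i j * ?e k l - s *\<^sub>C (?e k l * ?e i j) = (if j = k then ?e i l else 0) - s *\<^sub>C (if i = l then ?e k j else 0)"
    using gl_rep_unit_op[OF M] l unfolding gl_rep_def s_def by blast
  then have "pw (tmap (?e i j * ?e k l - s *\<^sub>C (?e k l * ?e i j)) 1)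
    = pw (tmap ((if j = k then ?e i l else 0) - s *\<^sub>C (if i = l then ?e k j else 0)) 1)"
    by simp
  then show "eop FM i j * eop FM k l - s *\<^sub>C (eop FM k l * eop FM i j)
      = (if j = k then eop FM i l else 0) - s *\<^sub>C (if i = l then eop FM k j else 0)"
    unfolding h by (simp add: pw_mult tmap_mult if_distrib[of pw] if_distrib[of "\<lambda>x. tmap x 1"] z cong: if_cong)
qed

lemma eop_N_mult:
  "eop FN i j * eop FN k l = pw (tmap (sign_op M (par n i + par n j + (par n k + par n l))) (unit_op n m N i j * unit_op n m N k l))"
  by (simp add: pw_mult tmap_mult sign_op_mult[OF M])

text \<open>Each operator on N carries a sign operator on M that depends on its parity. All terms of
  the relation have the same total parity r, so this sign operator is common to them.\<close>

lemma rep_N: "gl_rep (n + m) (par n) (eop FN)"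
  unfolding gl_rep_def
proof (intro allI impI)
  fix i j k l assume l: "i < n + m" "j < n + m" "k < n + m" "l < n + m"
  define s where "s = par_sign ((par n i + par n j) * (par n k + par n l))"
  define r where "r = par n i + par n j + (par n k + par n l)"
  let ?e = "unit_op n m N" let ?g = "sign_op M r"
  have h: "pw (tmap ?g (x - c *\<^sub>C y)) = pw (tmap ?g x) - c *\<^sub>C pw (tmap ?g y)" for x y c
  proof -
    have "tmap ?g (x - c *\<^sub>C y) = tmap ?g x - c *\<^sub>C tmap ?g y"
      using tmap_add(2)[of ?g "x - c *\<^sub>C y" "c *\<^sub>C y"] by (simp add: tmap_scale)
    then show ?thesis by (simp add: pw_linear)
  qed
  have z: "pw (tmap ?g 0) = 0"
    using h[of 0 1 0] by simp
  have r': "par n k + par n l + (par n i + par n j) = r"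
    by (simp add: r_def add.commute)
  have r1: "j = k \<Longrightarrow> par n i + par n l = r" "i = l \<Longrightarrow> par n k + par n j = r"
    unfolding r_def by (cases "par n i"; cases "par n j"; cases "par n k"; cases "par n l"; simp)+
  have e1: "eop FN i l = pw (tmap ?g (?e i l))" if "j = k"
    by (simp only: factor_op.simps r1(1)[OF that])
  have e2: "eop FN k j = pw (tmap ?g (?e k j))" if "i = l"
    by (simp only: factor_op.simps r1(2)[OF that])
  have "?e i j * ?e k l - s *\<^sub>C (?e k l * ?e i j) = (if j = k then ?e i l else 0) - s *\<^sub>C (if i = l then ?e k j else 0)"
    using gl_rep_unit_op[OF N] l unfolding gl_rep_def s_def by blast
  then have "pw (tmap ?g (?e i j * ?e k l - s *\<^sub>C (?e k l * ?e i j)))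
    = pw (tmap ?g ((if j = k then ?e i l else 0) - s *\<^sub>C (if i = l then ?e k j else 0)))"
    by simp
  moreover have "(if j = k then eop FN i l else 0) = pw (tmap ?g (if j = k then ?e i l else 0))"
    using e1 z by (auto simp del: factor_op.simps)
  moreover have "(if i = l then eop FN k j else 0) = pw (tmap ?g (if i = l then ?e k j else 0))"
    using e2 z by (auto simp del: factor_op.simps)
  ultimately show "eop FN i j * eop FN k l - s *\<^sub>C (eop FN k l * eop FN i j)
      = (if j = k then eop FN i l else 0) - s *\<^sub>C (if i = l then eop FN k j else 0)"
    unfolding h eop_N_mult r' r_def[symmetric] by (simp only:)
qed

lemma eop_V_mult:
  assumes "k \<in> {1..d}" "i < n + m" "j < n + m" "r < n + m" "l < n + m"
  shows "eop (FV k) i j * eop (FV k) r l = (if j = r then eop (FV k) i l else 0)"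
proof -
  have c: "j = r \<Longrightarrow> par n i + par n j + (par n r + par n l) = par n i + par n l"
    by (cases "par n i"; cases "par n j"; cases "par n l"; simp)
  have "eop (FV k) i j * eop (FV k) r l
      = pw (signs (par n i + par n j)) * (letop k i j * pw (signs (par n r + par n l))) * letop k r l"
    by (simp add: mult.assoc)
  also have "\<dots> = pw (signs (par n i + par n j + (par n r + par n l))) * (letop k i j * letop k r l)"
    by (simp add: pw_mult signs_mult mult.assoc flip: pointwise_letter_op mult.assoc[of "pw _" "pw _"])
  finally show ?thesis
    using assms c by (simp add: letter_op_mult)
qed

lemma eop_V_sum:
  assumes "k \<in> {1..d}"
  shows "(\<Sum>i<n + m. eop (FV k) i i) = unit"
proof (rule endo_eqI, rule ext)
  fix f :: "nat list \<Rightarrow> ('a, 'b) tensor" and w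
  have "app (eop (FV k) i i) f w = (if i = w ! (k - 1) then app unit f w else 0)" for i
    by (auto simp: signs_0 app_pointwise app_letter_op)
  then show "app (\<Sum>i<n + m. eop (FV k) i i) f w = app unit f w"
    using assms by (auto simp: app_sum_left sum_fun_apply app_pointwise words_nth)
qed

text \<open>The super sign arises when the sign operator that the action on N brings along passes
  the matrix unit on M; the pairs M, V and N, V work alike.\<close>

lemma comm_M_N: "super_commuting (n + m) (par n) (eop FM) (eop FN)"
  unfolding super_commuting_def
proof (intro allI impI)
  fix i j k l
  show "eop FM i j * eop FN k l = par_sign ((par n i + par n j) * (par n k + par n l)) *\<^sub>C (eop FN k l * eop FM i j)"
    by (simp add: pw_mult tmap_mult sign_op_unit_op[OF M] pw_scale_left mult.commute[of "par n k + par n l"])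
qed

lemma comm_M_V: "super_commuting (n + m) (par n) (eop FM) (eop (FV r))"
  unfolding super_commuting_def
proof (intro allI impI)
  fix i j k l
  have "eop (FV r) k l * eop FM i j
      = pw (signs (par n k + par n l)) * (letop r k l * pw (tmap (unit_op n m M i j) 1))"
    by (simp add: mult.assoc)
  also have "\<dots> = pw (signs (par n k + par n l) * tmap (unit_op n m M i j) 1) * letop r k l"
    by (simp flip: pointwise_letter_op add: pw_mult mult.assoc[symmetric])
  finally show "eop FM i j * eop (FV r) k l
      = par_sign ((par n i + par n j) * (par n k + par n l)) *\<^sub>C (eop (FV r) k l * eop FM i j)"
    by (simp add: pw_mult tmap_mult sign_op_unit_op[OF M] pw_scale_left mult.commute[of "par n k + par n l"]
        flip: mult.assoc)
qed

lemma comm_N_V: "super_commuting (n + m) (par n) (eop FN) (eop (FV r))"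
  unfolding super_commuting_def
proof (intro allI impI)
  fix i j k l
  define s where "s = par_sign ((par n i + par n j) * (par n k + par n l))"
  define u where "u = sign_op M (par n i + par n j + (par n k + par n l))"
  have g: "sign_op N (par n k + par n l) * unit_op n m N i j
      = s *\<^sub>C (unit_op n m N i j * sign_op N (par n k + par n l))"
    unfolding s_def sign_op_unit_op[OF N] by (simp add: mult.commute)
  have "eop (FV r) k l * eop FN i j
      = pw (signs (par n k + par n l)) * (letop r k l * pw (tmap (sign_op M (par n i + par n j)) (unit_op n m N i j)))"
    by (simp add: mult.assoc)
  also have "\<dots> = pw (signs (par n k + par n l) * tmap (sign_op M (par n i + par n j)) (unit_op n m N i j)) * letop r k l"
    by (simp flip: pointwise_letter_op add: pw_mult mult.assoc[symmetric])
  also have "signs (par n k + par n l) * tmap (sign_op M (par n i + par n j)) (unit_op n m N i j)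
      = s *\<^sub>C tmap u (unit_op n m N i j * sign_op N (par n k + par n l))"
    by (simp add: tmap_mult sign_op_mult[OF M] g tmap_scale u_def add.commute)
  finally have 1: "eop (FV r) k l * eop FN i j
      = s *\<^sub>C (pw (tmap u (unit_op n m N i j * sign_op N (par n k + par n l))) * letop r k l)"
    by (simp add: pw_linear)
  have "eop FN i j * eop (FV r) k l
      = pw (tmap u (unit_op n m N i j * sign_op N (par n k + par n l))) * letop r k l"
    by (simp add: pw_mult tmap_mult sign_op_mult[OF M] u_def flip: mult.assoc)
  then show "eop FN i j * eop (FV r) k l = s *\<^sub>C (eop (FV r) k l * eop FN i j)"
    unfolding 1 by (simp add: s_def)
qed

lemma comm_V_V:
  assumes "r \<in> {1..d}" "r' \<in> {1..d}" "r < r'"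
  shows "super_commuting (n + m) (par n) (eop (FV r)) (eop (FV r'))"
  unfolding super_commuting_def
proof (intro allI impI)
  fix i j k l assume l: "i < n + m" "j < n + m" "k < n + m" "l < n + m"
  have *: "pw (signs x) * letop q i j * (pw (signs y) * letop q' k l) = pw (signs (x + y)) * (letop q i j * letop q' k l)"
    for x y q q' i j k l
  proof -
    have "pw (signs x) * letop q i j * (pw (signs y) * letop q' k l)
        = pw (signs x) * (letop q i j * pw (signs y)) * letop q' k l"
      by (simp add: mult.assoc)
    also have "\<dots> = pw (signs x) * pw (signs y) * (letop q i j * letop q' k l)"
      unfolding pointwise_letter_op[symmetric] by (simp add: mult.assoc)
    finally show ?thesis by (simp only: pw_mult signs_mult)
  qed
  show "eop (FV r) i j * eop (FV r') k l
      = par_sign ((par n i + par n j) * (par n k + par n l)) *\<^sub>C (eop (FV r') k l * eop (FV r) i j)"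
    unfolding factor_op.simps * letter_op_commute[OF assms l]
    by (simp add: add.commute)
qed

lemma eop_comm:
  assumes "F \<in> all_factors d" "G \<in> all_factors d" "F \<noteq> G"
  shows "super_commuting (n + m) (par n) (eop F) (eop G)"
proof -
  have V: "super_commuting (n + m) (par n) (eop (FV r)) (eop (FV r'))"
    if "r \<in> {1..d}" "r' \<in> {1..d}" "r \<noteq> r'" for r r'
    using comm_V_V[of r r'] comm_V_V[of r' r] that by (metis linorder_neqE_nat super_commuting_sym)
  show ?thesis
    using assms comm_M_N comm_M_V comm_N_V V unfolding all_factors_def
    by (cases F; cases G) (auto intro: super_commuting_sym)
qed

lemma eop_rep: "F \<in> all_factors d \<Longrightarrow> gl_rep (n + m) (par n) (eop F)"
proof -
  have "gl_rep (n + m) (par n) (eop (FV k))" if "k \<in> {1..d}" for k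
    by (rule gl_rep_units) (rule eop_V_mult[OF that])
  then show "F \<in> all_factors d \<Longrightarrow> gl_rep (n + m) (par n) (eop F)"
    using rep_M rep_N by (auto simp: all_factors_def)
qed

end

section \<open>The signed exchange of neighbouring copies of V\<close>

lemma word_par_append: "word_par n (u @ w) = word_par n u + word_par n w"
  by (simp add: word_par_def)

lemma word_par_simps: "word_par n [] = 0" "word_par n (x # w) = par n x + word_par n w"
  by (simp_all add: word_par_def)

text \<open>Writing the word as p @ x # y # q replaces index arithmetic by list algebra; copy i is
  the letter x at index i - 1.\<close>

lemma split_at_swap:
  assumes "w \<in> words n m d" "i \<in> {1..<d}"
  obtains p x y q where "w = p @ x # y # q" "length p = i - 1" "x < n + m" "y < n + m"
proof
  have w: "length w = d" using assms(1) by (simp add: words_def)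
  show "w = take (i - 1) w @ w ! (i - 1) # w ! i # drop (i + 1) w"
  proof -
    have "drop (i - 1) w = w ! (i - 1) # w ! i # drop (i + 1) w"
    proof -
      have i: "i < length w" "i - 1 < length w" "Suc (i - 1) = i" using assms(2) w by auto
      show ?thesis
        using Cons_nth_drop_Suc[OF i(1)] Cons_nth_drop_Suc[OF i(2)] unfolding i(3) by simp
    qed
    then show ?thesis by (metis append_take_drop_id)
  qed
  show "length (take (i - 1) w) = i - 1" using assms(2) w by (auto simp: min_def)
  show "w ! (i - 1) < n + m" "w ! i < n + m"
    using assms by (auto intro: words_nth)
qed

lemma swap_split:
  "length p = i - 1 \<Longrightarrow> 1 \<le> i \<Longrightarrow>
    (p @ x # y # q)[i - 1 := (p @ x # y # q) ! i, i := (p @ x # y # q) ! (i - 1)] = p @ y # x # q"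
  "length p = i - 1 \<Longrightarrow> 1 \<le> i \<Longrightarrow> (p @ x # y # q) ! (i - 1) = x"
  "length p = i - 1 \<Longrightarrow> 1 \<le> i \<Longrightarrow> (p @ x # y # q) ! i = y"
  "length p = i - 1 \<Longrightarrow> 1 \<le> i \<Longrightarrow> (p @ x # y # q)[i - 1 := z] = p @ z # y # q"
  "length p = i - 1 \<Longrightarrow> 1 \<le> i \<Longrightarrow> (p @ x # y # q)[i := z] = p @ x # z # q"
  "length p = i - 1 \<Longrightarrow> 1 \<le> i \<Longrightarrow> take (i - 1) (p @ x # y # q) = p"
  "length p = i - 1 \<Longrightarrow> 1 \<le> i \<Longrightarrow> take i (p @ x # y # q) = p @ [x]"
proof -
  assume "length p = i - 1" "1 \<le> i"
  then have i: "i = Suc (length p)" by simp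
  show "(p @ x # y # q)[i - 1 := (p @ x # y # q) ! i, i := (p @ x # y # q) ! (i - 1)] = p @ y # x # q"
    "(p @ x # y # q) ! (i - 1) = x" "(p @ x # y # q) ! i = y"
    "(p @ x # y # q)[i - 1 := z] = p @ z # y # q" "(p @ x # y # q)[i := z] = p @ x # z # q"
    "take (i - 1) (p @ x # y # q) = p" "take i (p @ x # y # q) = p @ [x]"
    unfolding i by (simp_all add: nth_append list_update_append)
qed

lemma app_swap_split:
  assumes "p @ x # y # q \<in> words n m d" "length p = i - 1" "1 \<le> i"
  shows "app (swap_endo (words n m d) n i) f (p @ x # y # q) = par_sign (par n x * par n y) *\<^sub>C f (p @ y # x # q)"
proof -
  have "p @ y # x # q \<in> words n m d" using assms(1) by (auto simp: words_def)
  then show ?thesis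
    using assms unfolding app_swap_endo swap_split[OF assms(2,3)] by simp
qed

lemma swap_endo_square:
  assumes "i \<in> {1..<d}"
  shows "swap_endo (words n m d) n i * swap_endo (words n m d) n i = pointwise (words n m d) 1"
proof (rule endo_eqI, rule ext)
  fix f :: "nat list \<Rightarrow> 'a" and w
  show "app (swap_endo (words n m d) n i * swap_endo (words n m d) n i) f w = app (pointwise (words n m d) 1) f w"
  proof (cases "w \<in> words n m d")
    case True
    then obtain p x y q where w: "w = p @ x # y # q" "length p = i - 1"
      using split_at_swap[OF True assms] by metis
    have "p @ y # x # q \<in> words n m d" using True w by (auto simp: words_def)
    then show ?thesis
      using True w assms by (simp add: app_swap_split app_pointwise mult.commute)
  qed (simp add: app_swap_endo app_pointwise)
qed

text \<open>If k is one of the two exchanged positions, the prefix gains or loses one letter, and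
  the two exchange signs compensate for it. A later position sees a prefix whose parity is symmetric
  in the two letters.\<close>

lemma swap_endo_letter_op:
  assumes i: "i \<in> {1..<d}" and k: "k \<in> {1..d}" and l: "l < n + m"
  shows "swap_endo (words n m d) n i * letter_op (words n m d) n k r l
    = letter_op (words n m d) n (transpose i (Suc i) k) r l
      * (swap_endo (words n m d) n i :: (nat list \<Rightarrow> 'v::complex_vector) endo)"
proof (rule endo_eqI, rule ext)
  fix f :: "nat list \<Rightarrow> 'v" and w
  let ?D = "words n m d"
  show "app (swap_endo ?D n i * letter_op ?D n k r l) f w
    = app (letter_op ?D n (transpose i (Suc i) k) r l * swap_endo ?D n i) f w"
  proof (cases "w \<in> ?D")
    case True
    then obtain p x y q where w: "w = p @ x # y # q" "length p = i - 1" "x < n + m" "y < n + m"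
      using split_at_swap[OF True i] by metis
    have i1: "1 \<le> i" using i by simp
    note sw = swap_split[OF w(2) i1]
    have D: "p @ a # b # q \<in> ?D" if "a < n + m" "b < n + m" for a b
      using True w that by (auto simp: words_def)
    consider "k = i" | "k = Suc i" | "k < i" | "Suc i < k" by linarith
    then show ?thesis
    proof cases
      case 1
      have c: "par_sign (a * b) * par_sign ((b + e) * s) = par_sign ((b + e) * (s + a)) * par_sign (a * e)"
        for a b e s :: bit by (cases a; cases b; cases e; cases s; simp)
      show ?thesis
        using w D l i1 unfolding 1 w(1)
        by (simp add: app_swap_split app_letter_op sw word_par_append word_par_simps c del: One_nat_def take_append)
    next
      case 2
      have c: "par_sign (a * b) * par_sign ((a + e) * (s + b)) = par_sign ((a + e) * s) * par_sign (e * b)"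
        for a b e s :: bit by (cases a; cases b; cases e; cases s; simp)
      show ?thesis
        using w D l i1 unfolding 2 w(1)
        by (simp add: app_swap_split app_letter_op sw word_par_append word_par_simps c del: One_nat_def take_append)
    next
      case 3
      then have p: "k - 1 < length p" "transpose i (Suc i) k = k" using w(2) k by (auto simp: transpose_def)
      have u: "(p @ a # b # q)[k - 1 := l] = p[k - 1 := l] @ a # b # q"
        "(p @ a # b # q) ! (k - 1) = p ! (k - 1)" "take (k - 1) (p @ a # b # q) = take (k - 1) p" for a b
        using p by (simp_all add: list_update_append nth_append del: One_nat_def)
      have D': "p[k - 1 := l] @ a # b # q \<in> ?D" if "a < n + m" "b < n + m" for a b
        using words_update[OF D[OF that] l, of "k - 1"] unfolding u .
      show ?thesis
        using w D D' l i1 unfolding p(2) w(1)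
        by (simp add: app_swap_split app_letter_op u mult.commute del: One_nat_def take_append)
    next
      case 4
      define h where "h = k - 1 - length p - 2"
      have k': "k - 1 = length p + Suc (Suc h)" "transpose i (Suc i) k = k"
        using w(2) 4 i1 by (auto simp: transpose_def h_def)
      have u: "(p @ a # b # q)[k - 1 := l] = p @ a # b # q[h := l]"
        "(p @ a # b # q) ! (k - 1) = q ! h" "take (k - 1) (p @ a # b # q) = p @ a # b # take h q" for a b
        unfolding k'(1) by (simp_all add: list_update_append nth_append)
      have D': "p @ a # b # q[h := l] \<in> ?D" if "a < n + m" "b < n + m" for a b
        using words_update[OF D[OF that] l, of "k - 1"] unfolding u .
      show ?thesis
        using w D D' l i1 unfolding k'(2) w(1)
        by (simp add: app_swap_split app_letter_op u word_par_append word_par_simps mult.commute add_ac del: One_nat_def take_append)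
    qed
  qed (simp add: app_swap_endo app_letter_op)
qed

text \<open>At a word with letters x, y in the two positions only r = x and l = y contribute. The
  Casimir weight and the two prefix signs multiply to (-1)^(x y) in terms of parities: the second
  prefix has already had x replaced by y.\<close>

lemma swap_endo_casimir:
  assumes i: "i \<in> {1..<d}"
  shows "swap_endo (words n m d) n i = (\<Sum>r<n + m. \<Sum>l<n + m. par_sign (par n l) *\<^sub>C
    (letter_op (words n m d) n i r l * letter_op (words n m d) n (Suc i) l r) :: (nat list \<Rightarrow> 'v::complex_vector) endo)"
proof (rule endo_eqI, rule ext)
  fix f :: "nat list \<Rightarrow> 'v" and w
  let ?D = "words n m d"
  have "app (swap_endo ?D n i) f w = (\<Sum>r<n + m. \<Sum>l<n + m. par_sign (par n l) *\<^sub>C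
      app (letter_op ?D n i r l) (app (letter_op ?D n (Suc i) l r) f) w)"
  proof (cases "w \<in> ?D")
    case True
    then obtain p x y q where w: "w = p @ x # y # q" "length p = i - 1" "x < n + m" "y < n + m"
      using split_at_swap[OF True i] by metis
    have i1: "1 \<le> i" using i by simp
    note sw = swap_split[OF w(2) i1]
    have D: "p @ a # b # q \<in> ?D" if "a < n + m" "b < n + m" for a b
      using True w that by (auto simp: words_def)
    have c: "par_sign b * par_sign ((a + b) * s) * par_sign ((b + a) * (s + b)) = par_sign (a * b)"
      for a b s :: bit by (cases a; cases b; cases s; simp)
    have t: "par_sign (par n l) *\<^sub>C app (letter_op ?D n i r l) (app (letter_op ?D n (Suc i) l r) f) w
        = (if r = x then if l = y then par_sign (par n x * par n y) *\<^sub>C f (p @ y # x # q) else 0 else 0)"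
      if "r < n + m" "l < n + m" for r l
      using w D that unfolding w(1)
      by (simp add: app_letter_op sw word_par_append word_par_simps c del: One_nat_def take_append)
    have "(\<Sum>r<n + m. \<Sum>l<n + m. par_sign (par n l) *\<^sub>C app (letter_op ?D n i r l) (app (letter_op ?D n (Suc i) l r) f) w)
      = (\<Sum>r<n + m. \<Sum>l<n + m. if r = x then if l = y then par_sign (par n x * par n y) *\<^sub>C f (p @ y # x # q) else 0 else 0)"
      by (intro sum.cong refl t) auto
    also have "\<dots> = (\<Sum>r<n + m. if r = x then par_sign (par n x * par n y) *\<^sub>C f (p @ y # x # q) else 0)"
      using w by (intro sum.cong refl) simp
    also have "\<dots> = app (swap_endo ?D n i) f w"
      using w D i1 by (simp add: app_swap_split)
    finally show ?thesis by simp
  qed (simp add: app_swap_endo app_letter_op)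
  then show "app (swap_endo ?D n i) f w = app (\<Sum>r<n + m. \<Sum>l<n + m. par_sign (par n l) *\<^sub>C
    (letter_op ?D n i r l * letter_op ?D n (Suc i) l r)) f w"
    by (simp add: app_sum_left sum_fun_apply scaleC_fun_def)
qed

lemma app_1: "app 1 = id"
  by (simp add: fun_eq_iff)

text \<open>Because E_ij E_ji = E_ii, the scalar is the superdimension n - m. A nonempty matrix is
  needed to determine it uniquely.\<close>

lemma casimir_V_eq:
  assumes "0 < n + m"
  shows "casimir_V n m = (\<Sum>j<n + m. par_sign (par n j))"
proof -
  define k where "k = (\<Sum>j<n + m. par_sign (par n j))"
  have entry: "(\<Sum>i<n + m. \<Sum>j<n + m. par_sign (par n j) * (mat_E n m i j * mat_E n m j i) $$ (r, c))
      = (if r = c then k else 0)" if "r < n + m" "c < n + m" for r c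
  proof -
    have *: "(mat_E n m i j * mat_E n m j i) $$ (r, c) = (if r = i \<and> c = i then 1 else 0)" if "j < n + m" for i j
      unfolding mat_E_mult[OF that] using \<open>r < n + m\<close> \<open>c < n + m\<close> by (simp add: mat_E_def)
    have "(\<Sum>i<n + m. \<Sum>j<n + m. par_sign (par n j) * (mat_E n m i j * mat_E n m j i) $$ (r, c))
        = (\<Sum>i<n + m. if i = r then (if r = c then k else 0) else 0)"
      unfolding k_def using that by (intro sum.cong refl) (auto simp: *)
    then show ?thesis using that by simp
  qed
  have eq: "mat (n + m) (n + m) (\<lambda>rc. \<Sum>i<n + m. \<Sum>j<n + m. par_sign (par n j) * (mat_E n m i j * mat_E n m j i) $$ rc)
      = k \<cdot>\<^sub>m 1\<^sub>m (n + m)"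
    by (rule eq_matI) (auto simp: entry)
  show ?thesis
    unfolding casimir_V_def eq k_def[symmetric]
  proof (rule the_equality)
    fix c assume "k \<cdot>\<^sub>m 1\<^sub>m (n + m) = c \<cdot>\<^sub>m (1\<^sub>m (n + m) :: complex mat)"
    then have "(k \<cdot>\<^sub>m 1\<^sub>m (n + m)) $$ (0, 0) = (c \<cdot>\<^sub>m (1\<^sub>m (n + m) :: complex mat)) $$ (0, 0)" by simp
    then show "c = k" using assms by simp
  qed simp
qed

context two_modules
begin

sublocale act: braid_action "n + m" d "par n" unit eop swop
proof
  show "eop F i j * unit = eop F i j" "unit * eop F i j = eop F i j" for F i j
    by (rule unit_eop)+
  show "swop i * unit = swop i" "unit * swop i = swop i" for i
    by (rule unit_swop)+
  fix i assume i: "i \<in> {1..<d}"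
  show "swop i * swop i = unit" by (rule swap_endo_square[OF i])
  \<comment> \<open>Both legs bring the same sign operator on M and N, and its square is the
    unit.\<close>
  have letop: "pw (signs s) * letop i r l * (pw (signs s) * letop (Suc i) l r) = letop i r l * letop (Suc i) l r" for s r l
  proof -
    have "pw (signs s) * letop i r l * (pw (signs s) * letop (Suc i) l r)
        = pw (signs s) * (letop i r l * pw (signs s)) * letop (Suc i) l r"
      by (simp add: mult.assoc)
    also have "\<dots> = pw (signs s) * pw (signs s) * (letop i r l * letop (Suc i) l r)"
      unfolding pointwise_letter_op[symmetric] by (simp add: mult.assoc)
    also have "\<dots> = unit * letop i r l * letop (Suc i) l r"
      by (simp only: pw_mult signs_mult bit_self_simps signs_0 mult.assoc)
    finally show ?thesis by simp
  qed
  show "swop i = split_casimir (n + m) (par n) (eop (FV i)) (eop (FV (Suc i)))"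
    unfolding split_casimir_def swap_endo_casimir[OF i]
    by (intro sum.cong refl) (simp add: letop add.commute[of "par n _" "par n _"])
  fix F r l assume F: "F \<in> all_factors d" and l: "r < n + m" "l < n + m"
  show "swop i * eop F r l = eop (move_factor (transpose i (Suc i)) F) r l * swop i"
  proof (cases F)
    case (FV k)
    then have k: "k \<in> {1..d}" using F by (auto simp: all_factors_def)
    have "swop i * eop F r l = pw (signs (par n r + par n l)) * (swop i * letop k r l)"
      using FV by (simp add: pointwise_swap_endo[symmetric] flip: mult.assoc)
    then show ?thesis
      using FV unfolding swap_endo_letter_op[OF i k l(2)] by (simp add: mult.assoc)
  qed (simp_all add: pointwise_swap_endo)
qed (simp_all add: pw_mult eop_comm eop_rep eop_V_mult eop_V_sum del: factor_op.simps)

end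

section \<open>Quotients and free algebras\<close>

text \<open>Compatibility with the left factor gives c x = (c 1) x, so that ring ideals are closed
  under scalars.\<close>

definition complex_algebra :: "(complex, 'a) module \<Rightarrow> bool" where
  "complex_algebra A \<longleftrightarrow> ring A \<and>
     (\<forall>c. \<forall>x \<in> carrier A. c \<odot>\<^bsub>A\<^esub> x \<in> carrier A) \<and>
     (\<forall>c. \<forall>x \<in> carrier A. \<forall>y \<in> carrier A. c \<odot>\<^bsub>A\<^esub> (x \<oplus>\<^bsub>A\<^esub> y) = c \<odot>\<^bsub>A\<^esub> x \<oplus>\<^bsub>A\<^esub> c \<odot>\<^bsub>A\<^esub> y) \<and>
     (\<forall>c. \<forall>x \<in> carrier A. \<forall>y \<in> carrier A. c \<odot>\<^bsub>A\<^esub> (x \<otimes>\<^bsub>A\<^esub> y) = (c \<odot>\<^bsub>A\<^esub> x) \<otimes>\<^bsub>A\<^esub> y)"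

lemma alg_homI:
  assumes "\<And>x. x \<in> carrier A \<Longrightarrow> h x \<in> carrier B"
    and "\<And>x y. x \<in> carrier A \<Longrightarrow> y \<in> carrier A \<Longrightarrow> h (x \<otimes>\<^bsub>A\<^esub> y) = h x \<otimes>\<^bsub>B\<^esub> h y"
    and "\<And>x y. x \<in> carrier A \<Longrightarrow> y \<in> carrier A \<Longrightarrow> h (x \<oplus>\<^bsub>A\<^esub> y) = h x \<oplus>\<^bsub>B\<^esub> h y"
    and "h \<one>\<^bsub>A\<^esub> = \<one>\<^bsub>B\<^esub>"
    and "\<And>c x. x \<in> carrier A \<Longrightarrow> h (c \<odot>\<^bsub>A\<^esub> x) = c \<odot>\<^bsub>B\<^esub> h x"
  shows "h \<in> alg_hom A B"
  using assms by (simp add: alg_hom_def Ring.ring_hom_def Pi_iff)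

lemma alg_homD:
  assumes "h \<in> alg_hom A B"
  shows "x \<in> carrier A \<Longrightarrow> h x \<in> carrier B"
    and "x \<in> carrier A \<Longrightarrow> y \<in> carrier A \<Longrightarrow> h (x \<otimes>\<^bsub>A\<^esub> y) = h x \<otimes>\<^bsub>B\<^esub> h y"
    and "x \<in> carrier A \<Longrightarrow> y \<in> carrier A \<Longrightarrow> h (x \<oplus>\<^bsub>A\<^esub> y) = h x \<oplus>\<^bsub>B\<^esub> h y"
    and "h \<one>\<^bsub>A\<^esub> = \<one>\<^bsub>B\<^esub>"
    and "x \<in> carrier A \<Longrightarrow> h (c \<odot>\<^bsub>A\<^esub> x) = c \<odot>\<^bsub>B\<^esub> h x"
  using assms by (simp_all add: alg_hom_def Ring.ring_hom_def Pi_iff)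

lemma alg_hom_comp:
  assumes f: "f \<in> alg_hom A B" and g: "g \<in> alg_hom B C"
  shows "(\<lambda>x. g (f x)) \<in> alg_hom A C"
  by (rule alg_homI) (simp_all add: alg_homD[OF f] alg_homD[OF g])

lemma complex_algebra_ring: "complex_algebra A \<Longrightarrow> ring A"
  by (simp add: complex_algebra_def)

lemma ring_extend:
  fixes R :: "'a ring" and more :: 'm
  assumes "ring R"
  shows "ring (ring.extend R more)"
proof -
  interpret ring R by (rule assms)
  show ?thesis
  proof (rule ringI)
    show "abelian_group (ring.extend R more)"
      by (rule abelian_groupI) (auto simp: ring.defs a_assoc intro: a_comm l_neg)
    show "monoid (ring.extend R more)"
      by (rule monoidI) (auto simp: ring.defs m_assoc)
  qed (auto simp: ring.defs l_distr r_distr)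
qed

lemma quot_alg_simps [simp]:
  "carrier (quot_alg A I) = carrier (A Quot I)"
  "x \<otimes>\<^bsub>quot_alg A I\<^esub> y = x \<otimes>\<^bsub>A Quot I\<^esub> y"
  "x \<oplus>\<^bsub>quot_alg A I\<^esub> y = x \<oplus>\<^bsub>A Quot I\<^esub> y"
  "\<one>\<^bsub>quot_alg A I\<^esub> = \<one>\<^bsub>A Quot I\<^esub>"
  "\<zero>\<^bsub>quot_alg A I\<^esub> = \<zero>\<^bsub>A Quot I\<^esub>"
  "c \<odot>\<^bsub>quot_alg A I\<^esub> u = (\<Union>x\<in>u. I +>\<^bsub>A\<^esub> (c \<odot>\<^bsub>A\<^esub> x))"
  by (simp_all add: quot_alg_def ring.defs)

context
  fixes A :: "(complex, 'a) module" (structure) and I :: "'a set"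
  assumes A: "complex_algebra A" and I: "ideal I A"
begin

lemma smult_closed: "x \<in> carrier A \<Longrightarrow> c \<odot> x \<in> carrier A"
  using A by (simp add: complex_algebra_def)

lemma coset_eq_iff: "x \<in> carrier A \<Longrightarrow> y \<in> carrier A \<Longrightarrow> I +> x = I +> y \<longleftrightarrow> x \<ominus> y \<in> I"
  using ring.quotient_eq_iff_same_a_r_cos[OF complex_algebra_ring[OF A] I] by simp

lemma quot_carrierE:
  assumes "u \<in> carrier (A Quot I)"
  obtains x where "x \<in> carrier A" "u = I +> x"
  using assms by (auto simp: FactRing_def A_RCOSETS_def')

lemma quot_carrierI: "x \<in> carrier A \<Longrightarrow> I +> x \<in> carrier (A Quot I)"
  by (auto simp: FactRing_def A_RCOSETS_def')

lemma quot_add: "x \<in> carrier A \<Longrightarrow> y \<in> carrier A \<Longrightarrow> (I +> x) \<oplus>\<^bsub>A Quot I\<^esub> (I +> y) = I +> (x \<oplus> y)"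
proof -
  have "abelian_subgroup I A"
    by (rule abelian_subgroupI3[OF ideal.axioms(1)[OF I] ring.is_abelian_group[OF complex_algebra_ring[OF A]]])
  then show "x \<in> carrier A \<Longrightarrow> y \<in> carrier A \<Longrightarrow> (I +> x) \<oplus>\<^bsub>A Quot I\<^esub> (I +> y) = I +> (x \<oplus> y)"
    by (simp add: FactRing_def abelian_subgroup.a_rcos_sum)
qed

lemma quot_mult: "x \<in> carrier A \<Longrightarrow> y \<in> carrier A \<Longrightarrow> (I +> x) \<otimes>\<^bsub>A Quot I\<^esub> (I +> y) = I +> (x \<otimes> y)"
  by (simp add: FactRing_def ideal.rcoset_mult_add[OF I])

lemma quot_one: "\<one>\<^bsub>A Quot I\<^esub> = I +> \<one>"
  by (simp add: FactRing_def)

text \<open>All representatives give the same coset, so the union that defines the scalar action of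
  \<open>quot_alg\<close> is a single coset.\<close>

lemma smult_coset:
  assumes x: "x \<in> carrier A"
  shows "(\<Union>y\<in>I +> x. I +> (c \<odot> y)) = I +> (c \<odot> x)"
proof -
  interpret ring A by (rule complex_algebra_ring[OF A])
  have "I +> (c \<odot> y) = I +> (c \<odot> x)" if y: "y \<in> I +> x" for y
  proof -
    obtain i where i: "i \<in> I" "y = i \<oplus> x"
      using y by (auto simp: a_r_coset_def')
    have ic: "i \<in> carrier A" using i(1) ideal.Icarr[OF I] by blast
    have "c \<odot> i = c \<odot> (\<one> \<otimes> i)" using ic by simp
    also have "\<dots> = (c \<odot> \<one>) \<otimes> i"
      using A ic one_closed unfolding complex_algebra_def by blast
    finally have "c \<odot> i \<in> I"
      using ideal.I_l_closed[OF I i(1) smult_closed[OF one_closed]] by simp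
    moreover have "c \<odot> y = c \<odot> i \<oplus> c \<odot> x"
      using A ic x i(2) unfolding complex_algebra_def by blast
    then have "c \<odot> y \<ominus> c \<odot> x = c \<odot> i"
      using ic x smult_closed by (simp add: a_minus_def a_assoc r_neg)
    moreover have "y \<in> carrier A" using i(2) ic x by simp
    ultimately show ?thesis
      using coset_eq_iff smult_closed x by simp
  qed
  moreover have "x \<in> I +> x"
    using x additive_subgroup.zero_closed[OF ideal.axioms(1)[OF I]] by (force simp: a_r_coset_def')
  ultimately show ?thesis by blast
qed

lemma quot_smult: "x \<in> carrier A \<Longrightarrow> c \<odot>\<^bsub>quot_alg A I\<^esub> (I +> x) = I +> (c \<odot> x)"
  by (simp add: smult_coset)

lemma complex_algebra_quot: "complex_algebra (quot_alg A I)"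
proof -
  have s: "c \<odot> (x \<oplus> y) = c \<odot> x \<oplus> c \<odot> y" "c \<odot> (x \<otimes> y) = (c \<odot> x) \<otimes> y"
    if "x \<in> carrier A" "y \<in> carrier A" for c x y
    using A that unfolding complex_algebra_def by blast+
  interpret ring A by (rule complex_algebra_ring[OF A])
  show ?thesis
    unfolding complex_algebra_def
  proof (intro conjI allI ballI)
    show "ring (quot_alg A I)"
      unfolding quot_alg_def by (rule ring_extend[OF ideal.quotient_is_ring[OF I]])
  next
    fix c u assume "u \<in> carrier (quot_alg A I)"
    then obtain x where x: "x \<in> carrier A" "u = I +> x" unfolding quot_alg_simps by (rule quot_carrierE)
    then show "c \<odot>\<^bsub>quot_alg A I\<^esub> u \<in> carrier (quot_alg A I)"
      by (simp only: quot_smult quot_alg_simps(1) quot_carrierI smult_closed)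
  next
    fix c u v assume "u \<in> carrier (quot_alg A I)" "v \<in> carrier (quot_alg A I)"
    then obtain x y where x: "x \<in> carrier A" "u = I +> x" and y: "y \<in> carrier A" "v = I +> y"
      unfolding quot_alg_simps by (elim quot_carrierE)
    show "c \<odot>\<^bsub>quot_alg A I\<^esub> (u \<oplus>\<^bsub>quot_alg A I\<^esub> v)
        = c \<odot>\<^bsub>quot_alg A I\<^esub> u \<oplus>\<^bsub>quot_alg A I\<^esub> c \<odot>\<^bsub>quot_alg A I\<^esub> v"
      using x(1) y(1) unfolding x(2) y(2)
      by (simp only: quot_smult quot_alg_simps(3) quot_add smult_closed a_closed s)
    show "c \<odot>\<^bsub>quot_alg A I\<^esub> (u \<otimes>\<^bsub>quot_alg A I\<^esub> v)
        = (c \<odot>\<^bsub>quot_alg A I\<^esub> u) \<otimes>\<^bsub>quot_alg A I\<^esub> v"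
      using x(1) y(1) unfolding x(2) y(2)
      by (simp only: quot_smult quot_alg_simps(2) quot_mult smult_closed m_closed s)
  qed
qed

lemma quot_class_hom: "(\<lambda>x. I +> x) \<in> alg_hom A (quot_alg A I)"
  by (rule alg_homI)
    (simp_all only: quot_alg_simps(1-4) quot_add quot_mult quot_smult quot_carrierI quot_one)

end

text \<open>The kernel of h is an ideal containing S, hence I. This is applied twice: to the free
  algebra, for the existence of \<rho>, and to the braid algebra, for \<Psi>. Extensionality makes
  the factorisation unique as a HOL function.\<close>

lemma quot_alg_universal:
  fixes A :: "(complex, 'a) module" and B :: "(complex, 'b) module"
  assumes A: "complex_algebra A" and B: "ring B" and S: "S \<subseteq> carrier A"
    and h: "h \<in> alg_hom A B" and zero: "\<And>s. s \<in> S \<Longrightarrow> h s = \<zero>\<^bsub>B\<^esub>"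
  defines "I \<equiv> Idl\<^bsub>A\<^esub> S"
  shows "\<exists>!\<Psi>. \<Psi> \<in> alg_hom (quot_alg A I) B \<and> \<Psi> \<in> extensional (carrier (quot_alg A I)) \<and>
    (\<forall>g \<in> carrier A. \<Psi> (I +>\<^bsub>A\<^esub> g) = h g)"
proof -
  interpret A: ring A by (rule complex_algebra_ring[OF A])
  interpret B: ring B by (rule B)
  have I: "ideal I A" unfolding I_def by (rule A.genideal_ideal[OF S])
  have hr: "h \<in> Ring.ring_hom A B"
    using h unfolding alg_hom_def by blast
  have rhr: "ring_hom_ring A B h"
    by (rule ring_hom_ringI2[OF A.ring_axioms B hr])
  have "S \<subseteq> a_kernel A B h"
    using S zero unfolding a_kernel_def' by blast
  then have "I \<subseteq> a_kernel A B h"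
    unfolding I_def by (rule A.genideal_minimal[OF ring_hom_ring.kernel_is_ideal[OF rhr]])
  then have ker: "h x = \<zero>\<^bsub>B\<^esub>" if "x \<in> I" for x
    using that unfolding a_kernel_def' by blast
  define \<Psi> where "\<Psi> = (\<lambda>u \<in> carrier (quot_alg A I). h (SOME x. x \<in> carrier A \<and> u = I +>\<^bsub>A\<^esub> x))"
  have \<Psi>: "\<Psi> (I +>\<^bsub>A\<^esub> g) = h g" if g: "g \<in> carrier A" for g
  proof -
    define x where "x = (SOME x. x \<in> carrier A \<and> I +>\<^bsub>A\<^esub> g = I +>\<^bsub>A\<^esub> x)"
    have x: "x \<in> carrier A \<and> I +>\<^bsub>A\<^esub> g = I +>\<^bsub>A\<^esub> x"
      unfolding x_def by (rule someI[of _ g]) (use g in simp)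
    then have "g \<ominus>\<^bsub>A\<^esub> x \<in> I"
      using coset_eq_iff[OF A I g, of x] by simp
    then have "h (g \<ominus>\<^bsub>A\<^esub> x) = \<zero>\<^bsub>B\<^esub>" by (rule ker)
    moreover have "g = (g \<ominus>\<^bsub>A\<^esub> x) \<oplus>\<^bsub>A\<^esub> x"
      using g x by (simp add: a_minus_def A.a_assoc A.l_neg)
    then have "h g = h (g \<ominus>\<^bsub>A\<^esub> x) \<oplus>\<^bsub>B\<^esub> h x"
      using alg_homD(3)[OF h, of "g \<ominus>\<^bsub>A\<^esub> x" x] g x A.minus_closed by metis
    ultimately have "h g = h x"
      using alg_homD(1)[OF h] x B.l_zero by metis
    then show ?thesis
      using quot_carrierI[OF A I g] by (simp add: \<Psi>_def x_def)
  qed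
  have hom: "\<Psi> \<in> alg_hom (quot_alg A I) B"
  proof (rule alg_homI)
    fix u assume "u \<in> carrier (quot_alg A I)"
    then obtain x where x: "x \<in> carrier A" "u = I +>\<^bsub>A\<^esub> x"
      unfolding quot_alg_simps by (rule quot_carrierE[OF A I])
    show "\<Psi> u \<in> carrier B" using x(1) alg_homD(1)[OF h] by (simp add: x(2) \<Psi>)
    show "\<Psi> (c \<odot>\<^bsub>quot_alg A I\<^esub> u) = c \<odot>\<^bsub>B\<^esub> \<Psi> u" for c
      using x(1) unfolding x(2)
      by (simp only: quot_smult[OF A I] \<Psi> smult_closed[OF A I] alg_homD(5)[OF h])
  next
    fix u v assume "u \<in> carrier (quot_alg A I)" "v \<in> carrier (quot_alg A I)"
    then obtain x y where x: "x \<in> carrier A" "u = I +>\<^bsub>A\<^esub> x" and y: "y \<in> carrier A" "v = I +>\<^bsub>A\<^esub> y"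
      unfolding quot_alg_simps by (elim quot_carrierE[OF A I])
    show "\<Psi> (u \<otimes>\<^bsub>quot_alg A I\<^esub> v) = \<Psi> u \<otimes>\<^bsub>B\<^esub> \<Psi> v" "\<Psi> (u \<oplus>\<^bsub>quot_alg A I\<^esub> v) = \<Psi> u \<oplus>\<^bsub>B\<^esub> \<Psi> v"
      using x(1) y(1) unfolding x(2) y(2)
      by (simp_all only: quot_alg_simps(2,3) quot_add[OF A I] quot_mult[OF A I] \<Psi> A.m_closed A.a_closed
          alg_homD(2,3)[OF h])
  next
    show "\<Psi> \<one>\<^bsub>quot_alg A I\<^esub> = \<one>\<^bsub>B\<^esub>"
      by (simp only: quot_alg_simps(4) quot_one[OF A I] \<Psi> A.one_closed alg_homD(4)[OF h])
  qed
  show ?thesis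
  proof (rule ex1I[of _ \<Psi>])
    show "\<Psi> \<in> alg_hom (quot_alg A I) B \<and> \<Psi> \<in> extensional (carrier (quot_alg A I)) \<and>
      (\<forall>g \<in> carrier A. \<Psi> (I +>\<^bsub>A\<^esub> g) = h g)"
    proof (intro conjI ballI)
      show "\<Psi> \<in> extensional (carrier (quot_alg A I))"
        unfolding \<Psi>_def by (rule restrict_extensional)
    qed (simp_all only: hom \<Psi>)
  next
    fix \<Psi>' assume *: "\<Psi>' \<in> alg_hom (quot_alg A I) B \<and> \<Psi>' \<in> extensional (carrier (quot_alg A I)) \<and>
      (\<forall>g \<in> carrier A. \<Psi>' (I +>\<^bsub>A\<^esub> g) = h g)"
    show "\<Psi>' = \<Psi>"
    proof (rule extensionalityI)
      show "\<Psi>' \<in> extensional (carrier (quot_alg A I))" using * by simp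
      show "\<Psi> \<in> extensional (carrier (quot_alg A I))"
        unfolding \<Psi>_def by (rule restrict_extensional)
      fix u assume "u \<in> carrier (quot_alg A I)"
      then obtain x where "x \<in> carrier A" "u = I +>\<^bsub>A\<^esub> x"
        unfolding quot_alg_simps by (rule quot_carrierE[OF A I])
      then show "\<Psi>' u = \<Psi> u" using * \<Psi> by simp
    qed
  qed
qed

section \<open>Free algebras and evaluation\<close>

lemma letters_plus [simp]: "letters (u + w) = letters u @ letters w"
  by (simp add: plus_word_def)

lemma letters_zero [simp]: "letters 0 = []"
  by (simp add: zero_word_def)

lemma free_alg_simps [simp]:
  "f \<in> carrier (free_alg G) \<longleftrightarrow> (\<forall>w \<in> Poly_Mapping.keys f. set (letters w) \<subseteq> G)"
  "f \<otimes>\<^bsub>free_alg G\<^esub> g = f * g" "\<one>\<^bsub>free_alg G\<^esub> = 1" "\<zero>\<^bsub>free_alg G\<^esub> = 0" "f \<oplus>\<^bsub>free_alg G\<^esub> g = f + g"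
  "c \<odot>\<^bsub>free_alg G\<^esub> f = fscale c f"
  by (simp_all add: free_alg_def)

lemma fscale_add: "fscale c (f + g) = fscale c f + fscale c g"
  by (rule free_vs.scale_right_distrib)

text \<open>Scaling is left multiplication by a multiple of the empty word, so associativity
  suffices.\<close>

lemma fscale_mult: "fscale c (f * g) = fscale c f * (g :: 'k::monoid_add \<Rightarrow>\<^sub>0 complex)"
proof -
  have "fscale c f = Poly_Mapping.single 0 c * f" for f :: "'k \<Rightarrow>\<^sub>0 complex"
    by (induction f rule: poly_mapping_add_induct)
      (simp_all add: distrib_left fscale_add fscale_single mult_single)
  then show ?thesis by (simp add: mult.assoc)
qed

lemma complex_algebra_free_alg: "complex_algebra (free_alg G)"
proof -
  have add: "f + g \<in> carrier (free_alg G)" if "f \<in> carrier (free_alg G)" "g \<in> carrier (free_alg G)" for f g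
    using that Poly_Mapping.keys_add[of f g] unfolding free_alg_simps by blast
  have mult: "f * g \<in> carrier (free_alg G)" if "f \<in> carrier (free_alg G)" "g \<in> carrier (free_alg G)" for f g
    using that Poly_Mapping.keys_mult[of f g] unfolding free_alg_simps by force
  have one: "1 \<in> carrier (free_alg G)"
    by (simp flip: single_one)
  have uminus: "- f \<in> carrier (free_alg G)" if "f \<in> carrier (free_alg G)" for f
    using that by simp
  have scale: "fscale c f \<in> carrier (free_alg G)" if "f \<in> carrier (free_alg G)" for c f
    using that by (auto simp: in_keys_iff lookup_fscale)
  have "ring (free_alg G)"
  proof (rule ringI)
    show "abelian_group (free_alg G)"
    proof (rule abelian_groupI)
      fix f assume "f \<in> carrier (free_alg G)"
      then show "\<exists>g \<in> carrier (free_alg G). g \<oplus>\<^bsub>free_alg G\<^esub> f = \<zero>\<^bsub>free_alg G\<^esub>"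
        using uminus by (intro bexI[of _ "- f"]) (simp_all del: free_alg_simps(1))
    qed (use add in \<open>simp_all add: add_ac del: free_alg_simps(1)\<close>, simp)
    show "monoid (free_alg G)"
      by (rule monoidI) (use mult one in \<open>simp_all add: mult.assoc del: free_alg_simps(1)\<close>)
  qed (simp_all add: distrib_left distrib_right)
  then show ?thesis
    unfolding complex_algebra_def
    using scale by (simp add: fscale_add fscale_mult del: free_alg_simps(1))
qed

text \<open>The empty word goes to 1 of the ambient ring and not to the unit of the corner;
  relations are therefore tested after multiplication by \<open>P\<close>.\<close>

definition free_eval :: "('g \<Rightarrow> 'r::complex_alg) \<Rightarrow> ('g word \<Rightarrow>\<^sub>0 complex) \<Rightarrow> 'r" where
  "free_eval \<gamma> f = (\<Sum>w\<in>Poly_Mapping.keys f. Poly_Mapping.lookup f w *\<^sub>C prod_list (map \<gamma> (letters w)))"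

lemma free_eval_superset:
  assumes "finite S" "Poly_Mapping.keys f \<subseteq> S"
  shows "free_eval \<gamma> f = (\<Sum>w\<in>S. Poly_Mapping.lookup f w *\<^sub>C prod_list (map \<gamma> (letters w)))"
  unfolding free_eval_def using assms by (intro sum.mono_neutral_left) (auto simp: in_keys_iff)

lemma free_eval_add: "free_eval \<gamma> (f + g) = free_eval \<gamma> f + free_eval \<gamma> g"
proof -
  let ?S = "Poly_Mapping.keys f \<union> Poly_Mapping.keys g"
  have "Poly_Mapping.keys (f + g) \<subseteq> ?S" by (rule Poly_Mapping.keys_add)
  then show ?thesis
    by (simp add: free_eval_superset[of ?S] lookup_add scaleC_add_left flip: sum.distrib)
qed

lemma free_eval_0: "free_eval \<gamma> 0 = 0"
  by (simp add: free_eval_def)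

lemma free_eval_single: "free_eval \<gamma> (Poly_Mapping.single w c) = c *\<^sub>C prod_list (map \<gamma> (letters w))"
  by (simp add: free_eval_superset[of "{w}"])

lemma free_eval_diff: "free_eval \<gamma> (f - g) = free_eval \<gamma> f - free_eval \<gamma> g"
  using free_eval_add[of \<gamma> "f - g" g] by (simp add: algebra_simps)

lemma free_eval_one: "free_eval \<gamma> 1 = 1"
  by (simp add: free_eval_single flip: single_one)

lemma free_eval_fscale: "free_eval \<gamma> (fscale c f) = c *\<^sub>C free_eval \<gamma> f"
proof -
  have "Poly_Mapping.keys (fscale c f) \<subseteq> Poly_Mapping.keys f"
    by (auto simp: in_keys_iff lookup_fscale)
  then show ?thesis
    by (simp add: free_eval_superset[of "Poly_Mapping.keys f"] lookup_fscale complex_vector.scale_sum_right)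
qed

lemma free_eval_mult: "free_eval \<gamma> (f * g) = free_eval \<gamma> f * free_eval \<gamma> g"
proof (induction f rule: poly_mapping_add_induct)
  case (add f k c)
  have "free_eval \<gamma> (Poly_Mapping.single k c * g) = free_eval \<gamma> (Poly_Mapping.single k c) * free_eval \<gamma> g"
    by (induction g rule: poly_mapping_add_induct)
      (simp_all add: distrib_left free_eval_add free_eval_single free_eval_0 mult_single mult.commute)
  then show ?case using add by (simp add: distrib_right free_eval_add)
qed (simp add: free_eval_0)

lemma free_eval_sum: "free_eval \<gamma> (\<Sum>i\<in>I. f i) = (\<Sum>i\<in>I. free_eval \<gamma> (f i))"
  by (induction I rule: infinite_finite_induct) (simp_all add: free_eval_0 free_eval_add)

lemma free_eval_letter: "free_eval \<gamma> (letter g) = \<gamma> g"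
  by (simp add: letter_def free_eval_single)

lemmas free_eval_simps = free_eval_add free_eval_diff free_eval_0 free_eval_one free_eval_mult
  free_eval_fscale free_eval_sum free_eval_letter

lemma free_alg_hom_eq:
  fixes G :: "gen set"
  assumes h: "h \<in> alg_hom (free_alg G) B" and h': "h' \<in> alg_hom (free_alg G) B"
    and eq: "\<And>g. g \<in> G \<Longrightarrow> h (letter g) = h' (letter g)"
    and f: "f \<in> carrier (free_alg G)"
  shows "h f = h' f"
proof -
  have letter: "letter g \<in> carrier (free_alg G)" if "g \<in> G" for g
    using that by (simp add: letter_def)
  have one: "1 \<in> carrier (free_alg G)"
    by (simp flip: single_one)
  have hom: "k (x + y) = k x \<oplus>\<^bsub>B\<^esub> k y" "k (x * y) = k x \<otimes>\<^bsub>B\<^esub> k y" "k (fscale c x) = c \<odot>\<^bsub>B\<^esub> k x"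
    if "k \<in> {h, h'}" "x \<in> carrier (free_alg G)" "y \<in> carrier (free_alg G)" for k x y c
    using h h' that unfolding alg_hom_def Ring.ring_hom_def by (auto simp del: free_alg_simps(1))
  have h1: "h 1 = h' 1"
    using h h' unfolding alg_hom_def Ring.ring_hom_def by auto
  have mono: "h (Poly_Mapping.single w 1) = h' (Poly_Mapping.single w 1)" if "set (letters w) \<subseteq> G" for w
    using that
  proof (induction "letters w" arbitrary: w)
    case Nil
    then have "w = 0" by (cases w) (simp add: zero_word_def)
    then show ?case using h1 by (simp add: single_one)
  next
    case (Cons g gs)
    have sub: "set (g # gs) \<subseteq> G"
      unfolding Cons(2) by (rule Cons(3))
    have "Poly_Mapping.single w (1::complex) = letter g * Poly_Mapping.single (Word gs) 1"
      using Cons(2) by (cases w) (simp add: letter_def mult_single plus_word_def)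
    moreover have "h (Poly_Mapping.single (Word gs) 1) = h' (Poly_Mapping.single (Word gs) 1)"
      by (rule Cons(1)) (use sub in auto)
    moreover have "g \<in> G" "Poly_Mapping.single (Word gs) 1 \<in> carrier (free_alg G)"
      using sub by auto
    ultimately show ?case
      using hom(2)[of h "letter g" "Poly_Mapping.single (Word gs) 1"]
        hom(2)[of h' "letter g" "Poly_Mapping.single (Word gs) 1"] letter eq
      by (simp del: free_alg_simps(1))
  qed
  have "f \<in> carrier (free_alg G) \<longrightarrow> h f = h' f"
  proof (induction f rule: poly_mapping_add_induct)
    case zero
    \<comment> \<open>Preservation of 0 is not among the conditions of \<open>alg_hom\<close>, and
      the target is an arbitrary record, so 0 is written as a scalar multiple.\<close>
    have "fscale 0 1 = (0 :: free)"
      by (rule poly_mapping_eqI) (simp add: lookup_fscale)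
    then show ?case using hom(3)[of h 1 1 0] hom(3)[of h' 1 1 0] h1 one by simp
  next
    case (add f k c)
    show ?case
    proof
      assume *: "Poly_Mapping.single k c + f \<in> carrier (free_alg G)"
      have lk: "Poly_Mapping.lookup (Poly_Mapping.single k c + f) w
          = (if w = k then c else Poly_Mapping.lookup f w)" for w
        using add(1) by (auto simp: lookup_add lookup_single in_keys_iff)
      \<comment> \<open>Nothing cancels, because k is not a key of f; both summands stay in the
        carrier.\<close>
      then have f: "f \<in> carrier (free_alg G)" and k: "set (letters k) \<subseteq> G"
        using * add(1,2) unfolding free_alg_simps by (auto simp: in_keys_iff split: if_splits)
      have s: "Poly_Mapping.single k c = fscale c (Poly_Mapping.single k 1)" by (simp add: fscale_single)
      have kc: "Poly_Mapping.single k c \<in> carrier (free_alg G)" "Poly_Mapping.single k 1 \<in> carrier (free_alg G)"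
        using k by simp_all
      have "h (Poly_Mapping.single k c) = h' (Poly_Mapping.single k c)"
        using hom(3)[OF _ kc(2) kc(2), of h c] hom(3)[OF _ kc(2) kc(2), of h' c] mono[OF k] unfolding s by simp
      then show "h (Poly_Mapping.single k c + f) = h' (Poly_Mapping.single k c + f)"
        using hom(1)[OF _ kc(1) f, of h] hom(1)[OF _ kc(1) f, of h'] add(3) f by simp
    qed
  qed
  then show ?thesis using f by blast
qed

section \<open>The defining relations\<close>

context braid_action
begin

fun gen_val :: "gen \<Rightarrow> 'r" where
  "gen_val (GX i) = step_op {FM} i"
| "gen_val (GY i) = step_op {FN} i"
| "gen_val (GZ i) = (if i = 0 then zero_op else step_op {FM, FN} i)"
| "gen_val (GT i) = t i"

abbreviation "ev \<equiv> free_eval gen_val"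

text \<open>At j = 0 the two sides would be 1 and \<open>P\<close>.\<close>

lemma ev_transp: "1 \<le> j \<Longrightarrow> ev (transp i j) = transp_op i j"
proof (induction j)
  case (Suc j)
  then show ?case by (cases "j \<le> i") (simp_all add: free_eval_simps)
qed simp

lemma ev_m2:
  assumes "1 \<le> i" "i < j" "j \<le> d"
  shows "ev (m2 i j) = om (FV i) (FV j)"
proof (cases "j = i + 1")
  case True
  then show ?thesis
    using assms step_op_Suc[of i "{FM}"] t_casimir[of i] by (simp add: m2_def free_eval_simps om_def)
next
  case False
  obtain r where r: "j = r + 1" using assms by (metis Suc_eq_plus1 less_imp_Suc_add)
  have "step_op {FM} (r + 1) - t r * step_op {FM} r * t r = t r"
    by (rule step_op_Suc) (use assms r in auto)
  then show ?thesis
    using False assms r transp_op_conj[of i j] by (simp add: m2_def free_eval_simps ev_transp)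
qed

lemma ev_sum_Z: "ev (\<Sum>k\<in>{0..i}. Z k) = zero_op + (\<Sum>k\<in>{1..i}. step_op {FM, FN} k)"
proof -
  have "(\<Sum>k\<in>{0..i}. gen_val (GZ k)) = gen_val (GZ 0) + (\<Sum>k\<in>{1..i}. gen_val (GZ k))"
    by (simp add: sum.atLeast_Suc_atMost)
  also have "(\<Sum>k\<in>{1..i}. gen_val (GZ k)) = (\<Sum>k\<in>{1..i}. step_op {FM, FN} k)"
    by (intro sum.cong) auto
  finally show ?thesis by (simp add: free_eval_simps)
qed

text \<open>The factor \<open>P\<close> is decisive for T_i T_i - 1, whose value is \<open>P\<close>
  - 1.\<close>

lemma ev_braid_relators:
  assumes "r \<in> braid_relators d"
  shows "ev r * P = 0"
proof -
  consider "r \<in> polynomial_relators d" | "r \<in> symmetric_relators d" | "r \<in> R1 d" | "r \<in> R2 d" | "r \<in> R3 d"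
    | "r \<in> R4 d" | "r \<in> R5 d" | "r \<in> R6 d"
    using assms unfolding braid_relators_def by blast
  then show ?thesis
  proof cases
    case 1
    have z: "gen_val (GZ i) * gen_val (GZ j) = gen_val (GZ j) * gen_val (GZ i)" if "i \<le> d" "j \<le> d" for i j
      using that zero_op_commute step_op_commute[of "{FM, FN}" i j] by auto
    show ?thesis
      using 1 step_op_commute[of "{FM}"] step_op_commute[of "{FN}"] z unfolding polynomial_relators_def
      by (auto simp: free_eval_simps simp del: gen_val.simps(3))
  next
    case 2
    have "ev (T i * T i - 1) * P = 0" if "i \<in> {1..<d}" for i
      using t_t[OF that] by (simp add: free_eval_simps left_diff_distrib)
    moreover have "ev (T i * T j - T j * T i) = 0" if "i \<in> {1..<d}" "j \<in> {1..<d}" "i + 1 < j" for i j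
      using t_commute[OF that] by (simp add: free_eval_simps)
    moreover have "ev (T i * T (i + 1) * T i - T (i + 1) * T i * T (i + 1)) = 0" if "1 \<le> i" "i + 1 < d" for i
      using braid[OF that] by (simp add: free_eval_simps)
    ultimately show ?thesis
      using 2 unfolding symmetric_relators_def by auto
  next
    case 3
    then show ?thesis
      using t_step_op t_zero_op unfolding R1_def by (auto simp: free_eval_simps)
  next
    case 4
    have "ev ((\<Sum>k\<in>{0..i}. Z k) * letter g - letter g * (\<Sum>k\<in>{0..i}. Z k)) = 0"
      if "g = GX j \<or> g = GY j" "1 \<le> j" "j \<le> i" "i \<le> d" for i j g
      using that sum_commute[of "{FM}" j i] sum_commute[of "{FN}" j i]
      unfolding free_eval_diff free_eval_mult ev_sum_Z free_eval_letter by auto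
    with 4 show ?thesis unfolding R2_def by auto
  next
    case 5
    then show ?thesis
      using t_step_op_sum[of _ "{FM}"] t_step_op_sum[of _ "{FN}"] unfolding R3_def
      by (auto simp: free_eval_simps)
  next
    case 6
    have "t i * t (i + 1) * (step_op S (i + 1) - t i * step_op S i * t i) * t (i + 1) * t i
        - (step_op S (i + 2) - t (i + 1) * step_op S (i + 1) * t (i + 1)) = 0"
      if "1 \<le> i" "i + 2 \<le> d" "S = {FM} \<or> S = {FN}" for i S
      using that step_op_Suc[of i S] step_op_Suc[of "i + 1" S] braid_conj[of i] by auto
    with 6 show ?thesis unfolding R4_def by (auto simp: free_eval_simps)
  next
    case 7
    then show ?thesis
      using step_op_Suc[of _ "{FM}"] step_op_Suc[of _ "{FN}"] unfolding R5_def
      by (auto simp: free_eval_simps)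
  next
    case 8
    then obtain i where i: "i \<in> {1..d}" "r = Z i - (X i + Y i - m1 i)" unfolding R6_def by blast
    have "ev (m1 i) = (\<Sum>k\<in>{1..<i}. om (FV k) (FV i))"
      unfolding m1_def free_eval_sum using i(1) by (intro sum.cong refl ev_m2) auto
    then show ?thesis
      using i step_op_both[OF i(1)] by (simp add: free_eval_simps)
  qed
qed

lemma ev_hecke_relators:
  assumes d: "1 \<le> d"
    and QM: "\<And>k j. k < L \<Longrightarrow> j < L \<Longrightarrow> rect_tensor L \<pi> a p (e FM) k j * P = 0"
    and QN: "\<And>k j. k < L \<Longrightarrow> j < L \<Longrightarrow> rect_tensor L \<pi> b q (e FN) k j * P = 0"
    and r: "r \<in> hecke_relators d a b p q"
  shows "ev r * P = 0"
proof -
  \<comment> \<open>Constants in the relators evaluate to multiples of 1; the factor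
    \<open>P\<close> turns them into multiples of the unit of the corner.\<close>
  have quad: "(step_op S 1 - c *\<^sub>C 1) * (step_op S 1 + c' *\<^sub>C 1) * P = (step_op S 1 - c *\<^sub>C P) * (step_op S 1 + c' *\<^sub>C P)"
    for S c c'
    by (simp add: left_diff_distrib right_diff_distrib distrib_left distrib_right mult.assoc)
  have "t i * step_op S i * t i + t i = step_op S (i + 1)" if "i \<in> {1..<d}" "S = {FM} \<or> S = {FN}" for S i
    using step_op_Suc[OF that(1), of S] that(2) by (auto simp: algebra_simps)
  then show ?thesis
    using r hecke_quadratic[OF _ d QM] hecke_quadratic[OF _ d QN] unfolding hecke_relators_def
    by (auto simp: free_eval_simps quad simp del: One_nat_def)
qed

end

section \<open>The endomorphism algebra\<close>

context two_modules
begin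

abbreviation "W \<equiv> tspace n m d :: (nat list \<Rightarrow> ('a, 'b) tensor) set"

lemma app_unit: "app unit f w = (if w \<in> D then f w else 0)"
  by (simp add: app_pointwise)

lemma tspace_iff: "f \<in> W \<longleftrightarrow> app unit f = f"
  by (auto simp: tspace_def fun_eq_iff app_unit)

lemma app_in_tspace: "unit * g = g \<Longrightarrow> app g f \<in> W"
  unfolding tspace_iff app_ring(5)[symmetric] by (simp only:)

lemma app_tmap_eq:
  "app (tmap (unit_op n m M i j) (1 :: 'b endo)) = tensor_map (act M (mat_E n m i j)) id"
  "app (tmap (sign_op M s) (unit_op n m N i j)) = tensor_map (par_op M s) (act N (mat_E n m i j))"
  "app (signs s) = tensor_map (par_op M s) (par_op N s)"
  by (simp_all only: app_tmap app_unit_op[OF M] app_unit_op[OF N] app_sign_op[OF M] app_sign_op[OF N] app_1)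

lemma E_factor_eq:
  assumes F: "F \<in> all_factors d" and l: "i < n + m" "j < n + m" and f: "f \<in> W"
  shows "E_factor n m M N i j F f = app (eop F i j) f"
proof
  fix w
  have f0: "f w = 0" if "w \<notin> D" for w using f that by (simp add: tspace_def)
  show "E_factor n m M N i j F f w = app (eop F i j) f w"
  proof (cases F)
    case FM
    then show ?thesis by (cases "w \<in> D") (simp_all add: app_pointwise f0 flip: app_tmap_eq)
  next
    case FN
    then show ?thesis by (cases "w \<in> D") (simp_all add: app_pointwise f0 flip: app_tmap_eq)
  next
    case (FV k)
    then have k: "1 \<le> k" "k \<le> d" using F by (auto simp: all_factors_def)
    show ?thesis
    proof (cases "w \<in> D")
      case True
      then have "length w = d" "w[k - 1 := j] \<in> D"
        using words_update[OF True l(2)] by (simp_all add: words_def del: One_nat_def)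
      then show ?thesis
        using FV k True
        by (simp add: app_pointwise app_letter_op app_linear del: One_nat_def flip: app_tmap_eq)
    next
      case False
      \<comment> \<open>Changing the letter back to i would return the word w to D.\<close>
      have "w[k - 1 := j] \<notin> D" if "k \<le> length w" "w ! (k - 1) = i"
      proof
        assume "w[k - 1 := j] \<in> D"
        from words_update[OF this l(1), of "k - 1"] have "w[k - 1 := i] \<in> D" by simp
        then show False using False that(2) by (metis list_update_id)
      qed
      then show ?thesis
        using FV False by (auto simp: app_pointwise f0 simp del: One_nat_def simp flip: app_tmap_eq)
    qed
  qed
qed

lemma E_on_eq:
  assumes "S \<subseteq> all_factors d" "i < n + m" "j < n + m" "f \<in> W"
  shows "E_on n m M N S i j f = app (act.e_sum S i j) f"
proof
  fix w
  have "E_on n m M N S i j f w = (\<Sum>F\<in>S. app (eop F i j) f w)"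
    unfolding E_on_def using assms by (intro sum.cong refl) (simp add: E_factor_eq subset_iff)
  then show "E_on n m M N S i j f w = app (act.e_sum S i j) f w"
    by (simp only: act.e_sum_def app_sum_left sum_fun_apply)
qed

lemma casimir_on_eq:
  assumes "S \<subseteq> all_factors d" "f \<in> W"
  shows "casimir_on n m M N S f = app (act.cas S) f"
proof
  fix w
  have "E_on n m M N S i j (E_on n m M N S j i f) = app (act.e_sum S i j * act.e_sum S j i) f"
    if "i < n + m" "j < n + m" for i j
    using E_on_eq[OF assms(1) that(2,1) assms(2)] E_on_eq[OF assms(1) that app_in_tspace[OF act.P_e_sum(1)]]
    by simp
  then have "casimir_on n m M N S f w
      = (\<Sum>i<n + m. \<Sum>j<n + m. par_sign (par n j) *\<^sub>C app (act.e_sum S i j * act.e_sum S j i) f w)"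
    unfolding casimir_on_def by (intro sum.cong refl) simp
  then show "casimir_on n m M N S f w = app (act.cas S) f w"
    by (simp only: act.cas_def split_casimir_def app_sum_left sum_fun_apply app_ring scaleC_fun_def)
qed

lemma casimir_step_eq:
  assumes "0 < n + m" "S \<subseteq> {FM, FN}" "i \<in> {1..d}" "f \<in> W"
  shows "casimir_step n m M N S i f = app (act.step_op S i) f"
proof
  fix w
  have S: "S \<union> FV ` {1..i} \<subseteq> all_factors d" "S \<union> FV ` {1..i - 1} \<subseteq> all_factors d"
    using assms by (auto simp: all_factors_def)
  have "app unit f = f" using assms(4) by (simp add: tspace_iff)
  then show "casimir_step n m M N S i f w = app (act.step_op S i) f w"
    unfolding casimir_step_def casimir_on_eq[OF S(1) assms(4)] casimir_on_eq[OF S(2) assms(4)]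
      casimir_V_eq[OF assms(1)] act.step_op_def act.cas_V_def
    by (simp add: scaleC_fun_def)
qed

lemma swap_op_eq:
  assumes "i \<in> {1..<d}" "f \<in> W"
  shows "swap_op n i f = app (swop i) f"
proof
  fix w
  show "swap_op n i f w = app (swop i) f w"
  proof (cases "w \<in> D")
    case True
    then show ?thesis using words_swap[OF True assms(1)] by (simp add: swap_op_def app_swap_endo)
  next
    case False
    have "w[i - 1 := w ! i, i := w ! (i - 1)] \<notin> D"
    proof
      assume *: "w[i - 1 := w ! i, i := w ! (i - 1)] \<in> D"
      then have "length w = d" by (simp add: words_def)
      then have "set (w[i - 1 := w ! i, i := w ! (i - 1)]) = set w"
        using assms(1) by (intro set_swap) auto
      then show False using * False by (simp add: words_def)
    qed
    then show ?thesis using False assms(2) by (simp add: swap_op_def app_swap_endo tspace_def)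
  qed
qed

lemma gen_op_eq:
  assumes "0 < n + m" "g \<in> gens d" "f \<in> W"
  shows "gen_op n m M N g f = app (act.gen_val g) f"
proof -
  have "casimir_zero n m M N f = app act.zero_op f"
  proof
    fix w
    have S: "{FM, FN} \<subseteq> all_factors d" "{FM} \<subseteq> all_factors d" "{FN} \<subseteq> all_factors d"
      by (auto simp: all_factors_def)
    show "casimir_zero n m M N f w = app act.zero_op f w"
      unfolding casimir_zero_def act.zero_op_def casimir_on_eq[OF S(1) assms(3)]
        casimir_on_eq[OF S(2) assms(3)] casimir_on_eq[OF S(3) assms(3)]
      by (simp add: scaleC_fun_def)
  qed
  then show ?thesis
    using assms casimir_step_eq swap_op_eq by (cases g) (auto simp: gens_def)
qed

section \<open>Endomorphisms as restrictions of operators on all coefficient functions\<close>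

definition parity_op :: "(nat list \<Rightarrow> ('a, 'b) tensor) endo" where
  "parity_op = pw (signs 1) * total_sign n m d"

definition total_op :: "nat \<Rightarrow> nat \<Rightarrow> (nat list \<Rightarrow> ('a, 'b) tensor) endo" where
  "total_op = act.e_sum (all_factors d)"

text \<open>Commuting with \<open>unit\<close> is asked instead of lying in the corner, so that 1 is
  included and values of \<open>free_eval\<close> qualify.\<close>

definition equivariant :: "(nat list \<Rightarrow> ('a, 'b) tensor) endo \<Rightarrow> bool" where
  "equivariant g \<longleftrightarrow> unit * g = g * unit \<and> parity_op * g = g * parity_op \<and>
     (\<forall>i<n + m. \<forall>j<n + m. total_op i j * g = g * total_op i j)"

definition res :: "(nat list \<Rightarrow> ('a, 'b) tensor) endo \<Rightarrow> ('a, 'b) top" where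
  "res g = restrict (app g) W"

lemma commute_mult:
  fixes c f g :: "'r::complex_alg"
  assumes "c * f = f * c" "c * g = g * c"
  shows "c * (f * g) = (f * g) * c"
proof -
  have "c * (f * g) = (c * f) * g" by (simp only: mult.assoc)
  also have "\<dots> = f * (c * g)" by (simp only: assms(1) mult.assoc)
  finally show ?thesis by (simp only: assms(2) mult.assoc)
qed

lemma equivariant_closed:
  "equivariant 0" "equivariant 1"
  "equivariant f \<Longrightarrow> equivariant g \<Longrightarrow> equivariant (f + g)"
  "equivariant f \<Longrightarrow> equivariant (c *\<^sub>C f)"
  "equivariant f \<Longrightarrow> equivariant g \<Longrightarrow> equivariant (f * g)"
proof -
  show "equivariant f \<Longrightarrow> equivariant g \<Longrightarrow> equivariant (f * g)"
    unfolding equivariant_def using commute_mult by blast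
qed (simp_all add: equivariant_def distrib_left distrib_right)

lemma equivariant_in_tspace:
  assumes "equivariant g" "f \<in> W"
  shows "app g f \<in> W"
proof -
  have "app unit (app g f) = app g (app unit f)"
    using assms(1) unfolding equivariant_def app_ring(5)[symmetric] by (simp only:)
  then show ?thesis using assms(2) unfolding tspace_iff by simp
qed

lemma parity_op_unit: "unit * parity_op = parity_op" "parity_op * unit = parity_op"
proof -
  have c: "pw (signs 1) * total_sign n m d = total_sign n m d * pw (signs 1)"
    by (rule endo_eqI) (simp add: fun_eq_iff app_pointwise app_total_sign app_linear)
  have "unit * parity_op = unit * pw (signs 1) * total_sign n m d"
    by (simp only: parity_op_def mult.assoc)
  then show "unit * parity_op = parity_op" by (simp add: parity_op_def pw_mult)
  have "parity_op * unit = total_sign n m d * (pw (signs 1) * unit)"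
    by (simp only: parity_op_def c mult.assoc)
  then show "parity_op * unit = parity_op" by (simp add: parity_op_def pw_mult c)
qed

lemma tpar_eq: "f \<in> W \<Longrightarrow> tpar n M N f = app parity_op f"
proof
  fix w assume "f \<in> W"
  then have "f w = 0" if "w \<notin> D" using that by (simp add: tspace_def)
  then show "tpar n M N f w = app parity_op f w"
    by (cases "w \<in> D")
      (simp_all add: tpar_def parity_op_def app_pointwise app_total_sign app_linear flip: app_tmap_eq)
qed

lemma total_op_eq: "i < n + m \<Longrightarrow> j < n + m \<Longrightarrow> f \<in> W \<Longrightarrow> E_on n m M N (all_factors d) i j f = app (total_op i j) f"
  unfolding total_op_def by (rule E_on_eq) simp_all

lemma res_carrier:
  assumes "equivariant g"
  shows "res g \<in> carrier (End_gl n m d M N)"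
proof -
  have W: "(\<lambda>w. f w + h w) = f + h" "(\<lambda>w. c *\<^sub>C f w) = c *\<^sub>C f" for f h :: "nat list \<Rightarrow> ('a, 'b) tensor" and c
    by (simp_all add: fun_eq_iff scaleC_fun_def)
  have WW: "f + h \<in> W" "c *\<^sub>C f \<in> W" if "f \<in> W" "h \<in> W" for f h c
    using that by (simp_all add: tspace_iff app_linear)
  have par: "app parity_op f \<in> W" for f
    by (rule app_in_tspace[OF parity_op_unit(1)])
  have tot: "app (total_op i j) f \<in> W" for i j f
    unfolding total_op_def by (rule app_in_tspace[OF act.P_e_sum(1)])
  have "app g (app parity_op f) = app parity_op (app g f)"
    "i < n + m \<Longrightarrow> j < n + m \<Longrightarrow> app g (app (total_op i j) f) = app (total_op i j) (app g f)" for f i j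
    using assms unfolding equivariant_def app_ring(5)[symmetric] by (simp_all only:)
  then show ?thesis
    unfolding End_gl_def res_def
    using equivariant_in_tspace[OF assms] WW par tot
    by (simp add: W tpar_eq total_op_eq app_linear)
qed

text \<open>An endomorphism of the tensor space is extended by composing it with the projection. The
  ring axioms of \<open>End_gl\<close> can then be read off from those of
  \<open>endo\<close>.\<close>

lemma End_carrierE:
  assumes F: "F \<in> carrier (End_gl n m d M N)"
  obtains g where "equivariant g" "F = res g"
proof
  have F': "F \<in> W \<rightarrow>\<^sub>E W"
    "\<And>f g. f \<in> W \<Longrightarrow> g \<in> W \<Longrightarrow> F (\<lambda>w. f w + g w) = (\<lambda>w. F f w + F g w)"
    "\<And>c f. f \<in> W \<Longrightarrow> F (\<lambda>w. c *\<^sub>C f w) = (\<lambda>w. c *\<^sub>C F f w)"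
    "\<And>f. f \<in> W \<Longrightarrow> F (tpar n M N f) = tpar n M N (F f)"
    "\<And>i j f. i < n + m \<Longrightarrow> j < n + m \<Longrightarrow> f \<in> W \<Longrightarrow>
      F (E_on n m M N (all_factors d) i j f) = E_on n m M N (all_factors d) i j (F f)"
    using F by (auto simp: End_gl_def)
  define g where "g = Endo (\<lambda>f. F (app unit f))"
  have u: "app unit f \<in> W" for f by (rule app_in_tspace) (simp add: pw_mult)
  have FW: "F f \<in> W" if "f \<in> W" for f using F'(1) that by auto
  have g: "app g f = F (app unit f)" for f
  proof -
    have "F (app unit u + app unit v) = F (app unit u) + F (app unit v)" for u v
      using F'(2)[OF u u] by (simp only: plus_fun_def)
    moreover have "F (c *\<^sub>C app unit v) = c *\<^sub>C F (app unit v)" for c v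
      using F'(3)[OF u] by (simp only: scaleC_fun_def)
    ultimately have "clinear (\<lambda>f. F (app unit f))"
      by (simp add: clinear_iff app_linear)
    then show ?thesis by (simp add: g_def app_Endo)
  qed
  have uf: "app unit f = f" if "f \<in> W" for f using that by (simp add: tspace_iff)
  show "F = res g"
    unfolding res_def
    by (rule extensionalityI[of _ W]) (use F'(1) in \<open>auto simp: g uf PiE_def\<close>)
  show "equivariant g"
    unfolding equivariant_def
  proof (intro conjI allI impI)
    show "unit * g = g * unit"
      by (rule endo_eqI) (simp add: g uf[OF FW[OF u]] uf[OF u])
    have par: "app parity_op (app unit f) = app parity_op f" "app unit (app parity_op f) = app parity_op f" for f
      unfolding app_ring(5)[symmetric] by (simp_all only: parity_op_unit)
    show "parity_op * g = g * parity_op"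
      using F'(4)[OF u] by (intro endo_eqI) (simp add: g par tpar_eq u FW)
    fix i j assume l: "i < n + m" "j < n + m"
    have tot: "app (total_op i j) (app unit f) = app (total_op i j) f"
      "app unit (app (total_op i j) f) = app (total_op i j) f" for f
      unfolding app_ring(5)[symmetric] total_op_def by (simp_all only: act.P_e_sum)
    show "total_op i j * g = g * total_op i j"
      using F'(5)[OF l u] by (intro endo_eqI) (simp add: g tot total_op_eq l u FW)
  qed
qed

lemma res_simps:
  "\<zero>\<^bsub>End_gl n m d M N\<^esub> = res 0" "\<one>\<^bsub>End_gl n m d M N\<^esub> = res 1"
  "res f \<oplus>\<^bsub>End_gl n m d M N\<^esub> res g = res (f + g)"
  "c \<odot>\<^bsub>End_gl n m d M N\<^esub> res f = res (c *\<^sub>C f)"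
  "equivariant g \<Longrightarrow> res f \<otimes>\<^bsub>End_gl n m d M N\<^esub> res g = res (f * g)"
  using equivariant_in_tspace[of g]
  by (auto simp: End_gl_def res_def fun_eq_iff restrict_def compose_def scaleC_fun_def)

lemma ring_End: "ring (End_gl n m d M N)"
proof (rule ringI)
  note res_intros = res_carrier equivariant_closed
  show "abelian_group (End_gl n m d M N)"
  proof (rule abelian_groupI)
    fix F assume "F \<in> carrier (End_gl n m d M N)"
    then obtain f where f: "equivariant f" "F = res f" by (rule End_carrierE)
    then have "res (- 1 *\<^sub>C f) \<oplus>\<^bsub>End_gl n m d M N\<^esub> F = \<zero>\<^bsub>End_gl n m d M N\<^esub>"
      by (simp add: res_simps)
    then show "\<exists>G \<in> carrier (End_gl n m d M N). G \<oplus>\<^bsub>End_gl n m d M N\<^esub> F = \<zero>\<^bsub>End_gl n m d M N\<^esub>"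
      using f by (blast intro: res_intros)
  qed (auto elim!: End_carrierE simp: res_simps add_ac res_intros)
  show "monoid (End_gl n m d M N)"
    by (rule monoidI) (auto elim!: End_carrierE simp: res_simps mult.assoc res_intros)
qed (auto elim!: End_carrierE simp: res_simps distrib_left distrib_right equivariant_closed)

section \<open>The generators preserve parity and commute with the action\<close>

lemma parity_split_casimir:
  assumes "\<And>i j. parity_op * A i j = par_sign (par n i + par n j) *\<^sub>C (A i j * parity_op)"
    and "\<And>i j. parity_op * B i j = par_sign (par n i + par n j) *\<^sub>C (B i j * parity_op)"
  shows "parity_op * split_casimir (n + m) (par n) A B = split_casimir (n + m) (par n) A B * parity_op"
proof -
  have "parity_op * (A i j * B j i) = A i j * B j i * parity_op" for i j
  proof -
    have "parity_op * (A i j * B j i) = (parity_op * A i j) * B j i" by (simp add: mult.assoc)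
    also have "\<dots> = par_sign (par n i + par n j) *\<^sub>C (A i j * (parity_op * B j i))"
      unfolding assms(1) by (simp add: mult.assoc)
    also have "\<dots> = A i j * B j i * parity_op"
      unfolding assms(2) by (simp add: mult.assoc add.commute[of "par n j"])
    finally show ?thesis .
  qed
  then show ?thesis
    by (simp add: split_casimir_def sum_distrib_left sum_distrib_right)
qed

lemma total_sign_pw: "total_sign n m d * pw g = pw g * total_sign n m d"
  by (rule endo_eqI) (simp add: fun_eq_iff app_pointwise app_total_sign app_linear)

lemma total_sign_letop:
  assumes "k \<in> {1..d}"
  shows "total_sign n m d * letop k i j = par_sign (par n i + par n j) *\<^sub>C (letop k i j * total_sign n m d)"
proof (rule endo_eqI, rule ext)
  fix f :: "nat list \<Rightarrow> ('a, 'b) tensor" and w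
  have "par_sign (word_par n w) = par_sign (par n i + par n j) * par_sign (word_par n (w[k - 1 := j]))"
    if "w \<in> D" "w ! (k - 1) = i"
  proof -
    have "word_par n (w[k - 1 := j]) = word_par n w + par n i + par n j"
      using that assms by (subst word_par_update) (auto simp: words_def)
    then show ?thesis by (cases "par n i"; cases "par n j"; cases "word_par n w"; simp)
  qed
  then show "app (total_sign n m d * letop k i j) f w
      = app (par_sign (par n i + par n j) *\<^sub>C (letop k i j * total_sign n m d)) f w"
    by (auto simp: app_total_sign app_letter_op scaleC_fun_def mult_ac simp del: One_nat_def)
qed

lemma parity_eop:
  assumes "F \<in> all_factors d"
  shows "parity_op * eop F i j = par_sign (par n i + par n j) *\<^sub>C (eop F i j * parity_op)"
proof -
  define s where "s = par n i + par n j"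
  have pull: "parity_op * pw g = pw (signs 1 * g) * total_sign n m d" for g
    unfolding parity_op_def by (simp add: mult.assoc total_sign_pw flip: pw_mult)
  have push: "pw g * parity_op = pw (g * signs 1) * total_sign n m d" for g
    unfolding parity_op_def by (simp flip: pw_mult mult.assoc)
  have gM: "sign_op M 1 * unit_op n m M i j = par_sign s *\<^sub>C (unit_op n m M i j * sign_op M 1)"
    using sign_op_unit_op[OF M, of 1 i j] by (simp add: s_def)
  have gN: "sign_op N 1 * unit_op n m N i j = par_sign s *\<^sub>C (unit_op n m N i j * sign_op N 1)"
    using sign_op_unit_op[OF N, of 1 i j] by (simp add: s_def)
  show ?thesis
  proof (cases F)
    case FM
    then show ?thesis
      unfolding s_def[symmetric]
      by (simp add: pull push tmap_mult gM tmap_scale pw_linear)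
  next
    case FN
    then show ?thesis
      unfolding factor_op.simps s_def[symmetric]
      by (simp add: pull push tmap_mult gN tmap_scale pw_linear sign_op_mult[OF M] add.commute s_def[symmetric])
  next
    case (FV k)
    then have k: "k \<in> {1..d}" using assms by (auto simp: all_factors_def)
    have c: "signs 1 * signs s = signs s * signs 1" by (simp add: signs_mult add.commute)
    have "parity_op * eop F i j = pw (signs 1 * signs s) * (total_sign n m d * letop k i j)"
      unfolding FV factor_op.simps s_def[symmetric] by (simp add: pull flip: mult.assoc)
    also have "\<dots> = par_sign s *\<^sub>C (pw (signs s) * (pw (signs 1) * letop k i j) * total_sign n m d)"
      unfolding total_sign_letop[OF k] s_def[symmetric] c by (simp add: mult.assoc flip: pw_mult)
    also have "pw (signs s) * (pw (signs 1) * letop k i j) * total_sign n m d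
        = pw (signs s) * letop k i j * parity_op"
      unfolding pointwise_letter_op[of _ "signs 1"] parity_op_def by (simp only: mult.assoc)
    finally show ?thesis unfolding FV factor_op.simps s_def[symmetric] .
  qed
qed

lemma parity_cas: "S \<subseteq> all_factors d \<Longrightarrow> parity_op * act.cas S = act.cas S * parity_op"
  unfolding act.cas_def
  by (rule parity_split_casimir)
    (auto simp: act.e_sum_def sum_distrib_left sum_distrib_right complex_vector.scale_sum_right
      intro!: sum.cong parity_eop simp del: factor_op.simps)

lemma equivariant_cas: "S \<subseteq> all_factors d \<Longrightarrow> equivariant (act.cas S)"
  using act.cas_commute_e_sum[of "all_factors d" S] parity_cas
  by (simp add: equivariant_def total_op_def)

lemma equivariant_diff: "equivariant f \<Longrightarrow> equivariant g \<Longrightarrow> equivariant (f - g)"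
  by (simp add: equivariant_def left_diff_distrib right_diff_distrib)

lemma equivariant_unit: "equivariant unit"
  by (simp add: equivariant_def total_op_def parity_op_unit)

text \<open>As a split Casimir operator t_i is even, and it permutes the full set of factors, hence
  commutes with the total action.\<close>

lemma equivariant_swop:
  assumes i: "i \<in> {1..<d}"
  shows "equivariant (swop i)"
proof -
  have "parity_op * swop i = swop i * parity_op"
    unfolding act.t_casimir[OF i]
    by (rule parity_split_casimir; rule parity_eop) (use i in \<open>auto simp: all_factors_def\<close>)
  moreover have "move_factor (transpose i (Suc i)) ` all_factors d = all_factors d"
  proof -
    have "{FM, FN} \<union> FV ` {1..d} = all_factors d" by (auto simp: all_factors_def)
    then show ?thesis using act.move_factors[of "{FM, FN}" d i] i by simp
  qed
  ultimately show ?thesis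
    using act.t_e_sum[OF i subset_refl] by (simp add: equivariant_def total_op_def unit_swop)
qed

lemma equivariant_step_op: "S \<subseteq> {FM, FN} \<Longrightarrow> i \<le> d \<Longrightarrow> equivariant (act.step_op S i)"
  unfolding act.step_op_def
  by (intro equivariant_closed equivariant_diff equivariant_cas equivariant_unit) (auto simp: all_factors_def)

lemma equivariant_zero_op: "equivariant act.zero_op"
  unfolding act.zero_op_def
  by (intro equivariant_closed equivariant_diff equivariant_cas) (auto simp: all_factors_def)

lemma equivariant_gen_val: "g \<in> gens d \<Longrightarrow> equivariant (act.gen_val g)"
  using equivariant_step_op equivariant_zero_op equivariant_swop
  by (cases g) (auto simp: gens_def)

lemma equivariant_ev:
  assumes "f \<in> carrier (free_alg (gens d))"
  shows "equivariant (act.ev f)"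
proof -
  have prod: "equivariant (prod_list (map act.gen_val gs))" if "set gs \<subseteq> gens d" for gs
    using that by (induction gs) (simp_all add: equivariant_closed equivariant_gen_val)
  have sum: "equivariant (\<Sum>w\<in>I. h w)" if "finite I" "\<And>w. w \<in> I \<Longrightarrow> equivariant (h w)"
    for h :: "gen word \<Rightarrow> _" and I
    using that by (induction I rule: finite_induct) (simp_all add: equivariant_closed)
  show ?thesis
    unfolding free_eval_def using assms by (intro sum equivariant_closed prod) auto
qed

lemma res_ev_hom: "(\<lambda>f. res (act.ev f)) \<in> alg_hom (free_alg (gens d)) (End_gl n m d M N)"
  unfolding alg_hom_def Ring.ring_hom_def
  using equivariant_ev by (auto simp: res_simps free_eval_simps intro!: res_carrier simp del: free_alg_simps(1))

lemma res_eq_0: "g * unit = 0 \<Longrightarrow> res g = \<zero>\<^bsub>End_gl n m d M N\<^esub>"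
proof -
  assume g: "g * unit = 0"
  have "app g f = 0" if "f \<in> W" for f
  proof -
    have "app g f = app (g * unit) f" using that by (simp add: tspace_iff)
    then show ?thesis using g by simp
  qed
  then show ?thesis unfolding res_simps res_def by (auto simp: restrict_def fun_eq_iff)
qed

lemma rect_tensor_M:
  assumes "is_L n m (hook_weight n (rectangle a p)) M" "k < n + m" "j < n + m"
  shows "rect_tensor (n + m) (par n) (of_nat a) (of_nat p) (eop FM) k j * unit = 0"
proof -
  define h :: "'a endo \<Rightarrow> _" where "h x = pw (tmap x 1)" for x
  have "alg_map h" by (simp add: alg_map_def h_def tmap_add tmap_scale pw_linear)
  note hl = alg_mapD[OF this]
  have "rect_tensor (n + m) (par n) (of_nat a) (of_nat p) (eop FM) k j * unit
      = h (rect_tensor (n + m) (par n) (of_nat a) (of_nat p) (unit_op n m M) k j)"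
    unfolding rect_tensor_def adjoint_square_def hl if_distrib[of h]
    by (simp add: h_def left_diff_distrib distrib_right sum_distrib_right mult.assoc pw_mult tmap_mult)
  then show ?thesis
    unfolding rect_tensor_eq_0[OF assms] hl by simp
qed

text \<open>The vanishing on N is transported by x \<mapsto> sign \<otimes> x with the sign operator
  on M of parity k + j. This fits all terms: E_ij E_ki has parity k + j for every i, and the
  constant occurs only for k = j, where the sign operator is 1.\<close>

lemma rect_tensor_N:
  assumes "is_L n m (hook_weight n (rectangle b q)) N" "k < n + m" "j < n + m"
  shows "rect_tensor (n + m) (par n) (of_nat b) (of_nat q) (eop FN) k j * unit = 0"
proof -
  define h :: "'b endo \<Rightarrow> _" where "h x = pw (tmap (sign_op M (par n k + par n j)) x)" for x
  have "alg_map h" by (simp add: alg_map_def h_def tmap_add tmap_scale pw_linear)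
  note hl = alg_mapD[OF this]
  have s: "par n i + par n j + (par n k + par n i) = par n k + par n j" for i
    by (cases "par n i"; cases "par n j"; cases "par n k"; simp)
  have sq: "eop FN i j * eop FN k i = h (unit_op n m N i j * unit_op n m N k i)" for i
    unfolding eop_N_mult s h_def ..
  have lin: "eop FN k j = h (unit_op n m N k j)" by (simp add: h_def)
  have const: "k = j \<Longrightarrow> unit = h 1" by (simp add: h_def sign_op_0[OF M])
  have "rect_tensor (n + m) (par n) (of_nat b) (of_nat q) (eop FN) k j * unit
      = h (rect_tensor (n + m) (par n) (of_nat b) (of_nat q) (unit_op n m N) k j)"
    unfolding rect_tensor_def adjoint_square_def hl if_distrib[of h] sq lin
    by (auto simp: left_diff_distrib distrib_right sum_distrib_right const simp flip: sq lin
        simp: mult.assoc unit_eop simp del: factor_op.simps)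
  then show ?thesis
    unfolding rect_tensor_eq_0[OF assms] hl by simp
qed

end

section \<open>The induced representation\<close>

lemma free_carrier_closed:
  "1 \<in> carrier (free_alg G)" "g \<in> G \<Longrightarrow> letter g \<in> carrier (free_alg G)"
  "f \<in> carrier (free_alg G) \<Longrightarrow> h \<in> carrier (free_alg G) \<Longrightarrow> f + h \<in> carrier (free_alg G)"
  "f \<in> carrier (free_alg G) \<Longrightarrow> h \<in> carrier (free_alg G) \<Longrightarrow> f - h \<in> carrier (free_alg G)"
  "f \<in> carrier (free_alg G) \<Longrightarrow> h \<in> carrier (free_alg G) \<Longrightarrow> f * h \<in> carrier (free_alg G)"
  "f \<in> carrier (free_alg G) \<Longrightarrow> fscale c f \<in> carrier (free_alg G)"
  "(\<And>i. i \<in> I \<Longrightarrow> k i \<in> carrier (free_alg G)) \<Longrightarrow> (\<Sum>i\<in>I. k i) \<in> carrier (free_alg G)"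
proof -
  interpret ring "free_alg G" by (rule complex_algebra_ring[OF complex_algebra_free_alg])
  show one: "1 \<in> carrier (free_alg G)" using one_closed unfolding free_alg_simps(3) .
  show "g \<in> G \<Longrightarrow> letter g \<in> carrier (free_alg G)" by (simp add: letter_def)
  show add: "f + h \<in> carrier (free_alg G)" if "f \<in> carrier (free_alg G)" "h \<in> carrier (free_alg G)" for f h
    using a_closed[OF that] unfolding free_alg_simps(5) .
  show "f \<in> carrier (free_alg G) \<Longrightarrow> h \<in> carrier (free_alg G) \<Longrightarrow> f * h \<in> carrier (free_alg G)"
    using m_closed[of f h] unfolding free_alg_simps(2) .
  show scale: "fscale c f \<in> carrier (free_alg G)" if "f \<in> carrier (free_alg G)" for c f
    using that by (auto simp: in_keys_iff lookup_fscale)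
  show "f - h \<in> carrier (free_alg G)" if "f \<in> carrier (free_alg G)" "h \<in> carrier (free_alg G)"
    using add[OF that(1) scale[OF that(2), of "- 1"]] by simp
  have "0 \<in> carrier (free_alg G)" by simp
  then show "(\<And>i. i \<in> I \<Longrightarrow> k i \<in> carrier (free_alg G)) \<Longrightarrow> (\<Sum>i\<in>I. k i) \<in> carrier (free_alg G)"
    by (induction I rule: infinite_finite_induct) (auto intro: add simp del: free_alg_simps(1))
qed

lemma gens_iff: "GX i \<in> gens d \<longleftrightarrow> i \<in> {1..d}" "GY i \<in> gens d \<longleftrightarrow> i \<in> {1..d}"
  "GZ i \<in> gens d \<longleftrightarrow> i \<le> d" "GT i \<in> gens d \<longleftrightarrow> i \<in> {1..<d}"
  by (auto simp: gens_def)

lemma m1_carrier: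
  assumes "j \<le> d"
  shows "m1 j \<in> carrier (free_alg (gens d))"
proof -
  have transp: "transp i k \<in> carrier (free_alg (gens d))" if "1 \<le> i" "i < d" "k \<le> d" for i k
    using that
  proof (induction k)
    case (Suc k)
    then show ?case
      by (cases "k \<le> i") (auto simp: gens_iff intro!: free_carrier_closed simp del: free_alg_simps(1))
  qed (simp add: free_carrier_closed del: free_alg_simps(1))
  have "m2 i j \<in> carrier (free_alg (gens d))" if "i \<in> {1..<j}" for i
    unfolding m2_def using that assms
    by (auto simp: gens_iff intro!: free_carrier_closed transp simp del: free_alg_simps(1))
  then show ?thesis
    unfolding m1_def by (rule free_carrier_closed)
qed

lemma braid_relators_carrier: "braid_relators d \<subseteq> carrier (free_alg (gens d))"
  unfolding braid_relators_def polynomial_relators_def symmetric_relators_def R1_def R2_def R3_def R4_def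
    R5_def R6_def
  by (auto simp: gens_iff intro!: free_carrier_closed m1_carrier simp del: free_alg_simps(1))

lemma hecke_relators_carrier: "1 \<le> d \<Longrightarrow> hecke_relators d a b p q \<subseteq> carrier (free_alg (gens d))"
  unfolding hecke_relators_def
  by (auto simp: gens_iff intro!: free_carrier_closed simp del: free_alg_simps(1))

text \<open>The existence of \<rho> is part of the claim, so that the assertion about every \<rho>
  is not vacuous.\<close>

theorem theorem1p2:
  fixes n m d a b p q :: nat
    and M :: "'a::complex_vector supermod"
    and N :: "'b::complex_vector supermod"
  assumes "1 \<le> d"
    and "0 < a" and "0 < b" and "0 < p" and "0 < q"
    and "a \<le> m" and "b \<le> m"
    and "int p - int n \<le> int a" and "int q - int n \<le> int b"
    and "is_L n m (hook_weight n (rectangle a p)) M"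
    and "is_L n m (hook_weight n (rectangle b q)) N"
  shows "(\<exists>\<rho>. is_rho n m d M N \<rho>) \<and>
    (\<forall>\<rho>. is_rho n m d M N \<rho> \<longrightarrow>
      (\<forall>r \<in> hecke_relators d (of_nat a) (of_nat b) (of_nat p) (of_nat q).
         \<rho> (braid_class d r) = \<zero>\<^bsub>End_gl n m d M N\<^esub>) \<and>
      (\<exists>!\<Psi>. \<Psi> \<in> alg_hom (hecke_alg d (of_nat a) (of_nat b) (of_nat p) (of_nat q))
                       (End_gl n m d M N) \<and>
             \<Psi> \<in> extensional
                   (carrier (hecke_alg d (of_nat a) (of_nat b) (of_nat p) (of_nat q))) \<and>
             (\<forall>g \<in> carrier (braid_alg d).
                \<Psi> (hecke_class d (of_nat a) (of_nat b) (of_nat p) (of_nat q) g) = \<rho> g)))"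
proof -
  interpret two_modules n m d M N
    by unfold_locales (use assms(10,11) in \<open>simp_all add: is_L_def irreducible_supermodule_def\<close>)
  let ?A = "free_alg (gens d)" and ?E = "End_gl n m d M N"
  let ?H = "hecke_relators d (of_nat a) (of_nat b) (of_nat p) (of_nat q)"
  \<comment> \<open>From 0 < a \<le> m; this makes \<open>casimir_V\<close> the intended
    scalar.\<close>
  have nm: "0 < n + m" using assms by simp
  have A: "complex_algebra ?A" by (rule complex_algebra_free_alg)
  interpret A: ring ?A by (rule complex_algebra_ring[OF A])
  have I: "ideal (braid_ideal d) ?A"
    unfolding braid_ideal_def by (rule A.genideal_ideal[OF braid_relators_carrier])
  have letter: "res (act.ev (letter g)) = restrict (gen_op n m M N g) (tspace n m d)" if "g \<in> gens d" for g
    unfolding res_def using gen_op_eq[OF nm that] by (intro restrict_ext) (simp add: free_eval_simps)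
  have zero: "res (act.ev r) = \<zero>\<^bsub>?E\<^esub>" if "r \<in> braid_relators d" for r
    by (rule res_eq_0[OF act.ev_braid_relators[OF that]])
  obtain \<rho> where "\<rho> \<in> alg_hom (braid_alg d) ?E"
    "\<forall>f \<in> carrier ?A. \<rho> (braid_class d f) = res (act.ev f)"
    using quot_alg_universal[OF A ring_End braid_relators_carrier res_ev_hom zero]
    unfolding braid_alg_def braid_class_def braid_ideal_def by (blast dest: ex1_implies_ex)
  then have "is_rho n m d M N \<rho>"
    unfolding is_rho_def using letter free_carrier_closed(2) by (simp del: free_alg_simps(1))
  moreover have "(\<forall>r \<in> ?H. \<rho> (braid_class d r) = \<zero>\<^bsub>?E\<^esub>) \<and>
      (\<exists>!\<Psi>. \<Psi> \<in> alg_hom (hecke_alg d (of_nat a) (of_nat b) (of_nat p) (of_nat q)) ?E \<and>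
             \<Psi> \<in> extensional (carrier (hecke_alg d (of_nat a) (of_nat b) (of_nat p) (of_nat q))) \<and>
             (\<forall>g \<in> carrier (braid_alg d).
                \<Psi> (hecke_class d (of_nat a) (of_nat b) (of_nat p) (of_nat q) g) = \<rho> g))"
    if rho: "is_rho n m d M N \<rho>" for \<rho>
  proof -
    have hom: "\<rho> \<in> alg_hom (braid_alg d) ?E" using rho by (simp add: is_rho_def)
    have "(\<lambda>f. braid_class d f) \<in> alg_hom ?A (braid_alg d)"
      unfolding braid_class_def braid_alg_def by (rule quot_class_hom[OF A I])
    then have hom': "(\<lambda>f. \<rho> (braid_class d f)) \<in> alg_hom ?A ?E"
      using hom by (rule alg_hom_comp)
    \<comment> \<open>On the free algebra any \<rho> is evaluation, since the two agree on letters;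
      the relations proved for the evaluation thus hold for an arbitrary \<rho>.\<close>
    have val: "\<rho> (braid_class d f) = res (act.ev f)" if "f \<in> carrier ?A" for f
      by (rule free_alg_hom_eq[OF hom' res_ev_hom _ that]) (use rho letter in \<open>simp add: is_rho_def\<close>)
    have vanish: "\<rho> (braid_class d r) = \<zero>\<^bsub>?E\<^esub>" if r: "r \<in> ?H" for r
    proof -
      have "act.ev r * unit = 0"
        by (rule act.ev_hecke_relators[OF assms(1) rect_tensor_M[OF assms(10)] rect_tensor_N[OF assms(11)] r])
      moreover have "r \<in> carrier ?A"
        using r hecke_relators_carrier[OF assms(1)] by blast
      ultimately show ?thesis
        using val[of r] res_eq_0[of "act.ev r"] by (simp del: free_alg_simps(1))
    qed
    have S: "braid_class d ` ?H \<subseteq> carrier (braid_alg d)"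
    proof (rule image_subsetI)
      fix r assume "r \<in> ?H"
      then have "r \<in> carrier ?A" by (rule subsetD[OF hecke_relators_carrier[OF assms(1)]])
      then show "braid_class d r \<in> carrier (braid_alg d)"
        unfolding braid_alg_def braid_class_def by (simp only: quot_alg_simps(1) quot_carrierI[OF A I])
    qed
    have B: "complex_algebra (braid_alg d)"
      unfolding braid_alg_def by (rule complex_algebra_quot[OF A I])
    show ?thesis
      using vanish quot_alg_universal[OF B ring_End S hom]
      unfolding hecke_alg_def hecke_class_def hecke_ideal_def by blast
  qed
  ultimately show ?thesis by blast
qed

end
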